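(* Let $N\ge 1$ be a real number and let $X$ be a compact metric space with finite Hausdorff measure $\mathcal{H}^N(X)<\infty$. Let $p,q\in(1,\infty)$ with $p^{-1}+q^{-1}=1$. Let $E,F$ be two disjoint continua in $X$, with $\Gamma(E,F)$ the family of curves connecting $E$ and $F$ and $\Sigma_H(E,F)$ the family of finite separating surface measures defined in the context. If $\operatorname{Mod}_p(\Gamma(E,F))>0$, then $$\left(\operatorname{Mod}_p \Gamma(E,F)\right)^{1/p}\left(\operatorname{Mod}_q \Sigma_H(E,F)\right)^{1/q}\ \ge\ \frac{v_N}{2v_{N-1}}.$$ Moreover, if $\operatorname{Mod}_p\Gamma(E,F)=0$, then $\operatorname{Mod}_q\Sigma_H(E,F)=\infty$.
   Context: A continuum is a nonempty, compact, connected set. Constants: $v_k:=\dfrac{\pi^{k/2}}{\Gamma_{\mathrm{Eul}}(\frac k2+1)}$ for real $k\ge 0$, where $\Gamma_{\mathrm{Eul}}(\frac k2+1)=\int_0^\infty x^{k/2}e^{-x}\,dx$ is the Gamma function. Hausdorff measure: for real $s\ge 0$, $\mathcal{H}^s(A):=\lim_{\delta\to0}\mathcal{H}^s_\delta(A)$, where $\mathcal{H}^s_\delta(A):=\frac{v_s}{2^s}\inf\{\sum_i \operatorname{diam}(A_i)^s : A\subset\bigcup_i A_i,\ \operatorname{diam}(A_i)<\delta\}$, the infimum being over countable covers; for $s=0$ the usual convention ($\operatorname{diam}(A)^0=1$ if $A\ne\emptyset$, $0$ if $A=\emptyset$) makes $\mathcal{H}^0$ the counting measure. The space $X$ is equipped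 with the measure $\mathcal{H}^N$. Curves: a curve in $X$ is a continuous map $\gamma:I\to X$ from a compact nonempty interval $I\subset\mathbb{R}$. $\Gamma(E,F)$ is the family of all curves in $X$ which connect $E$ to $F$. Separating surfaces: $\Sigma_H(E,F)$ is the family of all measures of the form $\mathcal{H}^{N-1}|_{\partial U}$ that are finite, where $U\subset X$ is open with $E\subset U$ and $F\subset\operatorname{int}(X\setminus U)$, and $\partial U$ is the topological boundary of $U$ in $X$. (The zero measure may belong to $\Sigma_H(E,F)$.) Modulus: for $1\le r<\infty$ and a family $\Gamma$ of curves in $X$, a Borel function $\rho:X\to[0,\infty]$ is admissible for $\Gamma$ if $\int_\gamma\rho\,ds\ge1$ for each rectifiable $\gamma\in\Gamma$ ($ds$ denotes arc length), and $\operatorname{Mod}_r(\Gamma):=\inf\int_X\rho^r\,d\mathcal{H}^N$ over all admissible $\rho$. For a family $\Sigma$ of finite Radon measures on $X$, $\operatorname{Mod}_r(\Sigma)$ is defined by the same formula, with admissibility replaced by $\int_X\rho\,d\sigma\ge1$ for every $\sigma\in\Sigma$. The infimum over the empty set is $\infty$. *)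

theory Defs
  imports "HOL-Analysis.Analysis"
begin

definition continuum :: "'a::topological_space set \<Rightarrow> bool" where
  "continuum S \<longleftrightarrow> S \<noteq> {} \<and> compact S \<and> connected S"

text \<open>Powers with exponent \<open>r > 0\<close> on \<open>[0,\<infinity>]\<close>.\<close>

definition ennreal_powr :: "ennreal \<Rightarrow> real \<Rightarrow> ennreal" (infixr \<open>epowr\<close> 80) where
  "x epowr r = (if x = top then top else ennreal (enn2real x powr r))"


section \<open>Hausdorff measure\<close>

text \<open>
  \<open>diam(A)\<^sup>s\<close> for bounded \<open>A\<close>. The case \<open>s = 0\<close> is separate because \<open>0 powr 0 = 0\<close> in the
  library, whereas singletons have to contribute \<open>1\<close> to the counting measure.
\<close>

definition diam_pow :: "real \<Rightarrow> 'a::metric_space set \<Rightarrow> ennreal" where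
  "diam_pow s A = (if A = {} then 0 else if s = 0 then 1 else ennreal (diameter A powr s))"

text \<open>
  Covers are indexed by \<open>nat\<close>; finite covers are included since empty sets contribute \<open>0\<close>.
  Boundedness is required explicitly because \<open>diameter\<close> is real-valued and unspecified on
  unbounded sets. The constant \<^term>\<open>unit_ball_vol s\<close> is \<open>v\<^sub>s\<close>.
\<close>

definition hausdorff_pre :: "real \<Rightarrow> real \<Rightarrow> 'a::metric_space set \<Rightarrow> ennreal" where
  "hausdorff_pre s \<delta> A = ennreal (unit_ball_vol s / 2 powr s) *
     (INF C \<in> {C :: nat \<Rightarrow> 'a set. A \<subseteq> (\<Union>i. C i) \<and> (\<forall>i. bounded (C i) \<and> diameter (C i) < \<delta>)}.
        \<Sum>i. diam_pow s (C i))"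

definition hausdorff_outer :: "real \<Rightarrow> 'a::metric_space set \<Rightarrow> ennreal" where
  "hausdorff_outer s A = Lim (at_right 0) (\<lambda>\<delta>. hausdorff_pre s \<delta> A)"

text \<open>
  The Borel measure \<open>\<H>\<^sup>s\<close>; \<open>emeasure_hausdorff\<close> below shows that it agrees with the outer
  measure on all Borel sets.
\<close>

definition hausdorff :: "real \<Rightarrow> 'a::metric_space measure" where
  "hausdorff s = measure_of UNIV (sets borel) (hausdorff_outer s)"


section \<open>Curves and line integrals\<close>

text \<open>A curve \<open>(a, b, \<gamma>)\<close> is the restriction of \<open>\<gamma>\<close> to the compact interval \<open>{a..b}\<close>.\<close>

type_synonym 'a curve = "real \<times> real \<times> (real \<Rightarrow> 'a)"

definition is_curve :: "'a::metric_space curve \<Rightarrow> bool" where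
  "is_curve = (\<lambda>(a, b, \<gamma>). a \<le> b \<and> continuous_on {a..b} \<gamma>)"

definition curve_length :: "'a::metric_space curve \<Rightarrow> ennreal" where
  "curve_length = (\<lambda>(a, b, \<gamma>).
     SUP (n, t) \<in> {(n :: nat, t :: nat \<Rightarrow> real). t 0 = a \<and> t n = b \<and> mono_on {..n} t}.
       \<Sum>i<n. ennreal (dist (\<gamma> (t i)) (\<gamma> (t (Suc i)))))"

definition rectifiable :: "'a::metric_space curve \<Rightarrow> bool" where
  "rectifiable c \<longleftrightarrow> is_curve c \<and> curve_length c < top"

text \<open>
  The arc length parametrization \<open>\<gamma>\<^sub>s : [0, \<ell>(\<gamma>)] \<rightarrow> X\<close> of a rectifiable curve, characterized by
  \<open>\<gamma> x = \<gamma>\<^sub>s (\<ell>(\<gamma> restricted to [a, x]))\<close>. The choice of \<open>x\<close> is immaterial, as \<open>\<gamma>\<close> is constant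
  wherever its length function is.
\<close>

definition arclength_param :: "'a::metric_space curve \<Rightarrow> real \<Rightarrow> 'a" where
  "arclength_param = (\<lambda>(a, b, \<gamma>) l.
     \<gamma> (SOME x. x \<in> {a..b} \<and> curve_length (a, x, \<gamma>) = ennreal l))"

definition line_integral :: "'a::metric_space curve \<Rightarrow> ('a \<Rightarrow> ennreal) \<Rightarrow> ennreal" where
  "line_integral c \<rho> =
     (\<integral>\<^sup>+ l \<in> {0..enn2real (curve_length c)}. \<rho> (arclength_param c l) \<partial>lborel)"

definition connecting_curves :: "'a::metric_space set \<Rightarrow> 'a set \<Rightarrow> 'a curve set" where
  "connecting_curves E F = {(a, b, \<gamma>). is_curve (a, b, \<gamma>) \<and> \<gamma> a \<in> E \<and> \<gamma> b \<in> F}"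


section \<open>Separating surface measures\<close>

text \<open>
  \<^term>\<open>density \<mu> (indicator S)\<close> is the restriction of \<open>\<mu>\<close> to \<open>S\<close>, regarded as a measure on
  the whole space.
\<close>

definition separating_measures ::
    "real \<Rightarrow> 'a::metric_space set \<Rightarrow> 'a set \<Rightarrow> 'a measure set" where
  "separating_measures N E F =
     {\<sigma>. finite_measure \<sigma> \<and>
         (\<exists>U. open U \<and> E \<subseteq> U \<and> F \<subseteq> interior (- U) \<and>
              \<sigma> = density (hausdorff (N - 1)) (indicator (frontier U)))}"


section \<open>Modulus\<close>

definition Mod_curves :: "real \<Rightarrow> real \<Rightarrow> 'a::metric_space curve set \<Rightarrow> ennreal" where
  "Mod_curves N r \<Gamma> =
     (INF \<rho> \<in> {\<rho> \<in> borel_measurable borel.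
                \<forall>c\<in>\<Gamma>. rectifiable c \<longrightarrow> line_integral c \<rho> \<ge> 1}.
        \<integral>\<^sup>+ x. \<rho> x epowr r \<partial>hausdorff N)"

definition Mod_measures :: "real \<Rightarrow> real \<Rightarrow> 'a::metric_space measure set \<Rightarrow> ennreal" where
  "Mod_measures N r \<Sigma> =
     (INF \<rho> \<in> {\<rho> \<in> borel_measurable borel. \<forall>\<sigma>\<in>\<Sigma>. (\<integral>\<^sup>+ x. \<rho> x \<partial>\<sigma>) \<ge> 1}.
        \<integral>\<^sup>+ x. \<rho> x epowr r \<partial>hausdorff N)"


section \<open>The Hausdorff measure is a Borel measure\<close>

lemma hausdorff_pre_antimono:
  fixes A :: "'a::metric_space set"
  assumes "\<delta> \<le> \<delta>'"
  shows "hausdorff_pre s \<delta>' A \<le> hausdorff_pre s \<delta> A"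
  unfolding hausdorff_pre_def
proof (rule mult_left_mono)
  show "(INF C \<in> {C :: nat \<Rightarrow> 'a set. A \<subseteq> (\<Union>i. C i) \<and> (\<forall>i. bounded (C i) \<and> diameter (C i) < \<delta>')}.
        \<Sum>i. diam_pow s (C i)) \<le>
      (INF C \<in> {C :: nat \<Rightarrow> 'a set. A \<subseteq> (\<Union>i. C i) \<and> (\<forall>i. bounded (C i) \<and> diameter (C i) < \<delta>)}.
        \<Sum>i. diam_pow s (C i))"
    using assms by (intro INF_superset_mono order_refl Collect_mono) (meson less_le_trans)
qed simp

lemma hausdorff_pre_tendsto:
  "((\<lambda>\<delta>. hausdorff_pre s \<delta> A) \<longlongrightarrow> (SUP \<delta>\<in>{0<..}. hausdorff_pre s \<delta> A)) (at_right 0)"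
proof (rule order_tendstoI)
  fix y assume "y < (SUP \<delta>\<in>{0<..}. hausdorff_pre s \<delta> A)"
  then obtain d where d: "d > 0" "y < hausdorff_pre s d A"
    by (auto simp: less_SUP_iff)
  have "\<forall>\<^sub>F \<delta> in at_right 0. \<delta> \<in> {0<..<d}"
    using eventually_at_right_real[OF d(1)] by simp
  then show "\<forall>\<^sub>F \<delta> in at_right 0. y < hausdorff_pre s \<delta> A"
    by eventually_elim (use d hausdorff_pre_antimono[of _ d s A] in \<open>auto intro: less_le_trans\<close>)
next
  fix y assume y: "(SUP \<delta>\<in>{0<..}. hausdorff_pre s \<delta> A) < y"
  have "\<forall>\<^sub>F \<delta> in at_right 0. (\<delta>::real) \<in> {0<..<1}"
    using eventually_at_right_real[of 0 1] by simp
  then show "\<forall>\<^sub>F \<delta> in at_right 0. hausdorff_pre s \<delta> A < y"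
  proof eventually_elim
    case (elim \<delta>)
    then have "hausdorff_pre s \<delta> A \<le> (SUP \<delta>\<in>{0<..}. hausdorff_pre s \<delta> A)"
      by (intro SUP_upper) simp
    then show ?case using y by (rule le_less_trans)
  qed
qed

lemma hausdorff_outer_eq_SUP:
  "hausdorff_outer s A = (SUP \<delta>\<in>{0<..}. hausdorff_pre s \<delta> A)"
  unfolding hausdorff_outer_def by (rule tendsto_Lim[OF _ hausdorff_pre_tendsto]) simp

lemma hausdorff_pre_mono: "A \<subseteq> B \<Longrightarrow> hausdorff_pre s \<delta> A \<le> hausdorff_pre s \<delta> B"
  unfolding hausdorff_pre_def
  by (rule mult_left_mono, rule INF_superset_mono, rule Collect_mono) (meson subset_trans, simp_all)

lemma hausdorff_outer_mono: "A \<subseteq> B \<Longrightarrow> hausdorff_outer s A \<le> hausdorff_outer s B"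
  unfolding hausdorff_outer_eq_SUP by (intro SUP_mono') (rule hausdorff_pre_mono)

lemma hausdorff_pre_empty:
  assumes "\<delta> > 0" shows "hausdorff_pre s \<delta> {} = 0"
proof -
  have "(INF C \<in> {C :: nat \<Rightarrow> 'a set. {} \<subseteq> (\<Union>i. C i) \<and> (\<forall>i. bounded (C i) \<and> diameter (C i) < \<delta>)}.
        \<Sum>i. diam_pow s (C i)) \<le> (\<Sum>i::nat. diam_pow s ({} :: 'a set))"
    by (rule INF_lower) (use assms in auto)
  also have "\<dots> = 0" by (simp add: diam_pow_def)
  finally show ?thesis unfolding hausdorff_pre_def by simp
qed

lemma hausdorff_outer_empty: "hausdorff_outer s {} = 0"
  unfolding hausdorff_outer_eq_SUP by (simp add: hausdorff_pre_empty)

lemma hausdorff_pre_UN_le: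
  fixes A :: "nat \<Rightarrow> 'a::metric_space set"
  shows "hausdorff_pre s \<delta> (\<Union>n. A n) \<le> (\<Sum>n. hausdorff_pre s \<delta> (A n))"
proof -
  define cov where "cov = (\<lambda>A. {C :: nat \<Rightarrow> 'a set. A \<subseteq> (\<Union>i. C i) \<and>
    (\<forall>i. bounded (C i) \<and> diameter (C i) < \<delta>)})"
  define h where "h = (\<lambda>A. INF C \<in> cov A. \<Sum>i. diam_pow s (C i))"
  have pre: "hausdorff_pre s \<delta> B = ennreal (unit_ball_vol s / 2 powr s) * h B" for B :: "'a set"
    by (simp add: hausdorff_pre_def h_def cov_def)
  have "h (\<Union>n. A n) \<le> (\<Sum>n. h (A n))"
  proof (rule ennreal_le_epsilon)
    fix e :: real assume fin: "(\<Sum>n. h (A n)) < top" and e: "0 < e"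
    have "\<exists>C \<in> cov (A n). (\<Sum>i. diam_pow s (C i)) < h (A n) + ennreal (e * (1/2)^Suc n)" for n
    proof -
      have "h (A n) < top"
        using fin ennreal_suminf_lessD by blast
      then have "h (A n) < h (A n) + ennreal (e * (1/2)^Suc n)"
        using e by (simp add: ennreal_add_left_cancel_less zero_less_mult_iff)
      then show ?thesis unfolding h_def INF_less_iff .
    qed
    then obtain C where C: "\<And>n. C n \<in> cov (A n)"
      "\<And>n. (\<Sum>i. diam_pow s (C n i)) \<le> h (A n) + ennreal (e * (1/2)^Suc n)"
      by (metis less_imp_le)
    define D where "D = (\<lambda>k. case prod_decode k of (n, i) \<Rightarrow> C n i)"
    have "(\<Union>n. A n) \<subseteq> (\<Union>k. D k)"
    proof clarify
      fix x n assume "x \<in> A n"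
      then obtain i where "x \<in> C n i" using C(1)[of n] unfolding cov_def by blast
      then have "x \<in> D (prod_encode (n, i))" by (simp add: D_def)
      then show "x \<in> (\<Union>k. D k)" by blast
    qed
    then have "D \<in> cov (\<Union>n. A n)"
      using C(1) by (auto simp: cov_def D_def split: prod.split)
    then have "h (\<Union>n. A n) \<le> (\<Sum>k. diam_pow s (D k))"
      unfolding h_def by (rule INF_lower)
    also have "\<dots> = (\<Sum>n. \<Sum>i. diam_pow s (C n i))"
      using suminf_ennreal_2dimen[of "\<lambda>n. \<Sum>i. diam_pow s (C n i)" "\<lambda>(n, i). diam_pow s (C n i)"]
      by (simp add: D_def o_def case_prod_beta')
    also have "\<dots> \<le> (\<Sum>n. h (A n) + ennreal (e * (1/2)^Suc n))"
      by (intro suminf_le C(2)) auto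
    also have "\<dots> = (\<Sum>n. h (A n)) + (\<Sum>n. ennreal (e * (1/2)^Suc n))"
      by (rule suminf_add[symmetric]) auto
    also have "(\<Sum>n. ennreal (e * (1/2)^Suc n)) = ennreal e"
    proof -
      have "(\<lambda>n. e * (1/2)^Suc n) sums (e * 1)"
        by (rule sums_mult[OF power_half_series])
      then show ?thesis
        using e by (intro suminf_ennreal_eq) auto
    qed
    finally show "h (\<Union>n. A n) \<le> (\<Sum>n. h (A n)) + ennreal e" .
  qed
  then show ?thesis
    unfolding pre ennreal_suminf_cmult by (rule mult_left_mono) simp
qed

lemma hausdorff_outer_UN_le:
  "hausdorff_outer s (\<Union>n::nat. A n) \<le> (\<Sum>n. hausdorff_outer s (A n))"
  unfolding hausdorff_outer_eq_SUP[of _ "\<Union>n. A n"]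
proof (rule SUP_least)
  fix \<delta> :: real assume "\<delta> \<in> {0<..}"
  have "hausdorff_pre s \<delta> (\<Union>n. A n) \<le> (\<Sum>n. hausdorff_pre s \<delta> (A n))"
    by (rule hausdorff_pre_UN_le)
  also have "\<dots> \<le> (\<Sum>n. hausdorff_outer s (A n))"
    using \<open>\<delta> \<in> {0<..}\<close> by (intro suminf_le) (auto simp: hausdorff_outer_eq_SUP intro: SUP_upper)
  finally show "hausdorff_pre s \<delta> (\<Union>n. A n) \<le> (\<Sum>n. hausdorff_outer s (A n))" .
qed

lemma hausdorff_outer_Un_le:
  "hausdorff_outer s (A \<union> B) \<le> hausdorff_outer s A + hausdorff_outer s B"
proof -
  have "(\<Union>n. binaryset A B n) = A \<union> B" by (rule UN_binaryset_eq)
  moreover have "(\<Sum>n. hausdorff_outer s (binaryset A B n)) = hausdorff_outer s A + hausdorff_outer s B"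
    by (rule suminf_binaryset_eq) (rule hausdorff_outer_empty)
  ultimately show ?thesis using hausdorff_outer_UN_le[of s "binaryset A B"] by simp
qed

lemma hausdorff_pre_separated:
  fixes A B :: "'a::metric_space set"
  assumes pos: "\<delta> > 0" and sep: "\<And>x y. x \<in> A \<Longrightarrow> y \<in> B \<Longrightarrow> \<delta> \<le> dist x y"
  shows "hausdorff_pre s \<delta> A + hausdorff_pre s \<delta> B \<le> hausdorff_pre s \<delta> (A \<union> B)"
proof -
  define cov where "cov = (\<lambda>A. {C :: nat \<Rightarrow> 'a set. A \<subseteq> (\<Union>i. C i) \<and>
    (\<forall>i. bounded (C i) \<and> diameter (C i) < \<delta>)})"
  define h where "h = (\<lambda>A. INF C \<in> cov A. \<Sum>i. diam_pow s (C i))"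
  have pre: "hausdorff_pre s \<delta> B = ennreal (unit_ball_vol s / 2 powr s) * h B" for B :: "'a set"
    by (simp add: hausdorff_pre_def h_def cov_def)
  have "h A + h B \<le> h (A \<union> B)"
    unfolding h_def[THEN fun_cong, of "A \<union> B"]
  proof (rule INF_greatest)
    fix C assume C: "C \<in> cov (A \<union> B)"
    define C1 where "C1 = (\<lambda>i. if C i \<inter> A = {} then {} else C i)"
    define C2 where "C2 = (\<lambda>i. if C i \<inter> B = {} then {} else C i)"
    have "C1 \<in> cov A" "C2 \<in> cov B"
      using C pos by (fastforce simp: cov_def C1_def C2_def)+
    then have "h A \<le> (\<Sum>i. diam_pow s (C1 i))" "h B \<le> (\<Sum>i. diam_pow s (C2 i))"
      by (auto simp: h_def intro: INF_lower)
    then have "h A + h B \<le> (\<Sum>i. diam_pow s (C1 i)) + (\<Sum>i. diam_pow s (C2 i))"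
      by (rule add_mono)
    also have "\<dots> = (\<Sum>i. diam_pow s (C1 i) + diam_pow s (C2 i))"
      by (rule suminf_add) auto
    also have "\<dots> \<le> (\<Sum>i. diam_pow s (C i))"
    proof (rule suminf_le)
      fix i
      have "C i \<inter> A = {} \<or> C i \<inter> B = {}"
      proof (rule ccontr)
        assume "\<not> ?thesis"
        then obtain x y where "x \<in> C i" "x \<in> A" "y \<in> C i" "y \<in> B" by blast
        moreover have "bounded (C i)" "diameter (C i) < \<delta>" using C by (auto simp: cov_def)
        ultimately show False
          using diameter_bounded_bound[of "C i" x y] sep[of x y] by linarith
      qed
      then show "diam_pow s (C1 i) + diam_pow s (C2 i) \<le> diam_pow s (C i)"
        by (auto simp: C1_def C2_def diam_pow_def[of s "{}"])
    qed auto
    finally show "h A + h B \<le> (\<Sum>i. diam_pow s (C i))" .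
  qed
  then show ?thesis
    unfolding pre distrib_left[symmetric] by (rule mult_left_mono) simp
qed

lemma hausdorff_outer_separated:
  fixes A B :: "'a::metric_space set"
  assumes "e > 0" and sep: "\<And>x y. x \<in> A \<Longrightarrow> y \<in> B \<Longrightarrow> e \<le> dist x y"
  shows "hausdorff_outer s A + hausdorff_outer s B \<le> hausdorff_outer s (A \<union> B)"
proof -
  have lim: "((\<lambda>\<delta>. hausdorff_pre s \<delta> S) \<longlongrightarrow> hausdorff_outer s S) (at_right 0)" for S :: "'a set"
    unfolding hausdorff_outer_eq_SUP by (rule hausdorff_pre_tendsto)
  have "\<forall>\<^sub>F \<delta> in at_right 0. \<delta> \<in> {0<..<e}"
    using eventually_at_right_real[OF assms(1)] by simp
  then have "\<forall>\<^sub>F \<delta> in at_right 0.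
      hausdorff_pre s \<delta> A + hausdorff_pre s \<delta> B \<le> hausdorff_pre s \<delta> (A \<union> B)"
  proof eventually_elim
    case (elim \<delta>)
    then have "\<delta> \<le> dist x y" if "x \<in> A" "y \<in> B" for x y
      using sep[OF that] by simp
    with elim show ?case by (intro hausdorff_pre_separated) auto
  qed
  then show ?thesis
    by (intro tendsto_le[OF _ lim tendsto_add[OF lim lim]]) auto
qed

lemma hausdorff_outer_separated_sum:
  fixes R :: "nat \<Rightarrow> 'a::metric_space set"
  assumes sep: "\<And>i j. i < j \<Longrightarrow> \<exists>e>0. \<forall>x\<in>R i. \<forall>y\<in>R j. e \<le> dist x y"
  shows "(\<Sum>i<n. hausdorff_outer s (R i)) \<le> hausdorff_outer s (\<Union>i<n. R i)"
proof (induction n)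
  case 0
  show ?case by simp
next
  case (Suc n)
  have "\<forall>i\<in>{..<n}. \<exists>e>0. \<forall>x\<in>R i. \<forall>y\<in>R n. e \<le> dist x y"
    using sep by simp
  then obtain e where e: "\<forall>i\<in>{..<n}. e i > 0 \<and> (\<forall>x\<in>R i. \<forall>y\<in>R n. e i \<le> dist x y)"
    unfolding bchoice_iff by (elim exE)
  define d where "d = Min (insert 1 (e ` {..<n}))"
  have "d > 0" unfolding d_def using e by (subst Min_gr_iff) auto
  have d: "d \<le> dist x y" if x: "x \<in> (\<Union>i<n. R i)" and y: "y \<in> R n" for x y
  proof -
    obtain i where i: "i < n" "x \<in> R i" using x by auto
    then have "d \<le> e i" unfolding d_def by (intro Min_le) auto
    also have "e i \<le> dist x y" using e i y by blast
    finally show ?thesis .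
  qed
  have "(\<Sum>i<Suc n. hausdorff_outer s (R i)) \<le> hausdorff_outer s (\<Union>i<n. R i) + hausdorff_outer s (R n)"
    using Suc by (simp add: add_right_mono)
  also have "\<dots> \<le> hausdorff_outer s ((\<Union>i<n. R i) \<union> R n)"
    by (rule hausdorff_outer_separated[OF \<open>d > 0\<close> d])
  also have "(\<Union>i<n. R i) \<union> R n = (\<Union>i<Suc n. R i)" by (auto simp: less_Suc_eq)
  finally show ?case .
qed

lemma suminf_tail_ennreal:
  fixes f :: "nat \<Rightarrow> ennreal"
  assumes fin: "(\<Sum>i. f i) \<noteq> top"
  shows "(\<lambda>n. \<Sum>i. f (i + n)) \<longlonglongrightarrow> 0"
proof -
  let ?S = "\<Sum>i. f i"
  have part: "(\<Sum>i<n. f i) \<le> ?S" for n by (rule sum_le_suminf) auto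
  have "(\<Sum>i. f (i + n)) = ?S - (\<Sum>i<n. f i)" for n
  proof -
    have "?S = (\<Sum>i. f (i + n)) + (\<Sum>i<n. f i)" by (rule suminf_offset) simp
    moreover have "(\<Sum>i<n. f i) \<noteq> top" using part[of n] fin by (metis top.extremum_uniqueI)
    ultimately show ?thesis by (metis ennreal_add_diff_cancel_right)
  qed
  moreover have "(\<lambda>n. ?S - (\<Sum>i<n. f i)) \<longlonglongrightarrow> ?S - ?S"
    using fin by (intro tendsto_diff_ennreal tendsto_const summable_LIMSEQ) auto
  ultimately show ?thesis using fin by (simp add: ennreal_minus_cancel_iff)
qed

lemma hausdorff_outer_closed_split:
  fixes A C :: "'a::metric_space set"
  assumes C: "closed C"
  shows "hausdorff_outer s (A \<inter> C) + hausdorff_outer s (A - C) \<le> hausdorff_outer s A"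
proof (cases "C = {} \<or> hausdorff_outer s A = top")
  case True
  then show ?thesis by (auto simp: hausdorff_outer_empty)
next
  case False
  then have ne: "C \<noteq> {}" and fin: "hausdorff_outer s A < top" by (auto simp: less_top)
  let ?H = "hausdorff_outer s"
  define B where "B = (\<lambda>n::nat. {x \<in> A. 1 / (real n + 1) \<le> infdist x C})"
  define R where "R = (\<lambda>n::nat. B (Suc n) - B n)"
  have infd: "infdist x C \<le> dist x y + infdist y C" for x y
    using infdist_triangle[of x C y] by simp
  have sepR: "\<exists>e>0. \<forall>x\<in>R i. \<forall>y\<in>R j. e \<le> dist x y" if "Suc i < j" for i j
  proof (intro exI conjI ballI)
    have "real i + 2 < real j + 1" using that by linarith
    then show "1 / (real i + 2) - 1 / (real j + 1) > 0"
      by (simp add: frac_less2)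
    fix x y assume "x \<in> R i" "y \<in> R j"
    then have "1 / (real i + 2) \<le> infdist x C" "infdist y C < 1 / (real j + 1)"
      by (auto simp: R_def B_def add.commute)
    then show "1 / (real i + 2) - 1 / (real j + 1) \<le> dist x y"
      using infd[of x y] by linarith
  qed
  have RA: "R i \<subseteq> A" for i by (auto simp: R_def B_def)
  have half: "(\<Sum>i. ?H (R (2 * i + k))) \<le> ?H A" for k
  proof (rule suminf_le_const)
    fix n
    have "(\<Sum>i<n. ?H (R (2 * i + k))) \<le> ?H (\<Union>i<n. R (2 * i + k))"
      by (rule hausdorff_outer_separated_sum) (rule sepR, simp)
    also have "\<dots> \<le> ?H A" using RA by (intro hausdorff_outer_mono) auto
    finally show "(\<Sum>i<n. ?H (R (2 * i + k))) \<le> ?H A" .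
  qed auto
  have sumR: "(\<Sum>i. ?H (R i)) \<le> ?H A + ?H A"
  proof (rule suminf_le_const)
    fix n
    have "(\<Sum>i<n. ?H (R i)) \<le> (\<Sum>i<2*n. ?H (R i))" by (rule sum_mono2) auto
    also have "\<dots> = (\<Sum>i<n. ?H (R (2 * i + 0)) + ?H (R (2 * i + 1)))"
      by (induction n) (auto simp: algebra_simps)
    also have "\<dots> = (\<Sum>i<n. ?H (R (2 * i + 0))) + (\<Sum>i<n. ?H (R (2 * i + 1)))"
      by (rule sum.distrib)
    also have "\<dots> \<le> (\<Sum>i. ?H (R (2 * i + 0))) + (\<Sum>i. ?H (R (2 * i + 1)))"
      by (intro add_mono sum_le_suminf) auto
    also have "\<dots> \<le> ?H A + ?H A" by (intro add_mono half)
    finally show "(\<Sum>i<n. ?H (R i)) \<le> ?H A + ?H A" .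
  qed auto
  have bound: "?H (A \<inter> C) + ?H (B n) \<le> ?H A" for n
  proof -
    have "?H (A \<inter> C) + ?H (B n) \<le> ?H (A \<inter> C \<union> B n)"
    proof (rule hausdorff_outer_separated)
      show "1 / (real n + 1) > 0" by simp
      fix x y assume "x \<in> A \<inter> C" "y \<in> B n"
      then show "1 / (real n + 1) \<le> dist x y"
        using infdist_le[of x C y] by (auto simp: B_def dist_commute)
    qed
    also have "\<dots> \<le> ?H A" by (rule hausdorff_outer_mono) (auto simp: B_def)
    finally show ?thesis .
  qed
  have cover: "A - C \<subseteq> B n \<union> (\<Union>i. R (i + n))" for n
  proof
    fix x assume x: "x \<in> A - C"
    then have "infdist x C > 0"
      using in_closed_iff_infdist_zero[OF C ne] infdist_nonneg[of x C] by (metis DiffD2 order_le_less)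
    then obtain m :: nat where "m > 0" "inverse (real m) < infdist x C"
      using ex_inverse_of_nat_less by blast
    then have "1 / (real m + 1) \<le> infdist x C"
      by (smt (verit) frac_le inverse_eq_divide of_nat_0_less_iff)
    then have xm: "x \<in> B m" using x by (simp add: B_def)
    define k where "k = (LEAST m. x \<in> B m)"
    have k: "x \<in> B k" unfolding k_def by (rule LeastI[of _ m]) (rule xm)
    show "x \<in> B n \<union> (\<Union>i. R (i + n))"
    proof (cases "k \<le> n")
      case True
      have "1 / (real n + 1) \<le> 1 / (real k + 1)" using True by (intro divide_left_mono) auto
      then show ?thesis using k by (auto simp: B_def)
    next
      case False
      then obtain j where j: "k = Suc j" "j \<ge> n" by (cases k) auto
      have "x \<notin> B j" using not_less_Least[of j "\<lambda>m. x \<in> B m"] j k_def by simp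
      then have "x \<in> R ((j - n) + n)" using k j by (simp add: R_def)
      then show ?thesis by blast
    qed
  qed
  have le: "?H (A \<inter> C) + ?H (A - C) \<le> ?H A + (\<Sum>i. ?H (R (i + n)))" for n
  proof -
    have "?H (A - C) \<le> ?H (B n \<union> (\<Union>i. R (i + n)))" by (rule hausdorff_outer_mono[OF cover])
    also have "\<dots> \<le> ?H (B n) + (\<Sum>i. ?H (R (i + n)))"
      by (rule order_trans[OF hausdorff_outer_Un_le add_left_mono[OF hausdorff_outer_UN_le]])
    finally have "?H (A \<inter> C) + ?H (A - C) \<le> (?H (A \<inter> C) + ?H (B n)) + (\<Sum>i. ?H (R (i + n)))"
      by (simp add: add.assoc add_left_mono)
    also have "\<dots> \<le> ?H A + (\<Sum>i. ?H (R (i + n)))" by (intro add_right_mono bound)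
    finally show ?thesis .
  qed
  have "(\<Sum>i. ?H (R i)) \<noteq> top" using sumR fin
    by (metis ennreal_add_eq_top less_top top.extremum_uniqueI)
  then have "(\<lambda>n. \<Sum>i. ?H (R (i + n))) \<longlonglongrightarrow> 0"
    by (rule suminf_tail_ennreal)
  then have "(\<lambda>n. ?H A + (\<Sum>i. ?H (R (i + n)))) \<longlonglongrightarrow> ?H A + 0"
    by (intro tendsto_add tendsto_const)
  then show ?thesis
    using le by (intro tendsto_lowerbound[of _ "?H A"]) auto
qed

lemma measure_space_hausdorff:
  "measure_space UNIV (sets borel) (hausdorff_outer s :: 'a::metric_space set \<Rightarrow> ennreal)"
proof -
  let ?H = "hausdorff_outer s :: 'a set \<Rightarrow> ennreal"
  let ?L = "lambda_system (UNIV :: 'a set) UNIV ?H"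
  have "sigma_algebra (UNIV :: 'a set) UNIV"
    using sigma_algebra_Pow[of "UNIV :: 'a set"] by simp
  moreover have "outer_measure_space UNIV ?H"
    unfolding outer_measure_space_def positive_def increasing_def countably_subadditive_def
    by (auto simp: hausdorff_outer_empty hausdorff_outer_mono hausdorff_outer_UN_le)
  ultimately have ms: "measure_space UNIV ?L ?H"
    by (rule sigma_algebra.caratheodory_lemma)
  then have sa: "sigma_algebra UNIV ?L" by (simp add: measure_space_def)
  have "C \<in> ?L" if "closed C" for C
  proof -
    have "?H (C \<inter> A) + ?H ((UNIV - C) \<inter> A) = ?H A" for A
    proof (rule antisym)
      have "C \<inter> A = A \<inter> C" "(UNIV - C) \<inter> A = A - C" by auto
      then show "?H (C \<inter> A) + ?H ((UNIV - C) \<inter> A) \<le> ?H A"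
        using hausdorff_outer_closed_split[OF that, of s A] by simp
      have "A = (C \<inter> A) \<union> ((UNIV - C) \<inter> A)" by auto
      then show "?H A \<le> ?H (C \<inter> A) + ?H ((UNIV - C) \<inter> A)"
        using hausdorff_outer_Un_le[of s "C \<inter> A" "(UNIV - C) \<inter> A"] by simp
    qed
    then show ?thesis by (simp add: lambda_system_def)
  qed
  then have "sigma_sets UNIV (Collect closed) \<subseteq> ?L"
    by (intro sigma_algebra.sigma_sets_subset[OF sa]) auto
  then have "sets borel \<subseteq> ?L" by (simp add: borel_eq_closed)
  then show ?thesis
    using ms sets.sigma_algebra_axioms[of borel] by (intro measure_down[OF ms]) auto
qed

lemma space_hausdorff [simp]: "space (hausdorff s) = UNIV"
  by (simp add: hausdorff_def)

lemma sets_hausdorff [simp, measurable_cong]: "sets (hausdorff s) = sets borel"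
  by (simp add: hausdorff_def sets.sigma_sets_eq[of borel, simplified])

lemma emeasure_hausdorff: "A \<in> sets borel \<Longrightarrow> emeasure (hausdorff s) A = hausdorff_outer s A"
  using measure_space_hausdorff[of s]
  unfolding hausdorff_def measure_space_def by (intro emeasure_measure_of_sigma) auto

end

theory Submission
  imports Defs
begin

text \<open>
  Let \<open>\<rho>\<close> be admissible for the curves and \<open>g\<close> for the surfaces. By outer regularity \<open>\<rho>\<close> may be
  replaced, at arbitrarily small cost in \<open>L\<^sup>p\<close>, by the limit of an increasing sequence of continuous
  positive weights \<open>w\<^sub>k\<close>. Let \<open>u\<^sub>k\<close> be the infimum of the \<open>w\<^sub>k\<close>-costs of all chains from \<open>E\<close> whose steps
  are shorter than a scale \<open>e\<^sub>k \<rightarrow> 0\<close>. If \<open>u\<^sub>k\<close> were smaller than \<open>M < 1\<close> somewhere on \<open>F\<close> for every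
  \<open>k\<close>, then the cheap chains, parametrized by cost, would accumulate at a Lipschitz curve from \<open>E\<close> to
  \<open>F\<close> along which \<open>\<rho>\<close> integrates to at most \<open>M\<close>. So some \<open>u = u\<^sub>k\<close> is \<open>0\<close> on \<open>E\<close>, at least \<open>M\<close> on
  \<open>F\<close>, and locally Lipschitz with constant \<open>w = w\<^sub>k\<close>. Almost every sublevel set \<open>{u < t}\<close> with
  \<open>0 < t < M\<close> yields a separating surface measure, and Eilenberg's coarea inequality gives
  \<open>M \<le> (2 v\<^sub>N\<^sub>-\<^sub>1 / v\<^sub>N) \<integral> w g d\<H>\<^sup>N\<close>; conclude with Hoelder's inequality.
\<close>

subsection \<open>Approximation from above by continuous functions\<close>

text \<open>Minimizing cost over curves instead of chains could give a potential that is neither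
  continuous nor finite, since \<open>X\<close> may contain few rectifiable curves or none. A chain
  may jump up to its scale, so appending one step already makes the chain potential locally
  Lipschitz in every metric space. The price is that a cheap chain is not a curve, and compactness
  has to turn a failure at all scales into one. This explains the demands on the weights: continuity
  lets the cost pass to the limit, monotonicity makes a bound for late weights a bound for each
  earlier one, and a positive lower bound controls the length of a chain by its cost.

  The constant comes from covers: a set of diameter \<open>d\<close> meets level sets of
  \<open>u\<close> only for parameters in an interval of length at most \<open>w d\<close>, and adds
  \<open>d^(N-1)\<close> to each, hence at most \<open>w d^N\<close> in total. The quotient of the
  normalizations \<open>v_(N-1) / 2^(N-1)\<close> and \<open>v_N / 2^N\<close> is
  \<open>2 v_(N-1) / v_N\<close>.\<close>

lemma outer_regular_closed:
  fixes M :: "'a::metric_space measure"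
  assumes sets: "sets M = sets borel" and fin: "finite_measure M" and "closed A" and "e > 0"
  shows "\<exists>U. open U \<and> A \<subseteq> U \<and> measure M (U - A) < e"
\<comment> \<open>As \<open>infdist x {} = 0\<close>, the neighbourhoods used below would be the
  whole space for empty \<open>A\<close>.\<close>
proof (cases "A = {}")
  case True
  then show ?thesis using \<open>e > 0\<close> by (intro exI[of _ "{}"]) auto
next
  case False
  interpret finite_measure M by (rule fin)
  define U where "U = (\<lambda>n::nat. {x. infdist x A < 1 / (real n + 1)})"
  have op: "open (U n)" for n
    unfolding U_def by (intro open_Collect_less continuous_intros)
  have AU: "A \<subseteq> U n" for n
    by (auto simp: U_def)
  have "(\<Inter>n. U n) = A"
  proof
    show "(\<Inter>n. U n) \<subseteq> A"
    proof
      fix x assume x: "x \<in> (\<Inter>n. U n)"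
      have "infdist x A = 0"
      proof (rule ccontr)
        assume "infdist x A \<noteq> 0"
        then have "infdist x A > 0" using infdist_nonneg[of x A] by linarith
        then obtain n where "1 / (real n + 1) < infdist x A"
          using nat_approx_posE by (metis Suc_eq_plus1 of_nat_Suc add.commute)
        moreover have "infdist x A < 1 / (real n + 1)" using x by (auto simp: U_def)
        ultimately show False by linarith
      qed
      then show "x \<in> A" using in_closed_iff_infdist_zero[OF \<open>closed A\<close> False] by simp
    qed
  qed (use AU in auto)
  then have int: "(\<Inter>n. U n - A) = {}" by auto
  have "(\<lambda>n. measure M (U n - A)) \<longlonglongrightarrow> measure M (\<Inter>n. U n - A)"
  proof (rule finite_Lim_measure_decseq)
    show "range (\<lambda>n. U n - A) \<subseteq> sets M"
      using op \<open>closed A\<close> by (auto simp: sets)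
    show "decseq (\<lambda>n. U n - A)"
      unfolding decseq_def U_def
    proof (safe, goal_cases)
      case (1 m n x)
      have "1 / (real n + 1) \<le> 1 / (real m + 1)" using 1 by (intro divide_left_mono) auto
      with 1 show ?case by linarith
    qed
  qed
  then have "(\<lambda>n. measure M (U n - A)) \<longlonglongrightarrow> 0" by (simp only: int measure_empty)
  then have "eventually (\<lambda>n. measure M (U n - A) < e) sequentially"
    using \<open>e > 0\<close> by (rule order_tendstoD)
  then obtain n where "measure M (U n - A) < e" by (auto simp: eventually_sequentially)
  with op AU show ?thesis by blast
qed

text \<open>Outer regularity alone does not pass to complements. Squeezing \<open>A\<close> between
  a closed and an open set does: complementation swaps the two and keeps their difference. So the
  induction over the sets generated by the closed ones is run for the two-sided property.\<close>

lemma regular_borel: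
  fixes M :: "'a::metric_space measure"
  assumes sets: "sets M = sets borel" and fin: "finite_measure M"
    and "A \<in> sets borel" and "e > 0"
  shows "\<exists>U C. open U \<and> closed C \<and> C \<subseteq> A \<and> A \<subseteq> U \<and> measure M (U - C) < e"
proof -
  interpret finite_measure M by (rule fin)
  have "A \<in> sigma_sets UNIV (Collect closed)"
    using assms(3) by (simp add: borel_eq_closed)
  then show ?thesis using \<open>e > 0\<close>
  proof (induction arbitrary: e rule: sigma_sets.induct)
    case (Basic a)
    then obtain U where "open U" "a \<subseteq> U" "measure M (U - a) < e"
      using outer_regular_closed[OF sets fin, of a e] by auto
    with Basic show ?case by blast
  next
    case Empty
    then show ?case by (intro exI[of _ "{}"]) auto
  next
    case (Compl a)
    from Compl.IH[OF Compl.prems] obtain U C where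
      "open U" "closed C" "C \<subseteq> a" "a \<subseteq> U" "measure M (U - C) < e" by blast
    moreover have "- C - - U = U - C" by auto
    ultimately show ?case by (intro exI[of _ "- C"] exI[of _ "- U"]) auto
  next
    case (Union a)
    \<comment> \<open>These errors sum to \<open>e/2\<close>. The other half pays for truncation:
      the union of all \<open>C i\<close> need not be closed, so it is replaced by a finite union
      \<open>K n\<close>, with \<open>n\<close> found by continuity from above.\<close>
    have "\<exists>U C. open U \<and> closed C \<and> C \<subseteq> a i \<and> a i \<subseteq> U \<and> measure M (U - C) < e/2 * (1/2)^Suc i" for i
      using Union.IH[of "e/2 * (1/2)^Suc i" i] Union.prems by simp
    then obtain U C where UC: "\<And>i. open (U i)" "\<And>i. closed (C i)" "\<And>i. C i \<subseteq> a i"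
      "\<And>i. a i \<subseteq> U i" "\<And>i. measure M (U i - C i) < e/2 * (1/2)^Suc i"
      by metis
    have geo: "(\<lambda>i. e/2 * (1/2)^Suc i) sums (e/2 * 1)"
      by (rule sums_mult[OF power_half_series])
    have meas: "U i \<in> sets M" "C i \<in> sets M" for i using UC by (auto simp: sets)
    have summ: "summable (\<lambda>i. measure M (U i - C i))"
      by (rule summable_comparison_test[OF _ sums_summable[OF geo]])
         (use UC(5) in \<open>auto intro!: exI[of _ 0] less_imp_le\<close>)
    have "measure M (\<Union>i. U i - C i) \<le> (\<Sum>i. measure M (U i - C i))"
      by (rule finite_measure_subadditive_countably[OF _ summ]) (use meas in auto)
    also have "\<dots> \<le> (\<Sum>i. e/2 * (1/2)^Suc i)"
      by (rule suminf_le[OF _ summ sums_summable[OF geo]]) (use UC(5) less_imp_le in auto)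
    also have "\<dots> = e/2" using geo by (simp add: sums_iff)
    finally have 1: "measure M (\<Union>i. U i - C i) \<le> e/2" .
    define V where "V = (\<Union>i. U i)"
    define K where "K = (\<lambda>n. \<Union>i<n. C i)"
    have mV: "V \<in> sets M" "K n \<in> sets M" for n unfolding V_def K_def using meas by auto
    have "(\<lambda>n. measure M (V - K n)) \<longlonglongrightarrow> measure M (\<Inter>n. V - K n)"
    proof (rule finite_Lim_measure_decseq)
      show "range (\<lambda>n. V - K n) \<subseteq> sets M" using mV by auto
      show "decseq (\<lambda>n. V - K n)" by (force simp: decseq_def K_def)
    qed
    moreover have "measure M (\<Inter>n. V - K n) \<le> measure M (\<Union>i. U i - C i)"
      by (rule finite_measure_mono) (use meas in \<open>auto simp: V_def K_def, blast\<close>)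
    then have "measure M (\<Inter>n. V - K n) < e" using 1 Union.prems by linarith
    ultimately have "eventually (\<lambda>n. measure M (V - K n) < e) sequentially"
      by (rule order_tendstoD(2))
    then obtain n where n: "measure M (V - K n) < e" by (auto simp: eventually_sequentially)
    have "open V" "closed (K n)" using UC by (auto simp: V_def K_def)
    moreover have "K n \<subseteq> (\<Union>i. a i)" "(\<Union>i. a i) \<subseteq> V" using UC by (auto simp: K_def V_def) blast+
    ultimately show ?case using n by blast
  qed
qed

lemma outer_regular_borel:
  fixes M :: "'a::metric_space measure"
  assumes sets: "sets M = sets borel" and fin: "finite_measure M"
    and A: "A \<in> sets borel" and "e > 0"
  obtains U where "open U" "A \<subseteq> U" "emeasure M U \<le> emeasure M A + ennreal e"
proof -
  interpret finite_measure M by (rule fin)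
  obtain U C where UC: "open U" "closed C" "C \<subseteq> A" "A \<subseteq> U" "measure M (U - C) < e"
    using regular_borel[OF assms] by blast
  have "emeasure M U \<le> emeasure M (A \<union> (U - C))"
    by (rule emeasure_mono) (use UC A in \<open>auto simp: sets\<close>)
  also have "\<dots> \<le> emeasure M A + emeasure M (U - C)"
    by (rule emeasure_subadditive) (use UC A in \<open>auto simp: sets\<close>)
  also have "\<dots> \<le> emeasure M A + ennreal e"
    using UC(5) by (intro add_left_mono) (simp add: emeasure_eq_measure ennreal_leI less_imp_le)
  finally show ?thesis using that UC by blast
qed

text \<open>Discrete layer cake: when the layer with index \<open>m\<close> is still switched on,
  \<open>m\<close> layers fit below \<open>f\<close>, so the sum up to and including it exceeds
  \<open>f\<close> by at most one step \<open>h\<close>. Otherwise the sum does not grow.\<close>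

lemma layer_sum_upper:
  fixes f :: ennreal and h :: real
  assumes "h > 0"
  shows "(\<Sum>n<m. if ennreal (real n * h) < f then ennreal h else 0) \<le> f + ennreal h"
proof (induction m)
  case (Suc m)
  show ?case
  proof (cases "ennreal (real m * h) < f")
    case True
    have "(\<Sum>n<Suc m. if ennreal (real n * h) < f then ennreal h else 0) \<le> (\<Sum>n<Suc m. ennreal h)"
      by (intro sum_mono) auto
    also have "\<dots> = of_nat m * ennreal h + ennreal h"
      by (simp add: distrib_right add.commute)
    also have "\<dots> = ennreal (real m * h) + ennreal h"
      by (simp add: ennreal_of_nat_eq_real_of_nat ennreal_mult')
    also have "\<dots> \<le> f + ennreal h" using True by (intro add_right_mono) simp
    finally show ?thesis .
  qed (use Suc in simp)
qed simp

text \<open>The minimum is with the height that \<open>m\<close> layers can reach. In this form the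
  bound also covers \<open>f = top\<close>, where the sum grows without limit.\<close>

lemma layer_sum_lower:
  fixes f :: ennreal and h :: real
  assumes "h > 0"
  shows "min f (ennreal (real m * h)) \<le> (\<Sum>n<m. if ennreal (real n * h) < f then ennreal h else 0)"
proof (induction m)
  case (Suc m)
  show ?case
  proof (cases "ennreal (real m * h) < f")
    case True
    then have "min f (ennreal (real m * h)) = ennreal (real m * h)" by simp
    moreover have "ennreal (real (Suc m) * h) = ennreal (real m * h) + ennreal h"
      using assms by (simp add: distrib_right flip: ennreal_plus)
    ultimately have "ennreal (real (Suc m) * h) \<le> (\<Sum>n<Suc m. if ennreal (real n * h) < f then ennreal h else 0)"
      using Suc True by (simp add: add_right_mono add.commute)
    then show ?thesis by (metis min.coboundedI2)
  next
    case False
    then have "min f (ennreal (real m * h)) = f" by simp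
    then have "f \<le> (\<Sum>n<Suc m. if ennreal (real n * h) < f then ennreal h else 0)"
      using Suc False by simp
    then show ?thesis by (metis min.coboundedI1)
  qed
qed simp

section \<open>Continuous functions increasing to the indicator of an open set\<close>

text \<open>The case \<open>U = UNIV\<close> is separate because \<open>infdist x {} = 0\<close>.\<close>

definition open_approx :: "'a::metric_space set \<Rightarrow> nat \<Rightarrow> 'a \<Rightarrow> real" where
  "open_approx U k x = (if U = UNIV then 1 else min 1 (real k * infdist x (- U)))"

lemma open_approx_continuous: "continuous_on A (open_approx U k)"
proof (cases "U = UNIV")
  case True
  then have "open_approx U k = (\<lambda>x. 1)" by (auto simp: open_approx_def)
  then show ?thesis by simp
next
  case False
  then have "open_approx U k = (\<lambda>x. min 1 (real k * infdist x (- U)))"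
    by (simp add: open_approx_def fun_eq_iff)
  then show ?thesis by (auto intro!: continuous_intros)
qed

lemma open_approx_nonneg: "0 \<le> open_approx U k x"
  by (auto simp: open_approx_def infdist_nonneg)

lemma open_approx_le_indicator: "open_approx U k x \<le> indicator U x"
  by (auto simp: open_approx_def indicator_def)

lemma open_approx_mono: "k \<le> l \<Longrightarrow> open_approx U k x \<le> open_approx U l x"
proof -
  assume "k \<le> l"
  then have "real k * infdist x (- U) \<le> real l * infdist x (- U)"
    by (intro mult_right_mono) (auto simp: infdist_nonneg)
  then show ?thesis by (auto simp: open_approx_def)
qed

lemma open_approx_eventually_1:
  assumes "open U" "x \<in> U"
  shows "\<forall>\<^sub>F k in sequentially. open_approx U k x = 1"
proof (cases "U = UNIV")
  case False
  have "infdist x (- U) \<noteq> 0"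
    using in_closed_iff_infdist_zero[of "- U" x] assms False by auto
  then have pos: "infdist x (- U) > 0" using infdist_nonneg[of x "- U"] by linarith
  then obtain m where m: "1 < real m * infdist x (- U)"
    using reals_Archimedean3 by blast
  show ?thesis unfolding eventually_sequentially
  proof (intro exI allI impI)
    fix k assume "m \<le> k"
    then have "real m * infdist x (- U) \<le> real k * infdist x (- U)"
      using pos by (intro mult_right_mono) auto
    then show "open_approx U k x = 1" using m by (simp add: open_approx_def)
  qed
qed (simp add: open_approx_def)

text \<open>A form of the Vitali-Caratheodory theorem: the supremum of the \<open>F k\<close> is a
  lower semicontinuous majorant of \<open>f\<close> with almost the same integral. Superlevel sets
  in a layer sum are enlarged to open sets, and their indicators are approximated from below by
  continuous functions. The added constant \<open>h\<close> serves as the positive lower bound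
  \<open>c\<close>.\<close>

lemma continuous_approx_above:
  fixes M :: "'a::metric_space measure" and f :: "'a \<Rightarrow> ennreal"
  assumes sets: "sets M = sets borel" and fin: "finite_measure M"
    and f: "f \<in> borel_measurable borel" and "e > 0"
  obtains c :: real and F :: "nat \<Rightarrow> 'a \<Rightarrow> real"
  where "c > 0" "\<And>k. continuous_on UNIV (F k)" "\<And>k x. c \<le> F k x"
    "\<And>k l x. k \<le> l \<Longrightarrow> F k x \<le> F l x"
    "\<And>x. f x \<le> (SUP k. ennreal (F k x))"
    "\<And>k. (\<integral>\<^sup>+ x. ennreal (F k x) \<partial>M) \<le> (\<integral>\<^sup>+ x. f x \<partial>M) + ennreal e"
proof -
  interpret finite_measure M by (rule fin)
  have sp: "space M = UNIV" using sets_eq_imp_space_eq[OF sets] by simp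
  \<comment> \<open>The total error consists of \<open>h\<close> times the mass for the added
    constant, \<open>h\<close> times the mass for the overshoot of the layer sum, and at most
    \<open>h\<close> for the enlargement of the superlevel sets.\<close>
  define h where "h = e / (2 * measure M UNIV + 1)"
  have hpos: "h > 0" using \<open>e > 0\<close> measure_nonneg[of M UNIV] by (simp add: h_def divide_pos_pos add_nonneg_pos)
  have h_le: "h * (2 * measure M UNIV + 1) = e"
  proof -
    have "2 * measure M UNIV + 1 > 0" by (simp add: add_nonneg_pos)
    then show ?thesis by (simp add: h_def)
  qed
  define A where "A = (\<lambda>n. {x. ennreal (real n * h) < f x})"
  have A: "A n \<in> sets borel" for n
    unfolding A_def using f by measurable
  have "\<exists>U. open U \<and> A n \<subseteq> U \<and> emeasure M U \<le> emeasure M (A n) + ennreal ((1/2)^Suc n)" for n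
    by (rule outer_regular_borel[OF sets fin A[of n], of "(1/2)^Suc n"]) auto
  then obtain U where U: "\<And>n. open (U n)" "\<And>n. A n \<subseteq> U n"
    "\<And>n. emeasure M (U n) \<le> emeasure M (A n) + ennreal ((1/2)^Suc n)" by metis
  \<comment> \<open>Diagonal choice: \<open>k\<close> counts the layers and is also the level of
    approximation within each layer. Both effects increase with \<open>k\<close>, so the sequence is
    monotone.\<close>
  define F where "F = (\<lambda>k x. h + (\<Sum>n<k. h * open_approx (U n) k x))"
  have cont: "continuous_on UNIV (F k)" for k
    unfolding F_def by (intro continuous_intros open_approx_continuous)
  have low: "h \<le> F k x" for k x
    unfolding F_def using hpos by (simp add: sum_nonneg open_approx_nonneg)
  have mono: "F k x \<le> F l x" if "k \<le> l" for k l x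
  proof -
    have "(\<Sum>n<k. h * open_approx (U n) k x) \<le> (\<Sum>n<k. h * open_approx (U n) l x)"
      using hpos that by (intro sum_mono mult_left_mono open_approx_mono) auto
    also have "\<dots> \<le> (\<Sum>n<l. h * open_approx (U n) l x)"
      using hpos that by (intro sum_mono2) (auto simp: open_approx_nonneg)
    finally show ?thesis by (simp add: F_def)
  qed
  have up: "f x \<le> (SUP k. ennreal (F k x))" for x
  proof -
    have le: "min (f x) (ennreal (real m * h)) \<le> (SUP k. ennreal (F k x))" for m
    proof -
      \<comment> \<open>Up to the height \<open>m * h\<close> only the first \<open>m\<close> layers
        matter, so only finitely many approximations have to have reached 1 at
        \<open>x\<close>.\<close>
      have "\<forall>\<^sub>F k in sequentially. \<forall>n\<in>{n. n < m \<and> x \<in> A n}. open_approx (U n) k x = 1"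
        by (rule eventually_ball_finite) (use U open_approx_eventually_1 in \<open>auto, blast\<close>)
      then have "\<forall>\<^sub>F k in sequentially. m \<le> k \<and> (\<forall>n\<in>{n. n < m \<and> x \<in> A n}. open_approx (U n) k x = 1)"
        using eventually_ge_at_top[of m] by eventually_elim auto
      then obtain k where k: "m \<le> k" "\<And>n. n < m \<Longrightarrow> x \<in> A n \<Longrightarrow> open_approx (U n) k x = 1"
        by (auto simp: eventually_sequentially)
      have "min (f x) (ennreal (real m * h)) \<le> (\<Sum>n<m. if ennreal (real n * h) < f x then ennreal h else 0)"
        by (rule layer_sum_lower[OF hpos])
      also have "\<dots> \<le> (\<Sum>n<m. ennreal (h * open_approx (U n) k x))"
        by (rule sum_mono) (use k hpos in \<open>auto simp: A_def\<close>)
      also have "\<dots> \<le> (\<Sum>n<k. ennreal (h * open_approx (U n) k x))"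
        using k by (intro sum_mono2) auto
      also have "\<dots> = ennreal (\<Sum>n<k. h * open_approx (U n) k x)"
        using hpos by (intro sum_ennreal) (auto simp: open_approx_nonneg)
      also have "\<dots> \<le> ennreal (F k x)" unfolding F_def using hpos by (intro ennreal_leI) simp
      also have "\<dots> \<le> (SUP k. ennreal (F k x))" by (rule SUP_upper) simp
      finally show ?thesis .
    qed
    have lim: "(\<lambda>m. ennreal (real m * h)) \<longlonglongrightarrow> top"
    proof -
      have "filterlim (\<lambda>m. real m * h) at_top sequentially"
        using hpos by (intro filterlim_at_top_mult_tendsto_pos[OF tendsto_const _ filterlim_real_sequentially])
      then show ?thesis by (simp add: ennreal_tendsto_top_eq_at_top)
    qed
    show ?thesis
    proof (cases "f x = top")
      case True
      then have "ennreal (real m * h) \<le> (SUP k. ennreal (F k x))" for m using le[of m] by simp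
      then have "top \<le> (SUP k. ennreal (F k x))"
        by (intro LIMSEQ_le_const2[OF lim]) auto
      then show ?thesis by (metis top_greatest order_trans)
    next
      case False
      then have "f x < top" by (simp add: less_top)
      then have "\<forall>\<^sub>F m in sequentially. f x < ennreal (real m * h)"
        by (rule order_tendstoD(1)[OF lim])
      then obtain m where "f x < ennreal (real m * h)" by (auto simp: eventually_sequentially)
      then show ?thesis using le[of m] by simp
    qed
  qed
  have int: "(\<integral>\<^sup>+ x. ennreal (F k x) \<partial>M) \<le> (\<integral>\<^sup>+ x. f x \<partial>M) + ennreal e" for k
  proof -
    have mU: "U n \<in> sets M" "A n \<in> sets M" for n using U A by (auto simp: sets)
    have fM: "f \<in> borel_measurable M" using f sets measurable_cong_sets by blast
    have "(\<integral>\<^sup>+ x. ennreal (F k x) \<partial>M) \<le> (\<integral>\<^sup>+ x. ennreal h + (\<Sum>n<k. ennreal h * indicator (U n) x) \<partial>M)"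
    proof (rule nn_integral_mono)
      fix x
      have "ennreal (F k x) = ennreal h + (\<Sum>n<k. ennreal h * ennreal (open_approx (U n) k x))"
        unfolding F_def using hpos
        by (subst ennreal_plus) (auto simp: sum_nonneg open_approx_nonneg ennreal_mult simp flip: sum_ennreal)
      also have "\<dots> \<le> ennreal h + (\<Sum>n<k. ennreal h * indicator (U n) x)"
      proof (intro add_left_mono sum_mono mult_left_mono)
        fix n show "ennreal (open_approx (U n) k x) \<le> indicator (U n) x"
          using ennreal_leI[OF open_approx_le_indicator[of "U n" k x]] by (auto simp: indicator_def ennreal_eq_0_iff split: if_splits)
      qed simp
      finally show "ennreal (F k x) \<le> ennreal h + (\<Sum>n<k. ennreal h * indicator (U n) x)" .
    qed
    also have "\<dots> = ennreal h * emeasure M UNIV + (\<Sum>n<k. ennreal h * emeasure M (U n))"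
      using mU by (subst nn_integral_add, simp, simp, subst nn_integral_sum)
        (auto simp: nn_integral_cmult_indicator sp simp del: sum_mult_indicator)
    also have "\<dots> \<le> ennreal h * emeasure M UNIV + (\<Sum>n<k. ennreal h * (emeasure M (A n) + ennreal ((1/2)^Suc n)))"
      by (intro add_left_mono sum_mono mult_left_mono U) simp
    also have "\<dots> = ennreal h * emeasure M UNIV + (\<Sum>n<k. ennreal h * emeasure M (A n)) + (\<Sum>n<k. ennreal h * ennreal ((1/2)^Suc n))"
      by (simp add: distrib_left sum.distrib add.assoc)
    also have "\<dots> \<le> ennreal h * emeasure M UNIV + ((\<integral>\<^sup>+ x. f x \<partial>M) + ennreal h * emeasure M UNIV) + ennreal h"
    proof (intro add_mono order_refl)
      have "(\<Sum>n<k. ennreal h * emeasure M (A n)) = (\<integral>\<^sup>+ x. (\<Sum>n<k. ennreal h * indicator (A n) x) \<partial>M)"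
        using mU by (subst nn_integral_sum) (auto simp: nn_integral_cmult_indicator)
      also have "\<dots> \<le> (\<integral>\<^sup>+ x. f x + ennreal h \<partial>M)"
      proof (rule nn_integral_mono)
        fix x
        have "(\<Sum>n<k. ennreal h * indicator (A n) x) = (\<Sum>n<k. if ennreal (real n * h) < f x then ennreal h else 0)"
          by (rule sum.cong) (auto simp: A_def)
        then show "(\<Sum>n<k. ennreal h * indicator (A n) x) \<le> f x + ennreal h"
          using layer_sum_upper[OF hpos] by simp
      qed
      also have "\<dots> = (\<integral>\<^sup>+ x. f x \<partial>M) + ennreal h * emeasure M UNIV"
        using fM by (simp add: nn_integral_add sp)
      finally show "(\<Sum>n<k. ennreal h * emeasure M (A n)) \<le> (\<integral>\<^sup>+ x. f x \<partial>M) + ennreal h * emeasure M UNIV" .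
      have "(\<Sum>n<k. ennreal h * ennreal ((1/2)^Suc n)) = (\<Sum>n<k. ennreal (h * (1/2)^Suc n))"
        using hpos by (intro sum.cong refl ennreal_mult[symmetric]) auto
      also have "\<dots> = ennreal (\<Sum>n<k. h * (1/2)^Suc n)"
        using hpos by (intro sum_ennreal) auto
      also have "\<dots> \<le> ennreal (h * 1)"
      proof (rule ennreal_leI)
        have "(\<Sum>n<k. (1/2)^Suc n) \<le> (\<Sum>n. (1/2::real)^Suc n)"
          by (rule sum_le_suminf[OF sums_summable[OF power_half_series]]) auto
        also have "\<dots> = 1" using power_half_series by (simp add: sums_iff)
        finally have "(\<Sum>n<k. (1/2::real)^Suc n) \<le> 1" .
        then show "(\<Sum>n<k. h * (1/2)^Suc n) \<le> h * 1"
          using hpos by (metis mult_left_mono less_imp_le sum_distrib_left)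
      qed
      finally show "(\<Sum>n<k. ennreal h * ennreal ((1/2)^Suc n)) \<le> ennreal h" by simp
    qed
    also have "\<dots> = (\<integral>\<^sup>+ x. f x \<partial>M) + (ennreal h * emeasure M UNIV + ennreal h * emeasure M UNIV + ennreal h)"
      by (simp add: ac_simps)
    also have "ennreal h * emeasure M UNIV + ennreal h * emeasure M UNIV + ennreal h = ennreal (h * (2 * measure M UNIV + 1))"
      using hpos by (simp add: emeasure_eq_measure algebra_simps ennreal_mult'[symmetric] flip: ennreal_plus)
    finally show ?thesis by (simp add: h_le)
  qed
  show ?thesis by (rule that[OF hpos cont low mono up int])
qed

subsection \<open>Line integrals along Lipschitz curves\<close>

lemma curve_length_le_lipschitz:
  fixes g :: "real \<Rightarrow> 'a::metric_space"
  assumes "a \<le> b" and lip: "\<And>x y. a \<le> x \<Longrightarrow> x \<le> y \<Longrightarrow> y \<le> b \<Longrightarrow> dist (g x) (g y) \<le> K * (y - x)"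
  shows "curve_length (a, b, g) \<le> ennreal (K * (b - a))"
  unfolding curve_length_def prod.case
proof (rule SUP_least, clarify)
  fix n :: nat and t :: "nat \<Rightarrow> real" assume t: "a = t 0" "b = t n" "mono_on {..n} t"
  have "dist (g (t i)) (g (t (Suc i))) \<le> K * (t (Suc i) - t i)" if "i < n" for i
    unfolding t(1,2)[symmetric]
    by (intro lip) (use that monotone_onD[OF t(3)] in \<open>auto simp: t(1,2)\<close>)
  then have "(\<Sum>i<n. dist (g (t i)) (g (t (Suc i)))) \<le> (\<Sum>i<n. K * (t (Suc i) - t i))"
    by (intro sum_mono) auto
  also have "\<dots> = K * (t n - t 0)"
    by (simp add: sum_lessThan_telescope flip: sum_distrib_left)
  finally show "(\<Sum>i<n. ennreal (dist (g (t i)) (g (t (Suc i))))) \<le> ennreal (K * (t n - t 0))"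
    by (simp add: sum_ennreal ennreal_leI)
qed

lemma dist_le_curve_length:
  fixes g :: "real \<Rightarrow> 'a::metric_space"
  assumes "a \<le> b"
  shows "ennreal (dist (g a) (g b)) \<le> curve_length (a, b, g)"
  unfolding curve_length_def prod.case
proof (rule SUP_upper2[of "(1, \<lambda>i. if i = 0 then a else b)"])
  show "(1, \<lambda>i. if i = 0 then a else b) \<in> {(n :: nat, t :: nat \<Rightarrow> real). t 0 = a \<and> t n = b \<and> mono_on {..n} t}"
    using assms by (auto simp: monotone_on_def)
qed auto

lemma curve_length_subadditive:
  fixes g :: "real \<Rightarrow> 'a::metric_space"
  assumes "a \<le> b" "b \<le> c"
  shows "curve_length (a, c, g) \<le> curve_length (a, b, g) + curve_length (b, c, g)"
  unfolding curve_length_def[THEN fun_cong, of "(a, c, g)"] prod.case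
proof (rule SUP_least)
  fix z assume "z \<in> {(n :: nat, t :: nat \<Rightarrow> real). t 0 = a \<and> t n = c \<and> mono_on {..n} t}"
  then obtain n t where z: "z = (n, t)" and t: "a = t 0" "c = t n" "mono_on {..n} t" by auto
  \<comment> \<open>Clamping a partition of \<open>[a, c]\<close> at \<open>b\<close> gives partitions of \<open>[a, b]\<close> and \<open>[b, c]\<close> of the same size.\<close>
  define t1 t2 where "t1 = (\<lambda>i. min (t i) b)" and "t2 = (\<lambda>i. max (t i) b)"
  have "(\<Sum>i<n. ennreal (dist (g (t i)) (g (t (Suc i))))) \<le>
      (\<Sum>i<n. ennreal (dist (g (t1 i)) (g (t1 (Suc i)))) + ennreal (dist (g (t2 i)) (g (t2 (Suc i)))))"
  proof (rule sum_mono)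
    fix i assume "i \<in> {..<n}"
    then have "t i \<le> t (Suc i)" by (intro monotone_onD[OF t(3)]) auto
    then have "dist (g (t i)) (g (t (Suc i))) \<le> dist (g (t1 i)) (g (t1 (Suc i))) + dist (g (t2 i)) (g (t2 (Suc i)))"
      using dist_triangle[of "g (t i)" "g (t (Suc i))" "g b"]
      by (auto simp: t1_def t2_def min_def max_def)
    then show "ennreal (dist (g (t i)) (g (t (Suc i)))) \<le>
      ennreal (dist (g (t1 i)) (g (t1 (Suc i)))) + ennreal (dist (g (t2 i)) (g (t2 (Suc i))))"
      by (simp add: ennreal_leI flip: ennreal_plus)
  qed
  also have "\<dots> = (\<Sum>i<n. ennreal (dist (g (t1 i)) (g (t1 (Suc i))))) + (\<Sum>i<n. ennreal (dist (g (t2 i)) (g (t2 (Suc i)))))"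
    by (rule sum.distrib)
  also have "\<dots> \<le> curve_length (a, b, g) + curve_length (b, c, g)"
  proof (rule add_mono)
    have "mono_on {..n} t1" "mono_on {..n} t2"
      using t(3) by (fastforce simp: monotone_on_def t1_def t2_def)+
    have "t1 0 = a" "t1 n = b" "t2 0 = b" "t2 n = c"
      using assms t(1,2) by (auto simp: t1_def t2_def)
    then show "(\<Sum>i<n. ennreal (dist (g (t1 i)) (g (t1 (Suc i))))) \<le> curve_length (a, b, g)"
      "(\<Sum>i<n. ennreal (dist (g (t2 i)) (g (t2 (Suc i))))) \<le> curve_length (b, c, g)"
      using \<open>mono_on {..n} t1\<close> \<open>mono_on {..n} t2\<close> unfolding curve_length_def prod.case
      by - (rule SUP_upper2[of "(n, t1)"], simp_all only: prod.case mem_Collect_eq simp_thms order_refl,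
          rule SUP_upper2[of "(n, t2)"], simp_all only: prod.case mem_Collect_eq simp_thms order_refl)
  qed
  finally show "(case z of (n, t) \<Rightarrow> \<Sum>i<n. ennreal (dist (g (t i)) (g (t (Suc i))))) \<le>
      curve_length (a, b, g) + curve_length (b, c, g)"
    by (simp only: z prod.case)
qed

lemma curve_length_append:
  fixes g :: "real \<Rightarrow> 'a::metric_space"
  assumes "a \<le> b" "b \<le> c"
  shows "curve_length (a, b, g) + ennreal (dist (g b) (g c)) \<le> curve_length (a, c, g)"
proof -
  let ?I = "{(n :: nat, t :: nat \<Rightarrow> real). t 0 = a \<and> t n = b \<and> mono_on {..n} t}"
  have "(0, \<lambda>_. a) \<in> ?I \<or> (1, \<lambda>i. if i = 0 then a else b) \<in> ?I"
    using assms by (auto simp: monotone_on_def)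
  then have "?I \<noteq> {}" by blast
  then have "curve_length (a, b, g) + ennreal (dist (g b) (g c)) =
    (SUP (n, t) \<in> ?I. (\<Sum>i<n. ennreal (dist (g (t i)) (g (t (Suc i))))) + ennreal (dist (g b) (g c)))"
    unfolding curve_length_def prod.case by (subst ennreal_SUP_add_left[symmetric]) (auto simp: case_prod_beta')
  also have "\<dots> \<le> curve_length (a, c, g)"
  proof (rule SUP_least)
    fix z assume "z \<in> ?I"
    then obtain n t where z: "z = (n, t)" and t: "t 0 = a" "t n = b" "mono_on {..n} t" by auto
    define t' where "t' = (\<lambda>i. if i \<le> n then t i else c)"
    have "t i \<le> c" if "i \<le> n" for i
      using monotone_onD[OF t(3), of i n] that assms t(2) by auto
    then have "mono_on {..Suc n} t'"
      using t(3) by (auto simp: monotone_on_def t'_def)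
    then have mem: "(Suc n, t') \<in> {(n :: nat, t :: nat \<Rightarrow> real). t 0 = a \<and> t n = c \<and> mono_on {..n} t}"
      by (simp add: t) (simp add: t'_def t)
    have "(\<Sum>i<Suc n. ennreal (dist (g (t' i)) (g (t' (Suc i))))) \<le> curve_length (a, c, g)"
      unfolding curve_length_def prod.case
      by (rule SUP_upper2[OF mem]) (simp only: prod.case order_refl)
    moreover have "(\<Sum>i<n. ennreal (dist (g (t' i)) (g (t' (Suc i))))) = (\<Sum>i<n. ennreal (dist (g (t i)) (g (t (Suc i)))))"
      by (rule sum.cong) (auto simp: t'_def)
    moreover have "g (t' n) = g b" "g (t' (Suc n)) = g c" by (simp_all add: t'_def t)
    ultimately show "(case z of (n, t) \<Rightarrow> (\<Sum>i<n. ennreal (dist (g (t i)) (g (t (Suc i))))) + ennreal (dist (g b) (g c))) \<le>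
        curve_length (a, c, g)"
      by (simp only: sum.lessThan_Suc z prod.case)
  qed
  finally show ?thesis .
qed

text \<open>The local hypothesis says that \<open>w\<close> times the speed of \<open>g\<close> is
  at most 1, so that integrating over the parameter gives at most \<open>M\<close>. No derivative is
  used: on a short interval \<open>w\<close> is almost constant, which makes \<open>g\<close>
  Lipschitz with a constant close to \<open>1 / w\<close> and bounds the growth of arc length
  accordingly. The measurability statement is recorded for a later use of monotone convergence in
  \<open>w\<close>.\<close>

lemma line_integral_le_of_local_bound:
  fixes g :: "real \<Rightarrow> 'a::metric_space" and w :: "'a \<Rightarrow> real"
  assumes M: "0 \<le> M" and lip: "\<And>x y. 0 \<le> x \<Longrightarrow> x \<le> y \<Longrightarrow> y \<le> M \<Longrightarrow> dist (g x) (g y) \<le> K * (y - x)"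
    and w: "continuous_on UNIV w" and c: "0 < c" "\<And>x. c \<le> w x"
    and loc: "\<And>\<eta>. 0 < \<eta> \<Longrightarrow> \<exists>h>0. \<forall>s t. 0 \<le> s \<longrightarrow> s \<le> t \<longrightarrow> t \<le> M \<longrightarrow> t - s < h \<longrightarrow>
        (w (g s) - \<eta>) * dist (g s) (g t) \<le> t - s"
  shows "line_integral (0, M, g) (\<lambda>x. ennreal (w x)) \<le> ennreal M"
    and "(\<lambda>l. ennreal (w (arclength_param (0, M, g) l)) * indicator {0..enn2real (curve_length (0, M, g))} l)
      \<in> borel_measurable lborel"
proof -
  define L where "L = (\<lambda>x. enn2real (curve_length (0, x, g)))"
  have Leq: "curve_length (0, x, g) = ennreal (L x)" if "0 \<le> x" "x \<le> M" for x
  proof -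
    have "curve_length (0, x, g) \<le> ennreal (K * (x - 0))"
      using that by (intro curve_length_le_lipschitz lip) auto
    then have "curve_length (0, x, g) < top" using ennreal_less_top le_less_trans by blast
    then show ?thesis by (simp add: L_def)
  qed
  have Lnn: "0 \<le> L x" for x by (simp add: L_def)
  have L0: "L 0 = 0"
    using curve_length_le_lipschitz[of 0 0 g K] lip M by (auto simp: L_def)
  have Ldist: "dist (g s) (g t) \<le> L t - L s" if "0 \<le> s" "s \<le> t" "t \<le> M" for s t
  proof -
    have "ennreal (L s + dist (g s) (g t)) \<le> ennreal (L t)"
      using curve_length_append[of 0 s t g] that by (simp add: Leq Lnn ennreal_plus)
    then have "L s + dist (g s) (g t) \<le> L t" using Lnn[of t] by (subst (asm) ennreal_le_iff) auto
    then show ?thesis by simp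
  qed
  have Lmono: "L s \<le> L t" if "0 \<le> s" "s \<le> t" "t \<le> M" for s t
    using Ldist[OF that] zero_le_dist[of "g s" "g t"] by linarith
  have Llip: "L t - L s \<le> \<kappa> * (t - s)" if "0 \<le> s" "s \<le> t" "t \<le> M" "0 \<le> \<kappa>"
    "\<And>x y. s \<le> x \<Longrightarrow> x \<le> y \<Longrightarrow> y \<le> t \<Longrightarrow> dist (g x) (g y) \<le> \<kappa> * (y - x)" for s t \<kappa>
  proof -
    have "ennreal (L t) \<le> ennreal (L s) + curve_length (s, t, g)"
      using curve_length_subadditive[of 0 s t g] that by (simp add: Leq)
    also have "\<dots> \<le> ennreal (L s) + ennreal (\<kappa> * (t - s))"
      using that by (intro add_left_mono curve_length_le_lipschitz) auto
    also have "\<dots> = ennreal (L s + \<kappa> * (t - s))" using that by (simp add: Lnn)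
    finally show ?thesis using that Lnn[of s] by (subst (asm) ennreal_le_iff) auto
  qed
  have lip': "dist (g x) (g y) \<le> \<bar>K\<bar> * (y - x)" if "0 \<le> x" "x \<le> y" "y \<le> M" for x y
    using lip[OF that] that by (smt (verit) mult_right_mono)
  have Lcont: "continuous_on {0..M} L"
  proof (rule lipschitz_on_continuous_on[of "\<bar>K\<bar>"], rule lipschitz_onI)
    fix x y assume xy: "x \<in> {0..M}" "y \<in> {0..M}"
    have *: "dist (L x) (L y) \<le> \<bar>K\<bar> * dist x y" if "x \<le> y" "x \<in> {0..M}" "y \<in> {0..M}" for x y
      using Llip[of x y "\<bar>K\<bar>"] lip' Lmono[of x y] that by (auto simp: dist_real_def)
    show "dist (L x) (L y) \<le> \<bar>K\<bar> * dist x y"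
      using *[of x y] *[of y x] xy by (cases "x \<le> y") (auto simp: dist_commute)
  qed simp
  have Lsurj: "\<exists>x. 0 \<le> x \<and> x \<le> M \<and> L x = l" if "0 \<le> l" "l \<le> L M" for l
    using IVT'[of L 0 l M] that Lcont M L0 by auto
  have geq: "g x = g y" if "0 \<le> x" "x \<le> M" "0 \<le> y" "y \<le> M" "L x = L y" for x y
  proof -
    have "dist (g x) (g y) \<le> 0"
      using Ldist[of x y] Ldist[of y x] that by (smt (verit) dist_commute)
    then show ?thesis by simp
  qed
  define P where "P = arclength_param (0, M, g)"
  have P: "P (L x) = g x" if "0 \<le> x" "x \<le> M" for x
  proof -
    let ?Q = "\<lambda>y. y \<in> {0..M} \<and> curve_length (0, y, g) = ennreal (L x)"
    have "?Q x" using that Leq by auto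
    then have "?Q (SOME y. ?Q y)" by (rule someI)
    then have "(SOME y. ?Q y) \<in> {0..M}" "L (SOME y. ?Q y) = L x"
      using Leq Lnn by (auto simp: L_def)
    then show ?thesis unfolding P_def arclength_param_def prod.case
      using that by (intro geq) auto
  qed
  have Plip: "dist (P l) (P l') \<le> dist l l'" if l: "l \<in> {0..L M}" "l' \<in> {0..L M}" for l l'
  proof -
    obtain x y where xy: "0 \<le> x" "x \<le> M" "L x = l" "0 \<le> y" "y \<le> M" "L y = l'"
      using Lsurj[of l] Lsurj[of l'] l by auto
    then show ?thesis
      using Ldist[of x y] Ldist[of y x] P[of x] P[of y] by (cases "x \<le> y") (auto simp: dist_real_def dist_commute)
  qed
  have Pcont: "continuous_on {0..L M} P"
    by (rule lipschitz_on_continuous_on[of 1], rule lipschitz_onI) (use Plip in auto)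
  define f where "f = (\<lambda>l. ennreal (w (P l)) * indicator {0..L M} l)"
  have fmeas: "f \<in> borel_measurable lborel"
  proof -
    have "continuous_on {0..L M} (\<lambda>l. w (P l))"
      by (rule continuous_on_compose2[OF w Pcont]) auto
    then have "(\<lambda>l. indicator {0..L M} l *\<^sub>R w (P l)) \<in> borel_measurable borel"
      by (intro borel_measurable_continuous_on_indicator) auto
    then have "(\<lambda>l. ennreal (indicator {0..L M} l *\<^sub>R w (P l))) \<in> borel_measurable lborel" by simp
    also have "(\<lambda>l. ennreal (indicator {0..L M} l *\<^sub>R w (P l))) = f"
      by (auto simp: f_def fun_eq_iff indicator_def)
    finally show ?thesis .
  qed
  then show "(\<lambda>l. ennreal (w (arclength_param (0, M, g) l)) * indicator {0..enn2real (curve_length (0, M, g))} l)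
      \<in> borel_measurable lborel"
    by (simp add: f_def P_def L_def)
  have gcont: "continuous_on {0..M} g"
  proof (rule lipschitz_on_continuous_on[of "\<bar>K\<bar>"], rule lipschitz_onI)
    fix x y assume "x \<in> {0..M}" "y \<in> {0..M}"
    then show "dist (g x) (g y) \<le> \<bar>K\<bar> * dist x y"
      using lip'[of x y] lip'[of y x] by (cases "x \<le> y") (auto simp: dist_commute dist_real_def)
  qed simp
  have uc: "uniformly_continuous_on {0..M} (\<lambda>x. w (g x))"
    by (intro compact_uniformly_continuous continuous_on_compose2[OF w gcont]) auto
  have bound: "(\<integral>\<^sup>+ l. f l \<partial>lborel) \<le> ennreal (M + M * (3 * \<eta> / (c - 2 * \<eta>)))" if \<eta>: "0 < \<eta>" "2 * \<eta> < c" for \<eta>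
  proof -
    \<comment> \<open>With \<open>W = w (g s)\<close>, the integrand is at most
      \<open>W + \<eta>\<close> and arc length grows at rate at most
      \<open>1 / (W - 2 * \<eta>)\<close>. The product is
      \<open>1 + 3 * \<eta> / (W - 2 * \<eta>)\<close>, which is largest at the least admissible
      value \<open>W = c\<close>.\<close>
    define \<kappa> where "\<kappa> = 1 + 3 * \<eta> / (c - 2 * \<eta>)"
    have \<kappa>: "0 \<le> \<kappa>" using \<eta> by (simp add: \<kappa>_def)
    obtain h1 where h1: "h1 > 0" "\<And>s t. 0 \<le> s \<Longrightarrow> s \<le> t \<Longrightarrow> t \<le> M \<Longrightarrow> t - s < h1 \<Longrightarrow>
        (w (g s) - \<eta>) * dist (g s) (g t) \<le> t - s"
      using loc[OF \<eta>(1)] by blast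
    obtain h2 where h2: "h2 > 0" "\<And>x y. x \<in> {0..M} \<Longrightarrow> y \<in> {0..M} \<Longrightarrow> dist x y < h2 \<Longrightarrow> dist (w (g x)) (w (g y)) < \<eta>"
      using uc \<eta>(1) unfolding uniformly_continuous_on_def by (metis dist_commute)
    \<comment> \<open>Half-open intervals tile the range of \<open>L\<close> without overlap even
      where \<open>L\<close> is constant. The point \<open>l = 0\<close> that they leave out is a
      null set.\<close>
    have step: "(\<integral>\<^sup>+ l \<in> {L s<..L t}. f l \<partial>lborel) \<le> ennreal (\<kappa> * (t - s))"
      if st: "0 \<le> s" "s \<le> t" "t \<le> M" "t - s < h1" "t - s < h2" for s t
    proof -
      define W where "W = w (g s)"
      have W: "c \<le> W" by (simp add: W_def c)
      have near: "\<bar>w (g x) - W\<bar> \<le> \<eta>" if "s \<le> x" "x \<le> t" for x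
        using h2(2)[of x s] that st by (auto simp: W_def dist_real_def)
      have "dist (g x) (g y) \<le> 1 / (W - 2 * \<eta>) * (y - x)" if "s \<le> x" "x \<le> y" "y \<le> t" for x y
      proof -
        have "(W - 2 * \<eta>) * dist (g x) (g y) \<le> (w (g x) - \<eta>) * dist (g x) (g y)"
          using near[of x] that by (intro mult_right_mono) auto
        also have "\<dots> \<le> y - x" using that st by (intro h1(2)) auto
        finally show ?thesis using W \<eta> by (simp add: field_simps)
      qed
      then have LL: "L t - L s \<le> 1 / (W - 2 * \<eta>) * (t - s)"
        using st W \<eta> by (intro Llip) auto
      have "(\<integral>\<^sup>+ l \<in> {L s<..L t}. f l \<partial>lborel) \<le> (\<integral>\<^sup>+ l. ennreal (W + \<eta>) * indicator {L s<..L t} l \<partial>lborel)"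
      proof (rule nn_integral_mono)
        fix l
        show "f l * indicator {L s<..L t} l \<le> ennreal (W + \<eta>) * indicator {L s<..L t} l"
        proof (cases "l \<in> {L s<..L t}")
          case True
          have lM: "0 \<le> l" "l \<le> L M" using True Lnn[of s] Lmono[of t M] st by auto
          then obtain x where x: "0 \<le> x" "x \<le> M" "L x = l" using Lsurj by blast
          have "\<not> x \<le> s" using Lmono[of x s] x True st by auto
          have "w (g x) \<le> W + \<eta>"
          proof (cases "x \<le> t")
            case True then show ?thesis using near[of x] \<open>\<not> x \<le> s\<close> by auto
          next
            \<comment> \<open>The parameter supplied by \<open>Lsurj\<close> may lie beyond
              \<open>t\<close> if \<open>L\<close> is constant from \<open>t\<close> on. The point
              of the curve is then the same.\<close>
            case False
            then have "L x = L t" using Lmono[of t x] x True st by auto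
            then have "g x = g t" using x st by (intro geq) auto
            then show ?thesis using near[of t] st by auto
          qed
          then have "f l \<le> ennreal (W + \<eta>)"
            using P[of x] x lM by (auto simp: f_def intro: ennreal_leI)
          then show ?thesis using True by simp
        qed simp
      qed
      also have "\<dots> = ennreal (W + \<eta>) * ennreal (L t - L s)"
        using Lmono[of s t] st by (simp add: nn_integral_cmult_indicator)
      also have "\<dots> = ennreal ((W + \<eta>) * (L t - L s))"
        using W c \<eta> Lmono[of s t] st by (simp add: ennreal_mult)
      also have "\<dots> \<le> ennreal (\<kappa> * (t - s))"
      proof (rule ennreal_leI)
        have "(W + \<eta>) * (L t - L s) \<le> (W + \<eta>) * (1 / (W - 2 * \<eta>) * (t - s))"
          using W c \<eta> by (intro mult_left_mono LL) auto
        also have "\<dots> = (1 + 3 * \<eta> / (W - 2 * \<eta>)) * (t - s)"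
          using W \<eta> by (simp add: field_simps)
        also have "\<dots> \<le> \<kappa> * (t - s)"
          unfolding \<kappa>_def using W \<eta> st by (intro mult_right_mono add_left_mono divide_left_mono) auto
        finally show "(W + \<eta>) * (L t - L s) \<le> \<kappa> * (t - s)" .
      qed
      finally show ?thesis .
    qed
    obtain n :: nat where n: "n > 0" "M / real n < min h1 h2"
    proof -
      have "(\<lambda>n. M / real n) \<longlonglongrightarrow> 0" by (rule lim_const_over_n)
      then have "\<forall>\<^sub>F n in sequentially. M / real n < min h1 h2"
        using h1 h2 by (intro order_tendstoD(2)) auto
      then have "\<forall>\<^sub>F n in sequentially. M / real n < min h1 h2 \<and> n > 0"
        using eventually_gt_at_top[of "0::nat"] by eventually_elim auto
      then show ?thesis using that by (auto simp: eventually_sequentially)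
    qed
    define t where "t = (\<lambda>i. real i * (M / real n))"
    have t: "0 \<le> t i" "t i \<le> t (Suc i)" "t (Suc i) - t i = M / real n" for i
      using M by (auto simp: t_def algebra_simps add_divide_distrib)
    have tM: "t i \<le> M" if "i \<le> n" for i
    proof -
      have "t i \<le> real n * (M / real n)" unfolding t_def using that M by (intro mult_right_mono) auto
      then show ?thesis using n by simp
    qed
    have tn: "t n = M" using n by (simp add: t_def)
    have "(\<integral>\<^sup>+ l \<in> {0<..L (t i)}. f l \<partial>lborel) \<le> ennreal (\<kappa> * t i)" if "i \<le> n" for i
      using that
    proof (induction i)
      case 0
      then show ?case by (simp add: t_def L0)
    next
      case (Suc i)
      have "{0<..L (t (Suc i))} = {0<..L (t i)} \<union> {L (t i)<..L (t (Suc i))}"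
        using Lnn[of "t i"] Lmono[OF t(1,2) tM[OF Suc.prems]] by auto
      then have "(\<integral>\<^sup>+ l \<in> {0<..L (t (Suc i))}. f l \<partial>lborel) =
        (\<integral>\<^sup>+ l. f l * indicator {0<..L (t i)} l + f l * indicator {L (t i)<..L (t (Suc i))} l \<partial>lborel)"
        by (intro nn_integral_cong) (auto simp: indicator_def)
      also have "\<dots> = (\<integral>\<^sup>+ l \<in> {0<..L (t i)}. f l \<partial>lborel) + (\<integral>\<^sup>+ l \<in> {L (t i)<..L (t (Suc i))}. f l \<partial>lborel)"
        using fmeas by (intro nn_integral_add) auto
      also have "\<dots> \<le> ennreal (\<kappa> * t i) + ennreal (\<kappa> * (t (Suc i) - t i))"
        using Suc n t by (intro add_mono step tM) auto
      also have "\<dots> = ennreal (\<kappa> * t (Suc i))"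
        using \<kappa> t(1)[of i] t(2)[of i] by (simp flip: ennreal_plus add: algebra_simps mult_left_mono)
      finally show ?case .
    qed
    from this[of n] have "(\<integral>\<^sup>+ l \<in> {0<..L M}. f l \<partial>lborel) \<le> ennreal (\<kappa> * M)" by (simp add: tn)
    moreover have "(\<integral>\<^sup>+ l. f l \<partial>lborel) = (\<integral>\<^sup>+ l \<in> {0<..L M}. f l \<partial>lborel)"
    proof (rule nn_integral_cong_AE)
      have "AE l in lborel. l \<noteq> (0::real)" by (rule AE_lborel_singleton)
      then show "AE l in lborel. f l = f l * indicator {0<..L M} l"
        by eventually_elim (auto simp: f_def indicator_def)
    qed
    ultimately show ?thesis by (simp add: \<kappa>_def algebra_simps)
  qed
  have "(\<integral>\<^sup>+ l. f l \<partial>lborel) \<le> ennreal M"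
  proof (rule ennreal_le_epsilon)
    fix e :: real assume "e > 0"
    \<comment> \<open>The bound \<open>c / 4\<close> keeps the denominator
      \<open>c - 2 * \<eta>\<close> above \<open>c / 2\<close>; the other bound then makes the
      relative error at most \<open>e / (M + 1)\<close>. Dividing by \<open>M + 1\<close> instead of
      \<open>M\<close> allows \<open>M = 0\<close>.\<close>
    define \<eta> where "\<eta> = min (c / 4) (e / (M + 1) * c / 6)"
    have \<eta>: "0 < \<eta>" "2 * \<eta> < c" using c \<open>e > 0\<close> M by (auto simp: \<eta>_def)
    have "3 * \<eta> / (c - 2 * \<eta>) \<le> 3 * \<eta> / (c / 2)"
      using \<eta> c by (intro divide_left_mono) (auto simp: \<eta>_def)
    also have "\<dots> = 6 * \<eta> / c" by simp
    also have "\<dots> \<le> 6 * (e / (M + 1) * c / 6) / c"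
      using c by (intro divide_right_mono mult_left_mono) (auto simp: \<eta>_def)
    also have "\<dots> = e / (M + 1)" using c(1) M by (simp add: divide_simps)
    finally have "M * (3 * \<eta> / (c - 2 * \<eta>)) \<le> M * (e / (M + 1))"
      using M by (rule mult_left_mono)
    also have "\<dots> \<le> e" using M \<open>e > 0\<close> by (simp add: field_simps)
    finally have "ennreal (M + M * (3 * \<eta> / (c - 2 * \<eta>))) \<le> ennreal (M + e)"
      by (intro ennreal_leI) simp
    with bound[OF \<eta>] show "(\<integral>\<^sup>+ l. f l \<partial>lborel) \<le> ennreal M + ennreal e"
      using M \<open>e > 0\<close> by simp
  qed
  then show "line_integral (0, M, g) (\<lambda>x. ennreal (w x)) \<le> ennreal M"
    by (simp add: line_integral_def f_def P_def L_def)
qed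

subsection \<open>Limits of chains\<close>

text \<open>Tychonoff: \<open>g\<close> is a common point of the closures of all tails of
  \<open>s\<close> in the product space. An uncountable product need not be sequentially compact, so
  no single subsequence is claimed to converge at all parameters; the indices
  \<open>\<sigma>\<close> depend on the finite set \<open>T\<close> and are only required to tend to
  infinity.\<close>

lemma compact_pointwise_cluster:
  fixes s :: "nat \<Rightarrow> 'b \<Rightarrow> 'a::metric_space"
  assumes "compact (UNIV :: 'a set)"
  obtains g where "\<And>T. finite T \<Longrightarrow> \<exists>\<sigma>. (\<forall>i. i \<le> \<sigma> i) \<and> (\<forall>t\<in>T. (\<lambda>i. s (\<sigma> i) t) \<longlonglongrightarrow> g t)"
proof -
  let ?X = "product_topology (\<lambda>_::'b. euclidean :: 'a topology) UNIV"
  have cs: "compact_space ?X"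
    by (subst compact_space_product_topology) (use assms in \<open>auto simp: compact_space_def\<close>)
  have fip: "\<Inter>\<U> \<noteq> {}" if "\<forall>C\<in>\<U>. closedin ?X C"
      "\<forall>\<F>. finite \<F> \<and> \<F> \<subseteq> \<U> \<longrightarrow> \<Inter>\<F> \<noteq> {}" for \<U>
    by (rule cs[unfolded compact_space_fip, THEN spec, THEN mp, OF conjI[OF that]])
  have int: "\<Inter>\<F> \<noteq> {}" if \<F>: "finite \<F>" "\<F> \<subseteq> range (\<lambda>m. ?X closure_of (s ` {m..}))" for \<F>
  proof -
    obtain I where I: "finite I" "\<F> = (\<lambda>m. ?X closure_of (s ` {m..})) ` I"
      using finite_subset_image[of \<F> "\<lambda>m. ?X closure_of (s ` {m..})" UNIV] \<F> by auto
    have "s (Max (insert 0 I)) \<in> ?X closure_of (s ` {m..})" if "m \<in> I" for m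
    proof -
      have "s (Max (insert 0 I)) \<in> s ` {m..}" using that I by auto
      then show ?thesis by (intro subsetD[OF closure_of_subset]) (auto simp: PiE_def extensional_def)
    qed
    then show ?thesis using I by auto
  qed
  have "\<Inter>(range (\<lambda>m. ?X closure_of (s ` {m..}))) \<noteq> {}"
  proof (rule fip)
    show "\<forall>C\<in>range (\<lambda>m. ?X closure_of (s ` {m..})). closedin ?X C" by auto
    show "\<forall>\<F>. finite \<F> \<and> \<F> \<subseteq> range (\<lambda>m. ?X closure_of (s ` {m..})) \<longrightarrow> \<Inter>\<F> \<noteq> {}"
      by (intro allI impI) (elim conjE, rule int)
  qed
  then obtain g where g: "\<And>m. g \<in> ?X closure_of (s ` {m..})" by auto
  have near: "\<exists>k\<ge>m. \<forall>t\<in>T. dist (s k t) (g t) < e" if "finite T" "e > 0" for T m and e :: real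
  proof -
    define V where "V = PiE UNIV (\<lambda>t. if t \<in> T then ball (g t) e else UNIV)"
    have "openin ?X V"
      unfolding V_def openin_PiE_gen using \<open>finite T\<close> by (auto intro: finite_subset[of _ T])
    have "g \<in> V" using \<open>e > 0\<close> by (auto simp: V_def)
    then obtain k where "k \<ge> m" "s k \<in> V"
    proof -
      have "\<exists>y. y \<in> s ` {m..} \<and> y \<in> V"
        using g[of m] \<open>openin ?X V\<close> unfolding in_closure_of by (elim conjE allE[of _ V]) (rule mp, assumption, rule conjI, rule \<open>g \<in> V\<close>)
      then show ?thesis using that by auto
    qed
    then show ?thesis
      by (intro exI[of _ k]) (force simp: V_def PiE_iff dist_commute split: if_splits)
  qed
  show ?thesis
  proof (rule that)
    fix T :: "'b set" assume "finite T"
    then have "\<forall>i. \<exists>k\<ge>i. \<forall>t\<in>T. dist (s k t) (g t) < 1 / real (Suc i)"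
      using near by simp
    from choice[OF this] obtain \<sigma>
      where \<sigma>: "\<forall>i. i \<le> \<sigma> i \<and> (\<forall>t\<in>T. dist (s (\<sigma> i) t) (g t) < 1 / real (Suc i))"
      by (elim exE)
    have "(\<lambda>i. s (\<sigma> i) t) \<longlonglongrightarrow> g t" if "t \<in> T" for t
    proof (rule iffD2[OF tendsto_dist_iff], rule tendsto_sandwich[OF _ _ tendsto_const LIMSEQ_Suc[OF lim_1_over_n]])
      show "\<forall>\<^sub>F i in sequentially. dist (s (\<sigma> i) t) (g t) \<le> 1 / real (Suc i)"
        by (intro always_eventually allI less_imp_le \<sigma>[rule_format, THEN conjunct2, rule_format] that)
    qed simp
    with \<sigma> show "\<exists>\<sigma>. (\<forall>i. i \<le> \<sigma> i) \<and> (\<forall>t\<in>T. (\<lambda>i. s (\<sigma> i) t) \<longlonglongrightarrow> g t)" by blast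
  qed
qed

lemma dist_le_sum_steps:
  fixes x :: "nat \<Rightarrow> 'a::metric_space"
  assumes "a \<le> b"
  shows "dist (x a) (x b) \<le> (\<Sum>i=a..<b. dist (x i) (x (Suc i)))"
  using assms
proof (induction b rule: dec_induct)
  case (step b)
  then show ?case using dist_triangle[of "x a" "x (Suc b)" "x b"] by simp
qed simp

text \<open>A jump costs at most \<open>1 / (real k + 1)\<close>, so the Lipschitz bound in the cost
  parameter holds for the chains up to an error that vanishes in the limit. The last conclusion
  keeps the weight \<open>w m\<close> fixed while \<open>k\<close> tends to infinity: uniform
  continuity is available for one weight at a time, and \<open>w m \<le> w k\<close> for
  \<open>k \<ge> m\<close> turns the \<open>k\<close>-th cost into a bound for
  \<open>w m\<close>.\<close>

lemma chain_limit_curve: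
  fixes w :: "nat \<Rightarrow> 'a::metric_space \<Rightarrow> real" and x :: "nat \<Rightarrow> nat \<Rightarrow> 'a" and n :: "nat \<Rightarrow> nat"
  assumes X: "compact (UNIV :: 'a set)" and EF: "closed E" "closed F"
    and w: "\<And>k. continuous_on UNIV (w k)" and c: "0 < c" "\<And>k y. c \<le> w k y"
    and mono: "\<And>k l y. k \<le> l \<Longrightarrow> w k y \<le> w l y"
    and ends: "\<And>k. x k 0 \<in> E" "\<And>k. x k (n k) \<in> F"
    and small: "\<And>k i. i < n k \<Longrightarrow> w k (x k i) * dist (x k i) (x k (Suc i)) \<le> 1 / (real k + 1)"
    and cost: "\<And>k. (\<Sum>i<n k. w k (x k i) * dist (x k i) (x k (Suc i))) \<le> M"
  obtains g where "g 0 \<in> E" "g M \<in> F"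
    "\<And>s t. 0 \<le> s \<Longrightarrow> s \<le> t \<Longrightarrow> t \<le> M \<Longrightarrow> c * dist (g s) (g t) \<le> t - s"
    "\<And>m \<eta>. 0 < \<eta> \<Longrightarrow> \<exists>h>0. \<forall>s t. 0 \<le> s \<longrightarrow> s \<le> t \<longrightarrow> t \<le> M \<longrightarrow> t - s < h \<longrightarrow>
        (w m (g s) - \<eta>) * dist (g s) (g t) \<le> t - s"
proof -
  define cum where "cum = (\<lambda>k j. \<Sum>i=0..<j. w k (x k i) * dist (x k i) (x k (Suc i)))"
  have w0: "0 \<le> w k y" for k y using c(1) c(2)[of k y] by linarith
  have cum_diff: "cum k b - cum k a = (\<Sum>i=a..<b. w k (x k i) * dist (x k i) (x k (Suc i)))"
    if "a \<le> b" for k a b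
    unfolding cum_def using that by (intro sum_diff_nat_ivl) auto
  have cum_mono: "cum k a \<le> cum k b" if "a \<le> b" for k a b
  proof -
    have "0 \<le> cum k b - cum k a" unfolding cum_diff[OF that] by (intro sum_nonneg mult_nonneg_nonneg w0) auto
    then show ?thesis by simp
  qed
  have cum0: "cum k 0 = 0" for k by (simp add: cum_def)
  have cumM: "cum k (n k) \<le> M" for k using cost[of k] by (simp add: cum_def atLeast0LessThan)
  have M: "0 \<le> M" using cumM[of 0] cum_mono[of 0 "n 0" 0] by (simp add: cum0)
  have low: "v * dist (x k a) (x k b) \<le> cum k b - cum k a"
    if "a \<le> b" "\<And>j. a \<le> j \<Longrightarrow> j < b \<Longrightarrow> v \<le> w k (x k j)" for v k a b
  \<comment> \<open>The value used later is \<open>w m (S k s) - \<eta>\<close>, which may be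
    negative.\<close>
  proof (cases "0 \<le> v")
    case True
    have "v * dist (x k a) (x k b) \<le> v * (\<Sum>i=a..<b. dist (x k i) (x k (Suc i)))"
      by (intro mult_left_mono dist_le_sum_steps that(1) True)
    also have "\<dots> \<le> cum k b - cum k a"
      unfolding cum_diff[OF that(1)] sum_distrib_left using that(2)
      by (intro sum_mono mult_right_mono) auto
    finally show ?thesis .
  next
    case False
    then have "v * dist (x k a) (x k b) \<le> 0" by (simp add: mult_le_0_iff)
    then show ?thesis using cum_mono[OF that(1), of k] by linarith
  qed
  \<comment> \<open>\<open>t \<mapsto> x k (J k t)\<close> is the \<open>k\<close>-th chain as a step function parametrized by cost. On passing to
    the limit only finitely many parameters are needed at a time, so pointwise accumulation suffices.\<close>
  define J where "J = (\<lambda>k t. Max {j. j \<le> n k \<and> cum k j \<le> t})"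
  have J: "J k t \<le> n k" "cum k (J k t) \<le> t" "\<And>j. j \<le> n k \<Longrightarrow> cum k j \<le> t \<Longrightarrow> j \<le> J k t"
    if "0 \<le> t" for k t
  proof -
    have fin: "finite {j. j \<le> n k \<and> cum k j \<le> t}" by simp
    moreover have "{j. j \<le> n k \<and> cum k j \<le> t} \<noteq> {}" using that cum0 by (auto intro: exI[of _ 0])
    ultimately have "J k t \<in> {j. j \<le> n k \<and> cum k j \<le> t}" unfolding J_def by (rule Max_in)
    then show "J k t \<le> n k" "cum k (J k t) \<le> t" by auto
    show "j \<le> J k t" if "j \<le> n k" "cum k j \<le> t" for j
      unfolding J_def using that by (intro Max_ge fin) auto
  qed
  define S where "S = (\<lambda>k t. x k (J k t))"
  \<comment> \<open>Unless the chain has ended, the vertex after \<open>J k s\<close> has cost above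
    \<open>s\<close>, and one step costs at most \<open>1 / (real k + 1)\<close>; hence
    \<open>cum k (J k s)\<close> falls short of \<open>s\<close> by no more than that.\<close>
  have pair: "J k s \<le> J k t" "cum k (J k t) - cum k (J k s) \<le> t - s + 1 / (real k + 1)"
    if st: "0 \<le> s" "s \<le> t" for k s t
  proof -
    show le: "J k s \<le> J k t" using J(1,2)[of s k] J(3)[of t "J k s" k] st by auto
    show "cum k (J k t) - cum k (J k s) \<le> t - s + 1 / (real k + 1)"
    proof (cases "J k s < n k")
      case True
      then have "\<not> cum k (Suc (J k s)) \<le> s" using J(3)[of s "Suc (J k s)" k] st by auto
      moreover have "cum k (Suc (J k s)) - cum k (J k s) \<le> 1 / (real k + 1)"
        using small[OF True] by (simp add: cum_diff)
      ultimately show ?thesis using J(2)[of t k] st by linarith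
    next
      case False
      then have "J k s = J k t" using le J(1)[of t k] st by auto
      then show ?thesis using st by simp
    qed
  qed
  have Slip: "c * dist (S k s) (S k t) \<le> t - s + 1 / (real k + 1)" if "0 \<le> s" "s \<le> t" for k s t
    unfolding S_def using low[where v = c and k = k, OF pair(1)[OF that, of k] c(2)] pair(2)[OF that, of k] by simp
  \<comment> \<open>A chain may repeat its first point, so \<open>J k 0\<close> may be positive.
    Zero cost still means no movement, because the weights are at least
    \<open>c > 0\<close>.\<close>
  have S0: "S k 0 \<in> E" for k
  proof -
    have "c * dist (x k 0) (S k 0) \<le> 0"
      unfolding S_def using low[of 0 "J k 0" c k] c J(2)[of 0 k] by (simp add: cum0)
    then have "dist (x k 0) (S k 0) \<le> 0" using c(1) by (simp add: mult_le_0_iff)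
    then show ?thesis using ends(1)[of k] by simp
  qed
  have SM: "S k M \<in> F" for k
  proof -
    have "J k M = n k" using J(1)[OF M, of k] J(3)[OF M order_refl cumM[of k]] by simp
    then show ?thesis using ends(2)[of k] by (simp add: S_def)
  qed
  obtain g where g: "\<And>T. finite T \<Longrightarrow> \<exists>\<sigma>. (\<forall>i. i \<le> \<sigma> i) \<and> (\<forall>t\<in>T. (\<lambda>i. S (\<sigma> i) t) \<longlonglongrightarrow> g t)"
    using compact_pointwise_cluster[OF X, of S] by blast
  have lim0: "(\<lambda>i. 1 / (real (\<sigma> i) + 1)) \<longlonglongrightarrow> 0" if "\<And>i. i \<le> \<sigma> i" for \<sigma> :: "nat \<Rightarrow> nat"
  proof (rule tendsto_sandwich[OF _ _ tendsto_const LIMSEQ_Suc[OF lim_1_over_n]])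
    show "\<forall>\<^sub>F i in sequentially. 1 / (real (\<sigma> i) + 1) \<le> 1 / real (Suc i)"
      using that by (intro always_eventually allI divide_left_mono) auto
  qed (auto intro!: always_eventually)
  show ?thesis
  proof
    obtain \<sigma> where "(\<lambda>i. S (\<sigma> i) 0) \<longlonglongrightarrow> g 0" using g[of "{0}"] by auto
    then show "g 0 \<in> E" by (rule closed_sequentially[OF EF(1) S0])
    obtain \<sigma> where "(\<lambda>i. S (\<sigma> i) M) \<longlonglongrightarrow> g M" using g[of "{M}"] by auto
    then show "g M \<in> F" by (rule closed_sequentially[OF EF(2) SM])
  next
    fix s t :: real assume st: "0 \<le> s" "s \<le> t" "t \<le> M"
    obtain \<sigma> where \<sigma>: "\<And>i. i \<le> \<sigma> i" "(\<lambda>i. S (\<sigma> i) s) \<longlonglongrightarrow> g s" "(\<lambda>i. S (\<sigma> i) t) \<longlonglongrightarrow> g t"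
      using g[of "{s, t}"] by auto
    have lhs: "(\<lambda>i. c * dist (S (\<sigma> i) s) (S (\<sigma> i) t)) \<longlonglongrightarrow> c * dist (g s) (g t)"
      by (intro tendsto_intros \<sigma>)
    have rhs: "(\<lambda>i. t - s + 1 / (real (\<sigma> i) + 1)) \<longlonglongrightarrow> t - s + 0"
      by (intro tendsto_add tendsto_const lim0 \<sigma>)
    have "c * dist (g s) (g t) \<le> t - s + 0"
      by (rule tendsto_le[OF sequentially_bot rhs lhs]) (intro always_eventually allI Slip st)
    then show "c * dist (g s) (g t) \<le> t - s" by simp
  next
    fix m and \<eta> :: real assume "0 < \<eta>"
    have "uniformly_continuous_on UNIV (w m)"
      by (rule compact_uniformly_continuous[OF w X])
    then obtain r where r: "r > 0" "\<And>y z. dist y z < r \<Longrightarrow> \<bar>w m y - w m z\<bar> < \<eta>"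
      using \<open>0 < \<eta>\<close> unfolding uniformly_continuous_on_def dist_real_def by (metis UNIV_I dist_commute)
    have Sloc: "(w m (S k s) - \<eta>) * dist (S k s) (S k t) \<le> t - s + 1 / (real k + 1)"
      if st: "0 \<le> s" "s \<le> t" and k: "m \<le> k" "t - s + 1 / (real k + 1) < c * r" for k s t
    proof -
      have "(w m (S k s) - \<eta>) * dist (x k (J k s)) (x k (J k t)) \<le> cum k (J k t) - cum k (J k s)"
      proof (rule low[OF pair(1)[OF st]])
        fix j assume j: "J k s \<le> j" "j < J k t"
        have "c * dist (x k (J k s)) (x k j) \<le> cum k j - cum k (J k s)"
          using c by (intro low j) auto
        also have "\<dots> \<le> cum k (J k t) - cum k (J k s)" using cum_mono[of j "J k t" k] j by simp
        also have "\<dots> < c * r" using pair(2)[OF st, of k] k by linarith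
        finally have "dist (x k (J k s)) (x k j) < r" using c(1) by simp
        then have "\<bar>w m (S k s) - w m (x k j)\<bar> < \<eta>" unfolding S_def by (rule r(2))
        then show "w m (S k s) - \<eta> \<le> w k (x k j)" using mono[OF k(1), of "x k j"] by linarith
      qed
      then show ?thesis using pair(2)[OF st, of k] by (simp add: S_def)
    qed
    show "\<exists>h>0. \<forall>s t. 0 \<le> s \<longrightarrow> s \<le> t \<longrightarrow> t \<le> M \<longrightarrow> t - s < h \<longrightarrow> (w m (g s) - \<eta>) * dist (g s) (g t) \<le> t - s"
    \<comment> \<open>A piece of chain of cost below \<open>c * r\<close> has diameter less than
      \<open>r\<close> as seen from its start, and within distance \<open>r\<close> the weight
      \<open>w m\<close> varies by less than \<open>\<eta>\<close>.\<close>
    proof (intro exI[of _ "c * r"] conjI allI impI)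
      show "0 < c * r" using c(1) r(1) by simp
      fix s t assume st: "0 \<le> s" "s \<le> t" "t \<le> M" "t - s < c * r"
      obtain \<sigma> where \<sigma>: "\<And>i. i \<le> \<sigma> i" "(\<lambda>i. S (\<sigma> i) s) \<longlonglongrightarrow> g s" "(\<lambda>i. S (\<sigma> i) t) \<longlonglongrightarrow> g t"
        using g[of "{s, t}"] by auto
      have "isCont (w m) (g s)" using w[of m] by (simp add: continuous_on_eq_continuous_at)
      then have "(\<lambda>i. w m (S (\<sigma> i) s)) \<longlonglongrightarrow> w m (g s)"
        using \<sigma>(2) by (rule isCont_tendsto_compose)
      then have lhs: "(\<lambda>i. (w m (S (\<sigma> i) s) - \<eta>) * dist (S (\<sigma> i) s) (S (\<sigma> i) t)) \<longlonglongrightarrow> (w m (g s) - \<eta>) * dist (g s) (g t)"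
        by (intro tendsto_intros \<sigma>)
      have rhs: "(\<lambda>i. t - s + 1 / (real (\<sigma> i) + 1)) \<longlonglongrightarrow> t - s + 0"
        by (intro tendsto_add tendsto_const lim0 \<sigma>)
      have "\<forall>\<^sub>F i in sequentially. t - s + 1 / (real (\<sigma> i) + 1) < c * r"
        using st by (intro order_tendstoD[OF rhs]) simp
      then have "\<forall>\<^sub>F i in sequentially. (w m (S (\<sigma> i) s) - \<eta>) * dist (S (\<sigma> i) s) (S (\<sigma> i) t) \<le> t - s + 1 / (real (\<sigma> i) + 1)"
        using eventually_ge_at_top[of m]
      proof eventually_elim
        case (elim i)
        show ?case by (rule Sloc) (use st elim \<sigma>(1)[of i] in auto)
      qed
      then have "(w m (g s) - \<eta>) * dist (g s) (g t) \<le> t - s + 0"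
        by (rule tendsto_le[OF sequentially_bot rhs lhs])
      then show "(w m (g s) - \<eta>) * dist (g s) (g t) \<le> t - s" by simp
    qed
  qed
qed

text \<open>The value 1 is put into the set of costs so that the infimum makes sense where no chain
  arrives; chains are therefore recovered only for thresholds \<open>M \<le> 1\<close>. A step is
  charged with the weight at its starting point, so comparing \<open>u x\<close> and
  \<open>u y\<close> in both directions produces the maximum of the two weights.\<close>

lemma chain_potential:
  fixes w :: "'a::metric_space \<Rightarrow> real"
  assumes w: "\<And>x. 0 \<le> w x" and "e > 0"
  obtains u :: "'a \<Rightarrow> real" where "\<And>x. x \<in> E \<Longrightarrow> u x = 0" "\<And>x. 0 \<le> u x"
    "\<And>x y. dist x y < e \<Longrightarrow> \<bar>u x - u y\<bar> \<le> max (w x) (w y) * dist x y"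
    "\<And>y M. u y < M \<Longrightarrow> M \<le> 1 \<Longrightarrow> \<exists>x n. x 0 \<in> E \<and> x n = y \<and> (\<forall>i<n. dist (x i) (x (Suc i)) < e) \<and>
        (\<Sum>i<n. w (x i) * dist (x i) (x (Suc i))) < M"
proof -
  define S where "S = (\<lambda>y. {r. \<exists>x n. x 0 \<in> E \<and> x n = y \<and> (\<forall>i<n. dist (x i) (x (Suc i)) < e) \<and>
    r = (\<Sum>i<n. w (x i) * dist (x i) (x (Suc i)))})"
  define u where "u = (\<lambda>y. Inf (insert 1 (S y)))"
  have S0: "0 \<le> r" if "r \<in> S y" for r y
    using that by (auto simp: S_def intro!: sum_nonneg mult_nonneg_nonneg w)
  have bdd: "bdd_below (insert 1 (S y))" for y
    by (rule bdd_belowI[of _ 0]) (use S0 in auto)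
  have u0: "0 \<le> u y" for y
    unfolding u_def by (rule cInf_greatest) (use S0 in auto)
  have step: "u y \<le> u x + w x * dist x y" if "dist x y < e" for x y
  proof -
    have "u y - w x * dist x y \<le> u x"
      unfolding u_def
    proof (rule cInf_greatest)
      fix r assume r: "r \<in> insert 1 (S x)"
      show "Inf (insert 1 (S y)) - w x * dist x y \<le> r"
      proof (cases "r = 1")
        case True
        have "Inf (insert 1 (S y)) \<le> 1" by (rule cInf_lower[OF _ bdd]) simp
        moreover have "0 \<le> w x * dist x y" by (simp add: w)
        ultimately show ?thesis using True by linarith
      next
        case False
        then obtain z n where z: "z 0 \<in> E" "z n = x" "\<forall>i<n. dist (z i) (z (Suc i)) < e"
          "r = (\<Sum>i<n. w (z i) * dist (z i) (z (Suc i)))" using r by (auto simp: S_def)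
        define z' where "z' = (\<lambda>i. if i \<le> n then z i else y)"
        have "(\<Sum>i<n. w (z' i) * dist (z' i) (z' (Suc i))) = r"
          unfolding z(4) by (rule sum.cong) (auto simp: z'_def)
        then have "r + w x * dist x y = (\<Sum>i<Suc n. w (z' i) * dist (z' i) (z' (Suc i)))"
          using z by (simp add: z'_def)
        moreover have "z' 0 \<in> E" "z' (Suc n) = y" using z by (auto simp: z'_def)
        moreover have "\<forall>i<Suc n. dist (z' i) (z' (Suc i)) < e"
          using z that by (auto simp: z'_def less_Suc_eq)
        ultimately have "r + w x * dist x y \<in> S y" unfolding S_def by blast
        then have "Inf (insert 1 (S y)) \<le> r + w x * dist x y" by (intro cInf_lower bdd) simp
        then show ?thesis by simp
      qed
    qed simp
    then show ?thesis by simp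
  qed
  show ?thesis
  proof
    fix x assume "x \<in> E"
    then have "0 \<in> S x" unfolding S_def by (auto intro!: exI[of _ "\<lambda>_. x"] exI[of _ 0])
    then have "u x \<le> 0" unfolding u_def by (intro cInf_lower bdd) simp
    then show "u x = 0" using u0[of x] by simp
  next
    fix x y :: 'a assume d: "dist x y < e"
    have "w x * dist x y \<le> max (w x) (w y) * dist x y" "w y * dist x y \<le> max (w x) (w y) * dist x y"
      by (auto intro: mult_right_mono)
    then show "\<bar>u x - u y\<bar> \<le> max (w x) (w y) * dist x y"
      using step[OF d] step[of y x] d by (simp add: dist_commute abs_le_iff)
  next
    fix y M assume "u y < M" "M \<le> (1::real)"
    then obtain r where "r \<in> insert 1 (S y)" "r < M"
      unfolding u_def using cInf_lessD[of "insert 1 (S y)" M] by auto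
    with \<open>M \<le> 1\<close> have "r \<in> S y" by auto
    with \<open>r < M\<close> show "\<exists>x n. x 0 \<in> E \<and> x n = y \<and> (\<forall>i<n. dist (x i) (x (Suc i)) < e) \<and>
        (\<Sum>i<n. w (x i) * dist (x i) (x (Suc i))) < M"
      unfolding S_def by blast
  qed (rule u0)
qed

subsection \<open>Coarea inequality\<close>

lemma diam_pow_mono:
  assumes "A \<subseteq> B" "bounded B" "0 \<le> s"
  shows "diam_pow s A \<le> diam_pow s B"
  using assms diameter_subset[OF assms(1,2)] diameter_ge_0[OF bounded_subset[OF assms(2,1)]]
  by (auto simp: diam_pow_def intro!: ennreal_leI powr_mono2)

text \<open>The exchange behind the coarea inequality: one power of the diameter is traded for the
  length of the interval swept by \<open>u\<close>. For \<open>N = 1\<close> the first factor is the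
  conventional 1 of the counting measure and not \<open>diameter A powr 0\<close>, which is why the
  identity for powers is only set up for \<open>N \<noteq> 1\<close>.\<close>

lemma diam_pow_minus_1:
  assumes "N \<ge> 1" "0 \<le> L" "bounded A" "A \<noteq> {}"
  shows "diam_pow (N - 1) A * ennreal (L * diameter A) = ennreal L * diam_pow N A"
proof -
  have d: "0 \<le> diameter A" using assms by (simp add: diameter_ge_0)
  have "diameter A powr N = diameter A powr (N - 1) * diameter A" if "N \<noteq> 1"
    using d by (cases "diameter A = 0") (auto simp: powr_diff)
  then show ?thesis
    using assms d by (auto simp: diam_pow_def ennreal_mult algebra_simps)
qed

lemma hausdorff_cover_exists:
  fixes A :: "'a::metric_space set"
  assumes "s \<ge> 0" "\<delta> > 0" "hausdorff_outer s A < top" "e > 0"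
  obtains C :: "nat \<Rightarrow> 'a set" where "A \<subseteq> (\<Union>i. C i)" "\<And>i. bounded (C i)" "\<And>i. diameter (C i) < \<delta>"
    "ennreal (unit_ball_vol s / 2 powr s) * (\<Sum>i. diam_pow s (C i)) \<le> hausdorff_outer s A + ennreal e"
proof -
  let ?cov = "{C :: nat \<Rightarrow> 'a set. A \<subseteq> (\<Union>i. C i) \<and> (\<forall>i. bounded (C i) \<and> diameter (C i) < \<delta>)}"
  define \<kappa> where "\<kappa> = unit_ball_vol s / 2 powr s"
  have \<kappa>: "\<kappa> > 0" using assms by (simp add: \<kappa>_def)
  define b where "b = hausdorff_outer s A + ennreal e"
  define b' where "b' = ennreal (1 / \<kappa>) * b"
  have "ennreal \<kappa> * b' = ennreal (\<kappa> * (1 / \<kappa>)) * b"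
    unfolding b'_def using \<kappa> by (subst ennreal_mult) (auto simp: mult.assoc)
  then have bb: "ennreal \<kappa> * b' = b" using \<kappa> by simp
  have "hausdorff_pre s \<delta> A \<le> hausdorff_outer s A"
    unfolding hausdorff_outer_eq_SUP using assms by (intro SUP_upper) auto
  also have "\<dots> < b" unfolding b_def using assms by (simp add: ennreal_add_left_cancel_less)
  finally have "ennreal \<kappa> * (INF C\<in>?cov. \<Sum>i. diam_pow s (C i)) < ennreal \<kappa> * b'"
    unfolding bb by (simp only: hausdorff_pre_def \<kappa>_def)
  then have "(INF C\<in>?cov. \<Sum>i. diam_pow s (C i)) < b'"
    by (meson mult_left_mono not_le zero_le)
  then obtain C where C: "C \<in> ?cov" "(\<Sum>i. diam_pow s (C i)) < b'" by (auto simp: INF_less_iff)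
  have "ennreal \<kappa> * (\<Sum>i. diam_pow s (C i)) \<le> ennreal \<kappa> * b'"
    using C(2) by (intro mult_left_mono) auto
  then have "ennreal \<kappa> * (\<Sum>i. diam_pow s (C i)) \<le> b"
    unfolding bb .
  then have "ennreal (unit_ball_vol s / 2 powr s) * (\<Sum>i. diam_pow s (C i)) \<le> hausdorff_outer s A + ennreal e"
    unfolding b_def \<kappa>_def .
  then show ?thesis using that[of C] C(1) by auto
qed

lemma hausdorff_outer_le_liminf:
  assumes "\<And>k. hausdorff_pre s (\<delta> k) A \<le> h k" "\<delta> \<longlonglongrightarrow> 0"
  shows "hausdorff_outer s A \<le> liminf h"
  unfolding hausdorff_outer_eq_SUP
proof (rule SUP_least)
  fix d :: real assume "d \<in> {0<..}"
  then have "\<forall>\<^sub>F k in sequentially. \<delta> k < d" using order_tendstoD(2)[OF assms(2)] by auto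
  then have "\<forall>\<^sub>F k in sequentially. hausdorff_pre s d A \<le> h k"
  proof eventually_elim
    case (elim k)
    then have "hausdorff_pre s d A \<le> hausdorff_pre s (\<delta> k) A" by (intro hausdorff_pre_antimono) simp
    then show ?case using assms(1)[of k] by (rule order_trans)
  qed
  then show "hausdorff_pre s d A \<le> liminf h" by (rule Liminf_bounded)
qed

text \<open>Eilenberg's inequality. A piece of a nearly optimal cover meets the level set of
  \<open>t\<close> only for \<open>t\<close> in an interval of length at most \<open>L\<close> times
  its diameter; summing over the pieces and integrating bounds the premeasures, and Fatou's lemma
  passes to scale 0. The measure of a level set is not known to be measurable in \<open>t\<close>,
  so a Borel majorant \<open>h\<close> takes the place of an upper integral.\<close>

lemma coarea_lipschitz:
  fixes u :: "'a::metric_space \<Rightarrow> real"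
  assumes N: "N \<ge> 1" and L: "0 \<le> L" and e: "e > 0" and fin: "hausdorff_outer N A < top"
    and lip: "\<And>x y. x \<in> A \<Longrightarrow> y \<in> A \<Longrightarrow> dist x y < e \<Longrightarrow> \<bar>u x - u y\<bar> \<le> L * dist x y"
  obtains h where "h \<in> borel_measurable borel"
    "\<And>t. hausdorff_outer (N - 1) (A \<inter> u -` {t}) \<le> h t"
    "(\<integral>\<^sup>+ t. h t \<partial>lborel) \<le> ennreal (2 * unit_ball_vol (N - 1) / unit_ball_vol N) * (ennreal L * hausdorff_outer N A)"
proof -
  define K where "K = 2 * unit_ball_vol (N - 1) / unit_ball_vol N"
  define \<kappa> where "\<kappa> = unit_ball_vol N / 2 powr N"
  define \<kappa>' where "\<kappa>' = unit_ball_vol (N - 1) / 2 powr (N - 1)"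
  have vN: "unit_ball_vol N > 0" using N by simp
  \<comment> \<open>\<open>K\<close> is precisely the quotient of the normalizing constants in
    dimensions \<open>N - 1\<close> and \<open>N\<close>.\<close>
  have \<kappa>: "\<kappa>' = K * \<kappa>" "0 \<le> K" "0 \<le> \<kappa>" "0 \<le> \<kappa>'"
    using N vN unit_ball_vol_nonneg[of "N - 1"] by (auto simp: K_def \<kappa>_def \<kappa>'_def powr_diff less_imp_neq[THEN not_sym])
  define \<delta> where "\<delta> = (\<lambda>k. min e (1 / real (Suc k)))"
  have \<delta>: "\<delta> k > 0" "\<delta> k \<le> e" for k using e by (auto simp: \<delta>_def)
  have \<delta>0: "\<delta> \<longlonglongrightarrow> 0"
    by (rule tendsto_sandwich[OF _ _ tendsto_const LIMSEQ_Suc[OF lim_1_over_n]])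
       (use e in \<open>auto simp: \<delta>_def intro!: always_eventually\<close>)
  have "\<exists>C :: nat \<Rightarrow> 'a set. A \<subseteq> (\<Union>i. C i) \<and> (\<forall>i. bounded (C i)) \<and> (\<forall>i. diameter (C i) < \<delta> k) \<and>
    ennreal \<kappa> * (\<Sum>i. diam_pow N (C i)) \<le> hausdorff_outer N A + ennreal (1 / real (Suc k))" for k
  proof -
    have pos: "0 < 1 / real (Suc k)" by simp
    obtain C :: "nat \<Rightarrow> 'a set" where "A \<subseteq> (\<Union>i. C i)" "\<And>i. bounded (C i)" "\<And>i. diameter (C i) < \<delta> k"
      "ennreal (unit_ball_vol N / 2 powr N) * (\<Sum>i. diam_pow N (C i)) \<le> hausdorff_outer N A + ennreal (1 / real (Suc k))"
      using hausdorff_cover_exists[OF _ \<delta>(1) fin pos] N by auto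
    then show ?thesis unfolding \<kappa>_def by blast
  qed
  then have "\<forall>k. \<exists>C :: nat \<Rightarrow> 'a set. A \<subseteq> (\<Union>i. C i) \<and> (\<forall>i. bounded (C i)) \<and> (\<forall>i. diameter (C i) < \<delta> k) \<and>
    ennreal \<kappa> * (\<Sum>i. diam_pow N (C i)) \<le> hausdorff_outer N A + ennreal (1 / real (Suc k))" ..
  from choice[OF this] obtain C :: "nat \<Rightarrow> nat \<Rightarrow> 'a set" where
    "\<forall>k. A \<subseteq> (\<Union>i. C k i) \<and> (\<forall>i. bounded (C k i)) \<and> (\<forall>i. diameter (C k i) < \<delta> k) \<and>
    ennreal \<kappa> * (\<Sum>i. diam_pow N (C k i)) \<le> hausdorff_outer N A + ennreal (1 / real (Suc k))" by (elim exE)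
  then have C: "\<And>k. A \<subseteq> (\<Union>i. C k i)" "\<And>k i. bounded (C k i)"
    "\<And>k i. diameter (C k i) < \<delta> k"
    "\<And>k. ennreal \<kappa> * (\<Sum>i. diam_pow N (C k i)) \<le> hausdorff_outer N A + ennreal (1 / real (Suc k))"
    by (simp_all only: simp_thms)
  \<comment> \<open>The oscillation of \<open>u\<close> is controlled only on \<open>A\<close>. The
    choice \<open>\<delta> k \<le> e\<close> makes the local Lipschitz bound valid across a whole
    piece.\<close>
  define D where "D = (\<lambda>k i. C k i \<inter> A)"
  have Db: "bounded (D k i)" for k i using C(2) by (auto simp: D_def intro: bounded_subset)
  have Dd: "diameter (D k i) < \<delta> k" for k i
    using C(3)[of k i] diameter_subset[of "D k i" "C k i"] C(2) by (force simp: D_def)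
  \<comment> \<open>\<open>Inf\<close> and \<open>Sup\<close> of an empty set of reals carry no
    information, so empty pieces are given the empty interval.\<close>
  define I where "I = (\<lambda>k i. if D k i = {} then {} else {Inf (u ` D k i)..Sup (u ` D k i)})"
  have osc: "u x - u y \<le> L * diameter (D k i)" if "x \<in> D k i" "y \<in> D k i" for x y k i
  proof -
    have d: "dist x y \<le> diameter (D k i)" using that by (intro diameter_bounded_bound Db)
    also have "\<dots> < e" using Dd[of k i] \<delta>(2)[of k] by simp
    finally have "\<bar>u x - u y\<bar> \<le> L * dist x y" using that by (intro lip) (auto simp: D_def)
    also have "\<dots> \<le> L * diameter (D k i)" using d L by (rule mult_left_mono)
    finally show ?thesis by simp
  qed
  have uI: "u x \<in> I k i" if "x \<in> D k i" for x k i
  proof -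
    have "bdd_above (u ` D k i)" "bdd_below (u ` D k i)"
      using osc[OF _ that] osc[OF that]
      by (auto intro!: bdd_aboveI2[of _ _ "u x + L * diameter (D k i)"] bdd_belowI2[of _ "u x - L * diameter (D k i)"] simp: algebra_simps)
    then show ?thesis using that by (auto simp: I_def intro: cInf_lower cSup_upper)
  qed
  have Ilen: "emeasure lborel (I k i) \<le> ennreal (L * diameter (D k i))" for k i
  proof (cases "D k i = {}")
    case False
    have "Sup (u ` D k i) - L * diameter (D k i) \<le> Inf (u ` D k i)"
    proof (rule cInf_greatest)
      fix r assume "r \<in> u ` D k i"
      then obtain y where y: "y \<in> D k i" "r = u y" by auto
      have "Sup (u ` D k i) \<le> r + L * diameter (D k i)"
        by (rule cSup_least) (use False osc[OF _ y(1)] y(2) in \<open>auto simp: algebra_simps\<close>)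
      then show "Sup (u ` D k i) - L * diameter (D k i) \<le> r" by simp
    qed (use False in auto)
    moreover have "Inf (u ` D k i) \<le> Sup (u ` D k i)"
      using uI[of _ k i] False by (force simp: I_def)
    ultimately show ?thesis using False by (auto simp: I_def intro: ennreal_leI)
  qed (simp add: I_def)
  define h where "h = (\<lambda>k t. ennreal \<kappa>' * (\<Sum>i. diam_pow (N - 1) (D k i) * indicator (I k i) t))"
  have Imeas: "I k i \<in> sets borel" for k i by (auto simp: I_def)
  have hmeas: "h k \<in> borel_measurable borel" for k
    unfolding h_def using Imeas by measurable
  have h_ge: "hausdorff_pre (N - 1) (\<delta> k) (A \<inter> u -` {t}) \<le> h k t" for k t
    unfolding h_def hausdorff_pre_def \<kappa>'_def
  proof (rule mult_left_mono)
    define G where "G = (\<lambda>i. D k i \<inter> u -` {t})"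
    have "(INF C \<in> {C :: nat \<Rightarrow> 'a set. A \<inter> u -` {t} \<subseteq> (\<Union>i. C i) \<and> (\<forall>i. bounded (C i) \<and> diameter (C i) < \<delta> k)}.
        \<Sum>i. diam_pow (N - 1) (C i)) \<le> (\<Sum>i. diam_pow (N - 1) (G i))"
    proof (rule INF_lower, clarsimp, intro conjI allI)
      show "A \<inter> u -` {t} \<subseteq> (\<Union>i. G i)" using C(1)[of k] by (auto simp: G_def D_def)
      show "bounded (G i)" for i by (rule bounded_subset[OF Db[of k i]]) (auto simp: G_def)
      show "diameter (G i) < \<delta> k" for i
        using diameter_subset[of "G i" "D k i"] Db[of k i] Dd[of k i] by (auto simp: G_def)
    qed
    also have "\<dots> \<le> (\<Sum>i. diam_pow (N - 1) (D k i) * indicator (I k i) t)"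
    proof (rule suminf_le)
      fix i
      show "diam_pow (N - 1) (G i) \<le> diam_pow (N - 1) (D k i) * indicator (I k i) t"
      proof (cases "G i = {}")
        case False
        then have "t \<in> I k i" using uI[of _ k i] by (auto simp: G_def)
        moreover have "diam_pow (N - 1) (G i) \<le> diam_pow (N - 1) (D k i)"
          using N Db by (intro diam_pow_mono) (auto simp: G_def)
        ultimately show ?thesis by simp
      qed (simp add: diam_pow_def)
    qed auto
    finally show "(INF C \<in> {C :: nat \<Rightarrow> 'a set. A \<inter> u -` {t} \<subseteq> (\<Union>i. C i) \<and> (\<forall>i. bounded (C i) \<and> diameter (C i) < \<delta> k)}.
        \<Sum>i. diam_pow (N - 1) (C i)) \<le> (\<Sum>i. diam_pow (N - 1) (D k i) * indicator (I k i) t)" .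
  qed simp
  have h_int: "(\<integral>\<^sup>+ t. h k t \<partial>lborel) \<le> ennreal K * (ennreal L * (hausdorff_outer N A + ennreal (1 / real (Suc k))))" for k
  proof -
    have "(\<integral>\<^sup>+ t. h k t \<partial>lborel) = ennreal \<kappa>' * (\<Sum>i. diam_pow (N - 1) (D k i) * emeasure lborel (I k i))"
      unfolding h_def using Imeas
      by (simp add: nn_integral_cmult nn_integral_suminf nn_integral_cmult_indicator)
    also have "\<dots> \<le> ennreal \<kappa>' * (\<Sum>i. ennreal L * diam_pow N (C k i))"
    proof (intro mult_left_mono suminf_le)
      fix i
      show "diam_pow (N - 1) (D k i) * emeasure lborel (I k i) \<le> ennreal L * diam_pow N (C k i)"
      proof (cases "D k i = {}")
        case False
        have "diam_pow (N - 1) (D k i) * emeasure lborel (I k i) \<le> diam_pow (N - 1) (D k i) * ennreal (L * diameter (D k i))"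
          by (intro mult_left_mono Ilen) simp
        also have "\<dots> = ennreal L * diam_pow N (D k i)"
          by (rule diam_pow_minus_1[OF N L Db False])
        also have "\<dots> \<le> ennreal L * diam_pow N (C k i)"
          using N C(2) by (intro mult_left_mono diam_pow_mono) (auto simp: D_def)
        finally show ?thesis .
      qed (simp add: diam_pow_def)
    qed auto
    also have "\<dots> = ennreal K * (ennreal L * (ennreal \<kappa> * (\<Sum>i. diam_pow N (C k i))))"
      using \<kappa> by (simp add: ennreal_mult ac_simps)
    also have "\<dots> \<le> ennreal K * (ennreal L * (hausdorff_outer N A + ennreal (1 / real (Suc k))))"
      by (intro mult_left_mono C(4)) auto
    finally show ?thesis .
  qed
  show ?thesis
  proof (rule that)
    show "(\<lambda>t. liminf (\<lambda>k. h k t)) \<in> borel_measurable borel" using hmeas by measurable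
    show "hausdorff_outer (N - 1) (A \<inter> u -` {t}) \<le> liminf (\<lambda>k. h k t)" for t
      by (rule hausdorff_outer_le_liminf[OF h_ge \<delta>0])
    have "(\<integral>\<^sup>+ t. liminf (\<lambda>k. h k t) \<partial>lborel) \<le> liminf (\<lambda>k. \<integral>\<^sup>+ t. h k t \<partial>lborel)"
      by (rule nn_integral_liminf) (use hmeas in auto)
    also have "\<dots> \<le> liminf (\<lambda>k. ennreal K * (ennreal L * (hausdorff_outer N A + ennreal (1 / real (Suc k)))))"
      by (intro Liminf_mono always_eventually allI h_int)
    also have "\<dots> = ennreal K * (ennreal L * hausdorff_outer N A)"
    proof (rule lim_imp_Liminf[OF sequentially_bot])
      have "(\<lambda>k. ennreal K * (ennreal L * (hausdorff_outer N A + ennreal (1 / real (Suc k))))) \<longlonglongrightarrow>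
        ennreal K * (ennreal L * (hausdorff_outer N A + ennreal 0))"
        by (intro ennreal_tendsto_cmult tendsto_add tendsto_const tendsto_ennrealI LIMSEQ_Suc[OF lim_1_over_n]) auto
      then show "(\<lambda>k. ennreal K * (ennreal L * (hausdorff_outer N A + ennreal (1 / real (Suc k))))) \<longlonglongrightarrow>
        ennreal K * (ennreal L * hausdorff_outer N A)" by simp
    qed
    finally show "(\<integral>\<^sup>+ t. liminf (\<lambda>k. h k t) \<partial>lborel) \<le>
      ennreal (2 * unit_ball_vol (N - 1) / unit_ball_vol N) * (ennreal L * hausdorff_outer N A)"
      by (simp add: K_def)
  qed
qed

text \<open>Slicing along the values of \<open>w\<close> in steps of \<open>\<eta>\<close> replaces
  the variable Lipschitz constant by constant ones, at the price of \<open>w + \<eta>\<close> in the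
  integral. The passage from indicators to Borel functions \<open>g\<close> works with majorants
  throughout, as these can be scaled, added and passed to a lower limit.\<close>

lemma coarea_weighted:
  fixes u w :: "'a::metric_space \<Rightarrow> real" and g :: "'a \<Rightarrow> ennreal"
  assumes N: "N \<ge> 1" and fin: "emeasure (hausdorff N) (UNIV :: 'a set) < top"
    and w: "w \<in> borel_measurable borel" "\<And>x. 0 \<le> w x" and e: "e > 0" and \<eta>: "\<eta> > 0"
    and u: "u \<in> borel_measurable borel"
      "\<And>x y. dist x y < e \<Longrightarrow> \<bar>u x - u y\<bar> \<le> max (w x) (w y) * dist x y"
    and g: "g \<in> borel_measurable borel"
  shows "\<exists>h\<in>borel_measurable borel.
    (\<forall>t. (\<integral>\<^sup>+ x. g x * indicator (u -` {t}) x \<partial>hausdorff (N - 1)) \<le> h t) \<and>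
    (\<integral>\<^sup>+ t. h t \<partial>lborel) \<le> ennreal (2 * unit_ball_vol (N - 1) / unit_ball_vol N) *
      (\<integral>\<^sup>+ x. ennreal (w x + \<eta>) * g x \<partial>hausdorff N)"
  using g
proof (induction rule: borel_measurable_induct)
  case (cong f g)
  then have "f = g" by auto
  with cong show ?case by simp
next
  case (set A)
  \<comment> \<open>On \<open>A' j\<close> the constant \<open>(j + 1) \<eta>\<close> is a local Lipschitz constant of \<open>u\<close> and is at most \<open>w + \<eta>\<close>.\<close>
  define A' where "A' = (\<lambda>j. A \<inter> {x. real j * \<eta> \<le> w x \<and> w x < (real j + 1) * \<eta>})"
  have A': "A' j \<in> sets borel" for j
    unfolding A'_def using set w(1) by measurable
  have uv: "u -` {t} \<in> sets borel" for t
    using measurable_sets[OF u(1), of "{t}"] by simp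
  have disj: "disjoint_family A'"
    unfolding disjoint_family_on_def
  proof (intro ballI impI)
    fix i j :: nat assume "i \<noteq> j"
    have False if "x \<in> A' i \<inter> A' j" for x
    proof -
      have "real i * \<eta> < (real j + 1) * \<eta>" "real j * \<eta> < (real i + 1) * \<eta>" using that by (auto simp: A'_def)
      then have "real i < real j + 1" "real j < real i + 1" using \<eta> by simp_all
      then show False using \<open>i \<noteq> j\<close> by linarith
    qed
    then show "A' i \<inter> A' j = {}" by auto
  qed
  have un: "(\<Union>j. A' j) = A"
  proof
    show "A \<subseteq> (\<Union>j. A' j)"
    proof
      fix x assume x: "x \<in> A"
      define j where "j = nat \<lfloor>w x / \<eta>\<rfloor>"
      have "0 \<le> w x / \<eta>" using w(2) \<eta> by simp
      then have "real j \<le> w x / \<eta>" "w x / \<eta> < real j + 1" unfolding j_def by linarith+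
      then have "x \<in> A' j" using x \<eta> by (simp add: A'_def field_simps)
      then show "x \<in> (\<Union>j. A' j)" by blast
    qed
  qed (auto simp: A'_def)
  let ?K = "2 * unit_ball_vol (N - 1) / unit_ball_vol N"
  have "\<exists>h. h \<in> borel_measurable borel \<and> (\<forall>t. hausdorff_outer (N - 1) (A' j \<inter> u -` {t}) \<le> h t) \<and>
    (\<integral>\<^sup>+ t. h t \<partial>lborel) \<le> ennreal ?K * (ennreal ((real j + 1) * \<eta>) * hausdorff_outer N (A' j))" for j
  proof -
    have "hausdorff_outer N (A' j) \<le> hausdorff_outer N (UNIV :: 'a set)" by (rule hausdorff_outer_mono) simp
    then have fin': "hausdorff_outer N (A' j) < top" using fin by (simp add: emeasure_hausdorff)
    have lip: "\<bar>u x - u y\<bar> \<le> (real j + 1) * \<eta> * dist x y"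
      if "x \<in> A' j" "y \<in> A' j" "dist x y < e" for x y
    proof -
      have "\<bar>u x - u y\<bar> \<le> max (w x) (w y) * dist x y" by (rule u(2)[OF that(3)])
      also have "\<dots> \<le> (real j + 1) * \<eta> * dist x y"
        using that by (intro mult_right_mono) (auto simp: A'_def)
      finally show ?thesis .
    qed
    have nonneg: "0 \<le> (real j + 1) * \<eta>" using \<eta> by simp
    show ?thesis
    proof (rule coarea_lipschitz[OF N nonneg e fin' lip])
      fix h assume "h \<in> borel_measurable borel"
        "\<And>t. hausdorff_outer (N - 1) (A' j \<inter> u -` {t}) \<le> h t"
        "(\<integral>\<^sup>+ t. h t \<partial>lborel) \<le> ennreal ?K * (ennreal ((real j + 1) * \<eta>) * hausdorff_outer N (A' j))"
      then show ?thesis by (intro exI[of _ h] conjI allI)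
    qed
  qed
  then have "\<forall>j. \<exists>h. h \<in> borel_measurable borel \<and> (\<forall>t. hausdorff_outer (N - 1) (A' j \<inter> u -` {t}) \<le> h t) \<and>
    (\<integral>\<^sup>+ t. h t \<partial>lborel) \<le> ennreal ?K * (ennreal ((real j + 1) * \<eta>) * hausdorff_outer N (A' j))" ..
  from choice[OF this] obtain h where "\<forall>j. h j \<in> borel_measurable borel \<and>
    (\<forall>t. hausdorff_outer (N - 1) (A' j \<inter> u -` {t}) \<le> h j t) \<and>
    (\<integral>\<^sup>+ t. h j t \<partial>lborel) \<le> ennreal ?K * (ennreal ((real j + 1) * \<eta>) * hausdorff_outer N (A' j))" by (elim exE)
  then have h: "\<And>j. h j \<in> borel_measurable borel"
    "\<And>j t. hausdorff_outer (N - 1) (A' j \<inter> u -` {t}) \<le> h j t"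
    "\<And>j. (\<integral>\<^sup>+ t. h j t \<partial>lborel) \<le> ennreal ?K * (ennreal ((real j + 1) * \<eta>) * hausdorff_outer N (A' j))"
    by (simp_all only: simp_thms)
  show ?case
  proof (intro bexI[of _ "\<lambda>t. \<Sum>j. h j t"] conjI allI)
    show "(\<lambda>t. \<Sum>j. h j t) \<in> borel_measurable borel" using h(1) by measurable
    fix t
    have "(\<integral>\<^sup>+ x. indicator A x * indicator (u -` {t}) x \<partial>hausdorff (N - 1)) = hausdorff_outer (N - 1) (A \<inter> u -` {t})"
      using set uv[of t] by (simp add: indicator_inter_arith[symmetric] emeasure_hausdorff)
    also have "A \<inter> u -` {t} = (\<Union>j. A' j \<inter> u -` {t})" using un by auto
    also have "hausdorff_outer (N - 1) \<dots> \<le> (\<Sum>j. hausdorff_outer (N - 1) (A' j \<inter> u -` {t}))"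
      by (rule hausdorff_outer_UN_le)
    also have "\<dots> \<le> (\<Sum>j. h j t)" by (intro suminf_le h) auto
    finally show "(\<integral>\<^sup>+ x. indicator A x * indicator (u -` {t}) x \<partial>hausdorff (N - 1)) \<le> (\<Sum>j. h j t)" .
  next
    have "(\<integral>\<^sup>+ t. (\<Sum>j. h j t) \<partial>lborel) = (\<Sum>j. \<integral>\<^sup>+ t. h j t \<partial>lborel)"
      using h(1) by (intro nn_integral_suminf) auto
    also have "\<dots> \<le> (\<Sum>j. ennreal ?K * (\<integral>\<^sup>+ x. ennreal (w x + \<eta>) * indicator (A' j) x \<partial>hausdorff N))"
    proof (rule suminf_le)
      fix j
      have "ennreal ((real j + 1) * \<eta>) * hausdorff_outer N (A' j) = (\<integral>\<^sup>+ x. ennreal ((real j + 1) * \<eta>) * indicator (A' j) x \<partial>hausdorff N)"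
        using A'[of j] by (simp add: nn_integral_cmult_indicator emeasure_hausdorff)
      also have "\<dots> \<le> (\<integral>\<^sup>+ x. ennreal (w x + \<eta>) * indicator (A' j) x \<partial>hausdorff N)"
      proof (rule nn_integral_mono)
        fix x
        have "(real j + 1) * \<eta> \<le> w x + \<eta>" if "x \<in> A' j"
          using that by (simp add: A'_def algebra_simps)
        then show "ennreal ((real j + 1) * \<eta>) * indicator (A' j) x \<le> ennreal (w x + \<eta>) * indicator (A' j) x"
          by (auto intro!: ennreal_leI simp del: ennreal_plus split: split_indicator)
      qed
      finally show "(\<integral>\<^sup>+ t. h j t \<partial>lborel) \<le> ennreal ?K * (\<integral>\<^sup>+ x. ennreal (w x + \<eta>) * indicator (A' j) x \<partial>hausdorff N)"
        using h(3)[of j] by (meson mult_left_mono order_trans zero_le)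
    qed auto
    also have "\<dots> = ennreal ?K * (\<integral>\<^sup>+ x. (\<Sum>j. ennreal (w x + \<eta>) * indicator (A' j) x) \<partial>hausdorff N)"
      unfolding ennreal_suminf_cmult[of "ennreal ?K"] using A' w(1) by (subst nn_integral_suminf) auto
    also have "\<dots> = ennreal ?K * (\<integral>\<^sup>+ x. ennreal (w x + \<eta>) * indicator A x \<partial>hausdorff N)"
      by (simp only: ennreal_suminf_cmult suminf_indicator[OF disj] un)
    finally show "(\<integral>\<^sup>+ t. (\<Sum>j. h j t) \<partial>lborel) \<le> ennreal ?K * (\<integral>\<^sup>+ x. ennreal (w x + \<eta>) * indicator A x \<partial>hausdorff N)" .
  qed
next
  case (mult f c)
  then obtain h where h: "h \<in> borel_measurable borel"
    "\<And>t. (\<integral>\<^sup>+ x. f x * indicator (u -` {t}) x \<partial>hausdorff (N - 1)) \<le> h t"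
    "(\<integral>\<^sup>+ t. h t \<partial>lborel) \<le> ennreal (2 * unit_ball_vol (N - 1) / unit_ball_vol N) *
      (\<integral>\<^sup>+ x. ennreal (w x + \<eta>) * f x \<partial>hausdorff N)" by blast
  have [measurable]: "u -` {t} \<in> sets borel" for t
    using measurable_sets[OF u(1), of "{t}"] by simp
  note [measurable] = h(1) w(1) mult(2)
  show ?case
  proof (intro bexI[of _ "\<lambda>t. c * h t"] conjI allI)
    show "(\<integral>\<^sup>+ x. c * f x * indicator (u -` {t}) x \<partial>hausdorff (N - 1)) \<le> c * h t" for t
      using h(2)[of t] by (simp add: mult.assoc nn_integral_cmult mult_left_mono)
    have "(\<integral>\<^sup>+ t. c * h t \<partial>lborel) \<le> c * (ennreal (2 * unit_ball_vol (N - 1) / unit_ball_vol N) *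
      (\<integral>\<^sup>+ x. ennreal (w x + \<eta>) * f x \<partial>hausdorff N))"
      using h(3) by (simp add: nn_integral_cmult mult_left_mono)
    also have "\<dots> = ennreal (2 * unit_ball_vol (N - 1) / unit_ball_vol N) *
      (\<integral>\<^sup>+ x. c * (ennreal (w x + \<eta>) * f x) \<partial>hausdorff N)"
      by (simp add: nn_integral_cmult mult.left_commute)
    finally show "(\<integral>\<^sup>+ t. c * h t \<partial>lborel) \<le> ennreal (2 * unit_ball_vol (N - 1) / unit_ball_vol N) *
      (\<integral>\<^sup>+ x. ennreal (w x + \<eta>) * (c * f x) \<partial>hausdorff N)"
      by (simp add: mult.left_commute)
  qed measurable
next
  case (add f1 f2)
  obtain h1 where h1: "h1 \<in> borel_measurable borel"
    "\<And>t. (\<integral>\<^sup>+ x. f1 x * indicator (u -` {t}) x \<partial>hausdorff (N - 1)) \<le> h1 t"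
    "(\<integral>\<^sup>+ t. h1 t \<partial>lborel) \<le> ennreal (2 * unit_ball_vol (N - 1) / unit_ball_vol N) *
      (\<integral>\<^sup>+ x. ennreal (w x + \<eta>) * f1 x \<partial>hausdorff N)" using add by blast
  obtain h2 where h2: "h2 \<in> borel_measurable borel"
    "\<And>t. (\<integral>\<^sup>+ x. f2 x * indicator (u -` {t}) x \<partial>hausdorff (N - 1)) \<le> h2 t"
    "(\<integral>\<^sup>+ t. h2 t \<partial>lborel) \<le> ennreal (2 * unit_ball_vol (N - 1) / unit_ball_vol N) *
      (\<integral>\<^sup>+ x. ennreal (w x + \<eta>) * f2 x \<partial>hausdorff N)" using add by blast
  have [measurable]: "u -` {t} \<in> sets borel" for t
    using measurable_sets[OF u(1), of "{t}"] by simp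
  note [measurable] = h1(1) h2(1) w(1) \<open>f1 \<in> borel_measurable borel\<close> \<open>f2 \<in> borel_measurable borel\<close>
  show ?case
  proof (intro bexI[of _ "\<lambda>t. h2 t + h1 t"] conjI allI)
    show "(\<integral>\<^sup>+ x. (f2 x + f1 x) * indicator (u -` {t}) x \<partial>hausdorff (N - 1)) \<le> h2 t + h1 t" for t
    proof -
      have "(\<integral>\<^sup>+ x. (f2 x + f1 x) * indicator (u -` {t}) x \<partial>hausdorff (N - 1)) =
        (\<integral>\<^sup>+ x. f2 x * indicator (u -` {t}) x \<partial>hausdorff (N - 1)) +
        (\<integral>\<^sup>+ x. f1 x * indicator (u -` {t}) x \<partial>hausdorff (N - 1))"
        unfolding distrib_right by (rule nn_integral_add) measurable
      also have "\<dots> \<le> h2 t + h1 t" by (intro add_mono h1 h2)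
      finally show ?thesis .
    qed
    have "(\<integral>\<^sup>+ t. h2 t + h1 t \<partial>lborel) = (\<integral>\<^sup>+ t. h2 t \<partial>lborel) + (\<integral>\<^sup>+ t. h1 t \<partial>lborel)"
      by (intro nn_integral_add) auto
    also have "\<dots> \<le> ennreal (2 * unit_ball_vol (N - 1) / unit_ball_vol N) *
      ((\<integral>\<^sup>+ x. ennreal (w x + \<eta>) * f2 x \<partial>hausdorff N) + (\<integral>\<^sup>+ x. ennreal (w x + \<eta>) * f1 x \<partial>hausdorff N))"
      unfolding distrib_left by (intro add_mono h1 h2)
    also have "\<dots> = ennreal (2 * unit_ball_vol (N - 1) / unit_ball_vol N) *
      (\<integral>\<^sup>+ x. ennreal (w x + \<eta>) * (f2 x + f1 x) \<partial>hausdorff N)"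
      by (simp add: distrib_left nn_integral_add)
    finally show "(\<integral>\<^sup>+ t. h2 t + h1 t \<partial>lborel) \<le> ennreal (2 * unit_ball_vol (N - 1) / unit_ball_vol N) *
      (\<integral>\<^sup>+ x. ennreal (w x + \<eta>) * (f2 x + f1 x) \<partial>hausdorff N)" .
  qed measurable
next
  case (seq U)
  have "\<forall>i. \<exists>h. h \<in> borel_measurable borel \<and>
    (\<forall>t. (\<integral>\<^sup>+ x. U i x * indicator (u -` {t}) x \<partial>hausdorff (N - 1)) \<le> h t) \<and>
    (\<integral>\<^sup>+ t. h t \<partial>lborel) \<le> ennreal (2 * unit_ball_vol (N - 1) / unit_ball_vol N) *
      (\<integral>\<^sup>+ x. ennreal (w x + \<eta>) * U i x \<partial>hausdorff N)" using seq.IH by blast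
  from choice[OF this] obtain h where "\<forall>i. h i \<in> borel_measurable borel \<and>
    (\<forall>t. (\<integral>\<^sup>+ x. U i x * indicator (u -` {t}) x \<partial>hausdorff (N - 1)) \<le> h i t) \<and>
    (\<integral>\<^sup>+ t. h i t \<partial>lborel) \<le> ennreal (2 * unit_ball_vol (N - 1) / unit_ball_vol N) *
      (\<integral>\<^sup>+ x. ennreal (w x + \<eta>) * U i x \<partial>hausdorff N)" by (elim exE)
  then have h: "\<And>i. h i \<in> borel_measurable borel"
    "\<And>i t. (\<integral>\<^sup>+ x. U i x * indicator (u -` {t}) x \<partial>hausdorff (N - 1)) \<le> h i t"
    "\<And>i. (\<integral>\<^sup>+ t. h i t \<partial>lborel) \<le> ennreal (2 * unit_ball_vol (N - 1) / unit_ball_vol N) *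
      (\<integral>\<^sup>+ x. ennreal (w x + \<eta>) * U i x \<partial>hausdorff N)" by (simp_all only: simp_thms)
  have [measurable]: "u -` {t} \<in> sets borel" for t
    using measurable_sets[OF u(1), of "{t}"] by simp
  note [measurable] = h(1) w(1) \<open>\<And>i. U i \<in> borel_measurable borel\<close>
  have Umono: "U i x \<le> U j x" if "i \<le> j" for i j x
    using \<open>incseq U\<close> that by (auto simp: incseq_def le_fun_def)
  show ?case
  \<comment> \<open>The majorants \<open>h i\<close> are chosen independently and need not increase
    with \<open>i\<close>. Since the \<open>U i\<close> do, each \<open>h j t\<close> with
    \<open>j \<ge> i\<close> also bounds the integral of \<open>U i\<close>, so the lower limit is a
    majorant, and Fatou's lemma bounds its integral.\<close>
  proof (intro bexI[of _ "\<lambda>t. liminf (\<lambda>i. h i t)"] conjI allI)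
    fix t
    have "(\<integral>\<^sup>+ x. (SUP i. U i) x * indicator (u -` {t}) x \<partial>hausdorff (N - 1)) =
      (\<integral>\<^sup>+ x. (SUP i. U i x * indicator (u -` {t}) x) \<partial>hausdorff (N - 1))"
      by (simp add: SUP_mult_right_ennreal image_comp)
    also have "\<dots> = (SUP i. \<integral>\<^sup>+ x. U i x * indicator (u -` {t}) x \<partial>hausdorff (N - 1))"
      by (intro nn_integral_monotone_convergence_SUP)
         (auto simp: incseq_def le_fun_def intro!: mult_right_mono Umono)
    also have "\<dots> \<le> liminf (\<lambda>i. h i t)"
    proof (rule SUP_least)
      fix i
      have "(\<integral>\<^sup>+ x. U i x * indicator (u -` {t}) x \<partial>hausdorff (N - 1)) \<le> h j t" if "i \<le> j" for j
        using h(2)[of j t] that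
        by (elim order_trans[rotated]) (auto intro!: nn_integral_mono mult_right_mono Umono)
      then show "(\<integral>\<^sup>+ x. U i x * indicator (u -` {t}) x \<partial>hausdorff (N - 1)) \<le> liminf (\<lambda>i. h i t)"
        by (intro Liminf_bounded) (auto simp: eventually_sequentially)
    qed
    finally show "(\<integral>\<^sup>+ x. (SUP i. U i) x * indicator (u -` {t}) x \<partial>hausdorff (N - 1)) \<le> liminf (\<lambda>i. h i t)" .
  next
    let ?B = "ennreal (2 * unit_ball_vol (N - 1) / unit_ball_vol N) *
      (\<integral>\<^sup>+ x. ennreal (w x + \<eta>) * (SUP i. U i) x \<partial>hausdorff N)"
    have "(\<integral>\<^sup>+ t. liminf (\<lambda>i. h i t) \<partial>lborel) \<le> liminf (\<lambda>i. \<integral>\<^sup>+ t. h i t \<partial>lborel)"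
      by (rule nn_integral_liminf) auto
    also have "\<dots> \<le> liminf (\<lambda>i::nat. ?B)"
    proof (intro Liminf_mono always_eventually allI)
      fix i
      have "U i x \<le> (SUP i. U i) x" for x using le_funD[OF SUP_upper[of i UNIV U]] by simp
      then have "ennreal (2 * unit_ball_vol (N - 1) / unit_ball_vol N) *
        (\<integral>\<^sup>+ x. ennreal (w x + \<eta>) * U i x \<partial>hausdorff N) \<le> ?B"
        by (intro mult_left_mono nn_integral_mono) auto
      then show "(\<integral>\<^sup>+ t. h i t \<partial>lborel) \<le> ?B" using h(3)[of i] by (rule order_trans[rotated])
    qed
    also have "\<dots> = ?B" by (rule Liminf_const) simp
    finally show "(\<integral>\<^sup>+ t. liminf (\<lambda>i. h i t) \<partial>lborel) \<le> ?B" .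
  qed measurable
qed

subsection \<open>Duality of the moduli\<close>

lemma borel_measurable_epowr [measurable]:
  assumes "f \<in> borel_measurable M"
  shows "(\<lambda>x. f x epowr r) \<in> borel_measurable M"
  unfolding ennreal_powr_def using assms by measurable

text \<open>The continuous approximation is applied to the p-th power of the admissible function;
  this takes the root back inside the supremum.\<close>

lemma le_SUP_powr_inverse:
  assumes "0 < p" and F: "\<And>k. 0 < F k" and le: "x epowr p \<le> (SUP k. ennreal (F k))"
  shows "x \<le> (SUP k. ennreal (F k powr (1 / p)))"
proof (rule dense_le)
  fix y assume y: "y < x"
  then obtain r where r: "0 \<le> r" "y = ennreal r" by (cases y) auto
  have "ennreal (r powr p) < x epowr p"
  proof (cases "x = top")
    case False
    then obtain s where s: "0 \<le> s" "x = ennreal s" by (cases x) auto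
    then show ?thesis
      using y r \<open>0 < p\<close> by (simp add: ennreal_powr_def ennreal_less_iff powr_less_mono2)
  qed (simp add: ennreal_powr_def)
  then have "ennreal (r powr p) < (SUP k. ennreal (F k))" using le by (rule less_le_trans)
  then obtain k where "ennreal (r powr p) < ennreal (F k)" by (auto simp: less_SUP_iff)
  then have "(r powr p) powr (1 / p) \<le> F k powr (1 / p)"
    using \<open>0 < p\<close> by (intro powr_mono2) (auto simp: ennreal_less_iff)
  then have "r \<le> F k powr (1 / p)" using r \<open>0 < p\<close> by (simp add: powr_powr)
  then have "y \<le> ennreal (F k powr (1 / p))" using r by (simp add: ennreal_leI)
  also have "\<dots> \<le> (SUP k. ennreal (F k powr (1 / p)))" by (rule SUP_upper) simp
  finally show "y \<le> (SUP k. ennreal (F k powr (1 / p)))" .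
qed

text \<open>Young's inequality for the two functions divided by \<open>a powr (1 / p)\<close> and
  \<open>b powr (1 / q)\<close>. Normalizing by positive bounds instead of the integrals themselves
  avoids separate cases of vanishing integrals.\<close>

lemma Holder_nn_integral:
  assumes pq: "1 < p" "1 < q" "1 / p + 1 / q = 1" and ab: "0 < a" "0 < b"
    and f: "f \<in> borel_measurable M" and g: "g \<in> borel_measurable M"
    and fa: "(\<integral>\<^sup>+ x. f x epowr p \<partial>M) \<le> ennreal a" and gb: "(\<integral>\<^sup>+ x. g x epowr q \<partial>M) \<le> ennreal b"
  shows "(\<integral>\<^sup>+ x. f x * g x \<partial>M) \<le> ennreal (a powr (1 / p) * b powr (1 / q))"
proof -
  define st where "st = a powr (1 / p) * b powr (1 / q)"
  have st: "0 < st" using ab by (simp add: st_def)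
  have young: "x * y \<le> ennreal (st / (a * p)) * (x epowr p) + ennreal (st / (b * q)) * (y epowr q)" for x y
  proof (cases "x = top \<or> y = top")
    case True
    \<comment> \<open>Nonzero coefficients make the right-hand side infinite as soon as one factor
      is, whatever the product is.\<close>
    have "ennreal (st / (a * p)) \<noteq> 0" "ennreal (st / (b * q)) \<noteq> 0"
      using st ab pq by (simp_all add: ennreal_eq_0_iff not_le)
    then show ?thesis using True by (auto simp: ennreal_powr_def ennreal_mult_top)
  next
    case False
    then obtain r s where rs: "0 \<le> r" "x = ennreal r" "0 \<le> s" "y = ennreal s"
      by (cases x; cases y) auto
    have "(r / a powr (1 / p)) * (s / b powr (1 / q)) \<le> (r / a powr (1 / p)) powr p / p + (s / b powr (1 / q)) powr q / q"
      using rs by (intro Youngs_inequality pq) auto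
    also have "\<dots> = r powr p / (a * p) + s powr q / (b * q)"
      using rs ab pq by (simp add: powr_divide powr_powr)
    finally have "st * ((r / a powr (1 / p)) * (s / b powr (1 / q))) \<le> st * (r powr p / (a * p) + s powr q / (b * q))"
      using st by (intro mult_left_mono) auto
    moreover have "st * ((r / a powr (1 / p)) * (s / b powr (1 / q))) = r * s"
      using ab by (simp add: st_def)
    ultimately have "r * s \<le> st / (a * p) * r powr p + st / (b * q) * s powr q"
      by (simp add: distrib_left)
    then have "ennreal (r * s) \<le> ennreal (st / (a * p) * r powr p + st / (b * q) * s powr q)"
      by (rule ennreal_leI)
    also have "\<dots> = ennreal (st / (a * p)) * ennreal (r powr p) + ennreal (st / (b * q)) * ennreal (s powr q)"
      using st ab pq by (subst ennreal_plus) (auto simp: ennreal_mult[symmetric] simp del: ennreal_plus)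
    finally show ?thesis using rs by (simp add: ennreal_powr_def ennreal_mult)
  qed
  note [measurable] = f g
  have "(\<integral>\<^sup>+ x. f x * g x \<partial>M) \<le> (\<integral>\<^sup>+ x. ennreal (st / (a * p)) * (f x epowr p) + ennreal (st / (b * q)) * (g x epowr q) \<partial>M)"
    by (intro nn_integral_mono young)
  also have "\<dots> = ennreal (st / (a * p)) * (\<integral>\<^sup>+ x. f x epowr p \<partial>M) + ennreal (st / (b * q)) * (\<integral>\<^sup>+ x. g x epowr q \<partial>M)"
    by (simp add: nn_integral_add nn_integral_cmult)
  also have "\<dots> \<le> ennreal (st / (a * p)) * ennreal a + ennreal (st / (b * q)) * ennreal b"
    by (intro add_mono mult_left_mono fa gb) auto
  also have "\<dots> = ennreal (st / (a * p) * a + st / (b * q) * b)"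
    using st ab pq by (subst ennreal_plus) (auto simp: ennreal_mult[symmetric] simp del: ennreal_plus)
  also have "st / (a * p) * a + st / (b * q) * b = st * (1 / p + 1 / q)"
    using ab pq(1,2) by (simp add: distrib_left)
  finally show ?thesis by (simp add: pq(3) st_def)
qed

text \<open>The function approximated by continuous ones is \<open>\<rho> epowr p\<close>, so that
  the error is additive in the integral that enters Hoelder's inequality; taking p-th roots
  afterwards keeps continuity, monotonicity and the positive lower bound. The index of the weight is
  found by contradiction, so no rate is obtained.\<close>

lemma admissible_potential:
  fixes E F :: "'a::metric_space set" and \<rho> :: "'a \<Rightarrow> ennreal"
  assumes X: "compact (UNIV :: 'a set)" and fin: "emeasure (hausdorff N) (UNIV :: 'a set) < top"
    and EF: "closed E" "closed F" and "1 < p" and M: "0 \<le> M" "M < 1" and "0 < \<epsilon>"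
    and \<rho>: "\<rho> \<in> borel_measurable borel"
    and adm: "\<And>c. c \<in> connecting_curves E F \<Longrightarrow> rectifiable c \<Longrightarrow> 1 \<le> line_integral c \<rho>"
  obtains w :: "'a \<Rightarrow> real" and e :: real and u :: "'a \<Rightarrow> real" where "continuous_on UNIV w" "\<And>x. 0 \<le> w x"
    "(\<integral>\<^sup>+ x. ennreal (w x) epowr p \<partial>hausdorff N) \<le> (\<integral>\<^sup>+ x. \<rho> x epowr p \<partial>hausdorff N) + ennreal \<epsilon>"
    "0 < e" "\<And>x y. dist x y < e \<Longrightarrow> \<bar>u x - u y\<bar> \<le> max (w x) (w y) * dist x y"
    "\<And>x. x \<in> E \<Longrightarrow> u x = 0" "\<And>x. x \<in> F \<Longrightarrow> M \<le> u x"
proof -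
  have fm: "finite_measure (hausdorff N :: 'a measure)"
    using fin by (intro finite_measureI) auto
  obtain G :: "nat \<Rightarrow> 'a \<Rightarrow> real" and c where G: "0 < c" "\<And>k. continuous_on UNIV (G k)" "\<And>k x. c \<le> G k x"
    "\<And>k l x. k \<le> l \<Longrightarrow> G k x \<le> G l x" "\<And>x. \<rho> x epowr p \<le> (SUP k. ennreal (G k x))"
    "\<And>k. (\<integral>\<^sup>+ x. ennreal (G k x) \<partial>hausdorff N) \<le> (\<integral>\<^sup>+ x. \<rho> x epowr p \<partial>hausdorff N) + ennreal \<epsilon>"
  proof (rule continuous_approx_above[OF sets_hausdorff fm borel_measurable_epowr[OF \<rho>, of p] \<open>0 < \<epsilon>\<close>], goal_cases)
    case (1 c G)
    show ?case by (rule 1(1)[OF 1(2-)])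
  qed
  define w where "w = (\<lambda>k x. G k x powr (1 / p))"
  define c' where "c' = c powr (1 / p)"
  have Gpos: "0 < G k x" for k x using G(1) G(3)[of k x] by linarith
  have wcont: "continuous_on UNIV (w k)" for k
    unfolding w_def using Gpos by (intro continuous_on_powr G continuous_on_const) (metis less_irrefl)
  have c': "0 < c'" "\<And>k x. c' \<le> w k x"
    using G(1,3) \<open>1 < p\<close> by (auto simp: c'_def w_def intro!: powr_mono2)
  have w0: "0 \<le> w k x" for k x by (simp add: w_def)
  have wmono: "w k x \<le> w l x" if "k \<le> l" for k l x
    unfolding w_def using \<open>1 < p\<close> Gpos[of k x] G(4)[OF that, of x] by (intro powr_mono2) auto
  have wsup: "\<rho> x \<le> (SUP k. ennreal (w k x))" for x
    unfolding w_def using \<open>1 < p\<close> Gpos G(5) by (intro le_SUP_powr_inverse) auto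
  have wint: "(\<integral>\<^sup>+ x. ennreal (w k x) epowr p \<partial>hausdorff N) \<le> (\<integral>\<^sup>+ x. \<rho> x epowr p \<partial>hausdorff N) + ennreal \<epsilon>" for k
  proof -
    have "ennreal (w k x) epowr p = ennreal (G k x)" for x
      using \<open>1 < p\<close> Gpos[of k x] by (simp add: ennreal_powr_def w_def powr_powr)
    then show ?thesis using G(6)[of k] by simp
  qed
  \<comment> \<open>The scale is tied to the maximum of \<open>w k\<close> on the compact space, so
    that a single step of a chain costs at most \<open>1 / (real k + 1)\<close>.\<close>
  have "\<exists>e>0. \<forall>x. e * w k x \<le> 1 / (real k + 1)" for k
  proof -
    have "bounded (range (w k))"
      using compact_continuous_image[OF wcont X] by (rule compact_imp_bounded)
    then obtain B where B: "B > 0" "\<And>x. \<bar>w k x\<bar> \<le> B" by (auto simp: bounded_pos)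
    have "1 / ((real k + 1) * B) * w k x \<le> 1 / (real k + 1)" for x
    proof -
      have "1 / ((real k + 1) * B) * w k x \<le> 1 / ((real k + 1) * B) * B"
        using B(1) B(2)[of x] by (intro mult_left_mono) auto
      then show ?thesis using B(1) by simp
    qed
    then show ?thesis using B(1) by (intro exI[of _ "1 / ((real k + 1) * B)"]) auto
  qed
  then obtain e where e: "\<And>k. 0 < e k" "\<And>k x. e k * w k x \<le> 1 / (real k + 1)" by metis
  define good where "good = (\<lambda>k (u :: 'a \<Rightarrow> real). (\<forall>x y. dist x y < e k \<longrightarrow> \<bar>u x - u y\<bar> \<le> max (w k x) (w k y) * dist x y) \<and>
    (\<forall>x\<in>E. u x = 0) \<and> (\<forall>x\<in>F. M \<le> u x))"
  have "\<exists>k u. good k u"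
  proof (rule ccontr)
    assume neg: "\<not> ?thesis"
    have "\<exists>x n. x 0 \<in> E \<and> x n \<in> F \<and> (\<forall>i<n. dist (x i) (x (Suc i)) < e k) \<and>
        (\<Sum>i<n. w k (x i) * dist (x i) (x (Suc i))) \<le> M" for k
    proof -
      obtain u where u: "\<And>x. x \<in> E \<Longrightarrow> u x = 0" "\<And>x. 0 \<le> u x"
        "\<And>x y. dist x y < e k \<Longrightarrow> \<bar>u x - u y\<bar> \<le> max (w k x) (w k y) * dist x y"
        "\<And>y M. u y < M \<Longrightarrow> M \<le> 1 \<Longrightarrow> \<exists>x n. x 0 \<in> E \<and> x n = y \<and> (\<forall>i<n. dist (x i) (x (Suc i)) < e k) \<and>
          (\<Sum>i<n. w k (x i) * dist (x i) (x (Suc i))) < M"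
      proof (rule chain_potential[where w = "w k" and E = E, OF w0 e(1)[of k]], goal_cases)
        case (1 u)
        show ?case by (rule 1(1)[OF 1(2-)])
      qed
      have "\<not> good k u" using neg by blast
      then obtain y where y: "y \<in> F" "u y < M" using u(1,3) by (auto simp: good_def not_le)
      obtain x n where xn: "x 0 \<in> E" "x n = y" "\<forall>i<n. dist (x i) (x (Suc i)) < e k"
        "(\<Sum>i<n. w k (x i) * dist (x i) (x (Suc i))) < M"
        using u(4)[OF y(2) less_imp_le[OF M(2)]] by (elim exE conjE)
      show ?thesis
        by (intro exI[of _ x] exI[of _ n] conjI xn(1,3) less_imp_le[OF xn(4)]) (simp add: xn(2) y(1))
    qed
    then have "\<forall>k. \<exists>x n. x 0 \<in> E \<and> x n \<in> F \<and> (\<forall>i<n. dist (x i) (x (Suc i)) < e k) \<and>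
        (\<Sum>i<n. w k (x i) * dist (x i) (x (Suc i))) \<le> M" ..
    from choice[OF this] obtain x where "\<forall>k. \<exists>n. x k 0 \<in> E \<and> x k n \<in> F \<and>
        (\<forall>i<n. dist (x k i) (x k (Suc i)) < e k) \<and>
        (\<Sum>i<n. w k (x k i) * dist (x k i) (x k (Suc i))) \<le> M" by (elim exE)
    from choice[OF this] obtain n where "\<forall>k. x k 0 \<in> E \<and> x k (n k) \<in> F \<and>
        (\<forall>i<n k. dist (x k i) (x k (Suc i)) < e k) \<and>
        (\<Sum>i<n k. w k (x k i) * dist (x k i) (x k (Suc i))) \<le> M" by (elim exE)
    then have xn: "\<And>k. x k 0 \<in> E" "\<And>k. x k (n k) \<in> F"
      "\<And>k i. i < n k \<Longrightarrow> dist (x k i) (x k (Suc i)) < e k"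
      "\<And>k. (\<Sum>i<n k. w k (x k i) * dist (x k i) (x k (Suc i))) \<le> M" by simp_all
    have small: "w k (x k i) * dist (x k i) (x k (Suc i)) \<le> 1 / (real k + 1)" if "i < n k" for k i
    proof -
      have "w k (x k i) * dist (x k i) (x k (Suc i)) \<le> w k (x k i) * e k"
        using xn(3)[OF that] by (intro mult_left_mono w0) auto
      also have "\<dots> \<le> 1 / (real k + 1)" using e(2)[of k "x k i"] by (simp add: mult.commute)
      finally show ?thesis .
    qed
    obtain g where g: "g 0 \<in> E" "g M \<in> F"
      "\<And>s t. 0 \<le> s \<Longrightarrow> s \<le> t \<Longrightarrow> t \<le> M \<Longrightarrow> c' * dist (g s) (g t) \<le> t - s"
      "\<And>m \<eta>. 0 < \<eta> \<Longrightarrow> \<exists>h>0. \<forall>s t. 0 \<le> s \<longrightarrow> s \<le> t \<longrightarrow> t \<le> M \<longrightarrow> t - s < h \<longrightarrow>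
          (w m (g s) - \<eta>) * dist (g s) (g t) \<le> t - s"
    proof (rule chain_limit_curve[where w = w and x = x and n = n and M = M and c = c', OF X EF wcont c' _ xn(1,2)],
        goal_cases)
      case 1
      show ?case by (rule wmono[OF 1(2)])
    next
      case 2
      show ?case by (rule small[OF 2(2)])
    next
      case 3
      show ?case by (rule xn(4))
    next
      case (4 g)
      show ?case by (rule 4(1)[OF 4(2-)])
    qed
    have lip: "dist (g s) (g t) \<le> 1 / c' * (t - s)" if "0 \<le> s" "s \<le> t" "t \<le> M" for s t
      using g(3)[OF that] c'(1) by (simp add: field_simps)
    have "continuous_on {0..M} g"
    proof (rule lipschitz_on_continuous_on[of "1 / c'"], rule lipschitz_onI)
      fix s t assume "s \<in> {0..M}" "t \<in> {0..M}"
      then show "dist (g s) (g t) \<le> 1 / c' * dist s t"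
        using lip[of s t] lip[of t s] by (cases "s \<le> t") (auto simp: dist_commute dist_real_def)
    qed (use c' in auto)
    then have curve: "is_curve (0, M, g)" using M by (simp add: is_curve_def)
    have "curve_length (0, M, g) \<le> ennreal (1 / c' * (M - 0))"
      using M by (intro curve_length_le_lipschitz lip) auto
    then have "rectifiable (0, M, g)"
      using curve ennreal_less_top le_less_trans unfolding rectifiable_def by blast
    then have "1 \<le> line_integral (0, M, g) \<rho>"
      using curve g(1,2) by (intro adm) (auto simp: connecting_curves_def)
    also have "\<dots> \<le> ennreal M"
    proof -
      let ?P = "arclength_param (0, M, g)" and ?I = "{0..enn2real (curve_length (0, M, g))}"
      have li: "line_integral (0, M, g) (\<lambda>x. ennreal (w k x)) \<le> ennreal M"
        and [measurable]: "(\<lambda>l. ennreal (w k (?P l)) * indicator ?I l) \<in> borel_measurable lborel" for k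
        using line_integral_le_of_local_bound[where w = "w k" and g = g and M = M and c = c', OF M(1) lip wcont c' g(4)] by auto
      \<comment> \<open>The same limit curve serves all weights, so the bound \<open>M\<close> for
        each \<open>w k\<close> passes to their supremum, which lies above \<open>\<rho>\<close>, by
        monotone convergence.\<close>
      have "line_integral (0, M, g) \<rho> \<le> (\<integral>\<^sup>+ l. (SUP k. ennreal (w k (?P l)) * indicator ?I l) \<partial>lborel)"
        unfolding line_integral_def
      proof (rule nn_integral_mono)
        fix l
        show "\<rho> (?P l) * indicator ?I l \<le> (SUP k. ennreal (w k (?P l)) * indicator ?I l)"
          using wsup[of "?P l"] by (simp add: SUP_mult_right_ennreal[symmetric] mult_right_mono)
      qed
      also have "\<dots> = (SUP k. \<integral>\<^sup>+ l. ennreal (w k (?P l)) * indicator ?I l \<partial>lborel)"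
        by (intro nn_integral_monotone_convergence_SUP)
           (auto simp: incseq_def le_fun_def intro!: mult_right_mono ennreal_leI wmono)
      also have "\<dots> \<le> ennreal M"
        using li by (intro SUP_least) (simp add: line_integral_def)
      finally show ?thesis .
    qed
    finally show False using M by (simp add: ennreal_ge_1)
  qed
  then obtain k u where "good k u" by blast
  then show ?thesis
    using that[of "w k" "e k" u] wcont w0 wint e(1) by (auto simp: good_def)
qed

text \<open>For \<open>0 < t < M\<close> the open set \<open>{x. t < u x}\<close> contains
  \<open>F\<close> and misses \<open>{x. u x < t}\<close>, which gives the separation with an
  interior. The frontier of \<open>{x. u x < t}\<close> lies in the level set of \<open>t\<close>,
  so a bound for the integral over the level set suffices.\<close>

lemma separating_integral_bound:
  fixes E F :: "'a::metric_space set" and g :: "'a \<Rightarrow> ennreal" and u w :: "'a \<Rightarrow> real"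
  assumes X: "compact (UNIV :: 'a set)" and N: "N \<ge> 1" and fin: "emeasure (hausdorff N) (UNIV :: 'a set) < top"
    and w: "continuous_on UNIV w" "\<And>x. 0 \<le> w x" and e: "0 < e" and \<eta>: "0 < \<eta>" and M: "0 \<le> M"
    and u: "\<And>x y. dist x y < e \<Longrightarrow> \<bar>u x - u y\<bar> \<le> max (w x) (w y) * dist x y"
      "\<And>x. x \<in> E \<Longrightarrow> u x = 0" "\<And>x. x \<in> F \<Longrightarrow> M \<le> u x"
    and g: "g \<in> borel_measurable borel"
    and adm: "\<And>\<sigma>. \<sigma> \<in> separating_measures N E F \<Longrightarrow> 1 \<le> (\<integral>\<^sup>+ x. g x \<partial>\<sigma>)"
  shows "ennreal M \<le> ennreal (2 * unit_ball_vol (N - 1) / unit_ball_vol N) *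
    (\<integral>\<^sup>+ x. ennreal (w x + \<eta>) * g x \<partial>hausdorff N)"
proof -
  have "bounded (range w)"
    using compact_continuous_image[OF w(1) X] by (rule compact_imp_bounded)
  then obtain B where B: "B > 0" "\<And>x. \<bar>w x\<bar> \<le> B" by (auto simp: bounded_pos)
  have ucont: "continuous_on UNIV u"
    unfolding continuous_on_iff
  proof (intro ballI allI impI)
    fix x :: 'a and r :: real assume "0 < r"
    show "\<exists>d>0. \<forall>x'\<in>UNIV. dist x' x < d \<longrightarrow> dist (u x') (u x) < r"
    proof (intro exI[of _ "min e (r / B)"] conjI ballI impI)
      fix x' assume d: "dist x' x < min e (r / B)"
      then have "\<bar>u x' - u x\<bar> \<le> max (w x') (w x) * dist x' x" by (intro u(1)) simp
      also have "\<dots> \<le> B * dist x' x" using B(2)[of x] B(2)[of x'] by (intro mult_right_mono) auto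
      also have "\<dots> < r" using d B(1) by (simp add: field_simps)
      finally show "dist (u x') (u x) < r" by (simp add: dist_real_def)
    qed (use e \<open>0 < r\<close> B in auto)
  qed
  have wm: "w \<in> borel_measurable borel" and um: "u \<in> borel_measurable borel"
    using w(1) ucont by (auto intro: borel_measurable_continuous_onI)
  let ?K = "ennreal (2 * unit_ball_vol (N - 1) / unit_ball_vol N)"
  obtain h where h: "h \<in> borel_measurable borel"
    "\<And>t. (\<integral>\<^sup>+ x. g x * indicator (u -` {t}) x \<partial>hausdorff (N - 1)) \<le> h t"
    "(\<integral>\<^sup>+ t. h t \<partial>lborel) \<le> ?K * (\<integral>\<^sup>+ x. ennreal (w x + \<eta>) * g x \<partial>hausdorff N)"
    using coarea_weighted[OF N fin wm w(2) e \<eta> um u(1) g] by blast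
  \<comment> \<open>Admissibility speaks of finite measures only. A second use of the coarea
    inequality, with integrand 1, shows that almost every level set has finite measure.\<close>
  obtain k where k: "k \<in> borel_measurable borel"
    "\<And>t. (\<integral>\<^sup>+ x. 1 * indicator (u -` {t}) x \<partial>hausdorff (N - 1)) \<le> k t"
    "(\<integral>\<^sup>+ t. k t \<partial>lborel) \<le> ?K * (\<integral>\<^sup>+ x. ennreal (w x + \<eta>) * 1 \<partial>hausdorff N)"
    using coarea_weighted[OF N fin wm w(2) e \<eta> um u(1), of "\<lambda>_. 1"] by auto
  have "(\<integral>\<^sup>+ x. ennreal (w x + \<eta>) * 1 \<partial>hausdorff N) \<le> (\<integral>\<^sup>+ x. ennreal (B + \<eta>) \<partial>(hausdorff N :: 'a measure))"
    using B(2) by (intro nn_integral_mono) (auto intro!: ennreal_leI simp del: ennreal_plus simp: abs_le_iff)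
  also have "\<dots> < top" using fin by (simp add: ennreal_mult_less_top)
  finally have "?K * (\<integral>\<^sup>+ x. ennreal (w x + \<eta>) * 1 \<partial>hausdorff N) < top"
    by (simp add: ennreal_mult_less_top)
  then have "(\<integral>\<^sup>+ t. k t \<partial>lborel) \<noteq> \<infinity>" using k(3) by auto
  then have kfin: "AE t in lborel. k t \<noteq> \<infinity>"
    using k(1) by (intro nn_integral_PInf_AE) auto
  have h1: "1 \<le> h t" if t: "0 < t" "t < M" and kt: "k t \<noteq> \<infinity>" for t
  proof -
    define U where "U = {x. u x < t}"
    define \<sigma> where "\<sigma> = density (hausdorff (N - 1)) (indicator (frontier U))"
    have opens: "open U" "open {x. t < u x}"
      unfolding U_def using ucont by (auto intro!: open_Collect_less continuous_intros)
    have "closed {x. u x \<le> t}" using ucont by (auto intro!: closed_Collect_le continuous_intros)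
    then have "closure U \<subseteq> {x. u x \<le> t}" by (intro closure_minimal) (auto simp: U_def)
    then have fr: "frontier U \<subseteq> u -` {t}"
      using opens(1) by (auto simp: frontier_def interior_open U_def)
    have frm [measurable]: "frontier U \<in> sets borel" by (simp add: frontier_closed borel_closed)
    have ind: "indicator (frontier U) \<in> borel_measurable (hausdorff (N - 1) :: 'a measure)" by measurable
    have "emeasure \<sigma> (space \<sigma>) = (\<integral>\<^sup>+ x. indicator (frontier U) x \<partial>hausdorff (N - 1))"
      unfolding \<sigma>_def by (subst emeasure_density) (auto intro!: nn_integral_cong)
    also have "\<dots> \<le> (\<integral>\<^sup>+ x. 1 * indicator (u -` {t}) x \<partial>hausdorff (N - 1))"
      using fr by (intro nn_integral_mono) (auto split: split_indicator)
    also have "\<dots> \<le> k t" by (rule k(2))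
    finally have "finite_measure \<sigma>" using kt by (intro finite_measureI) (auto simp: top_unique)
    moreover have "E \<subseteq> U" using u(2) t by (auto simp: U_def)
    moreover have "F \<subseteq> interior (- U)"
    proof -
      have "{x. t < u x} \<subseteq> interior (- U)" using opens(2) by (intro interior_maximal) (auto simp: U_def)
      then show ?thesis using u(3) t by (auto intro: less_le_trans)
    qed
    ultimately have "\<sigma> \<in> separating_measures N E F"
      unfolding separating_measures_def \<sigma>_def using opens(1) by blast
    then have "1 \<le> (\<integral>\<^sup>+ x. g x \<partial>\<sigma>)" by (rule adm)
    also have "\<dots> = (\<integral>\<^sup>+ x. indicator (frontier U) x * g x \<partial>hausdorff (N - 1))"
      unfolding \<sigma>_def using g ind by (intro nn_integral_density) auto
    also have "\<dots> \<le> (\<integral>\<^sup>+ x. g x * indicator (u -` {t}) x \<partial>hausdorff (N - 1))"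
      using fr by (intro nn_integral_mono) (auto split: split_indicator)
    also have "\<dots> \<le> h t" by (rule h(2))
    finally show ?thesis .
  qed
  have "ennreal M = (\<integral>\<^sup>+ t. indicator {0<..<M} t \<partial>lborel)" using M by simp
  also have "\<dots> \<le> (\<integral>\<^sup>+ t. h t \<partial>lborel)"
    using kfin by (intro nn_integral_mono_AE) (auto elim!: eventually_mono simp: h1 split: split_indicator)
  also note h(3)
  finally show ?thesis .
qed

text \<open>One parameter \<open>\<epsilon>\<close> plays three roles: the height reached by the
  potential is \<open>1 - \<epsilon>\<close>, the approximation of \<open>\<rho>\<close> costs
  \<open>\<epsilon>\<close>, and the slices of the weight have thickness \<open>\<epsilon>\<close>.
  All three errors disappear in the limit.\<close>

lemma admissible_product_bound:
  fixes E F :: "'a::metric_space set" and \<rho> g :: "'a \<Rightarrow> ennreal"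
  assumes X: "compact (UNIV :: 'a set)" and N: "N \<ge> 1" and fin: "emeasure (hausdorff N) (UNIV :: 'a set) < top"
    and EF: "closed E" "closed F" and pq: "1 < p" "1 < q" "1 / p + 1 / q = 1" and ab: "0 < a" "0 < b"
    and \<rho>: "\<rho> \<in> borel_measurable borel" "(\<integral>\<^sup>+ x. \<rho> x epowr p \<partial>hausdorff N) \<le> ennreal a"
      "\<And>c. c \<in> connecting_curves E F \<Longrightarrow> rectifiable c \<Longrightarrow> 1 \<le> line_integral c \<rho>"
    and g: "g \<in> borel_measurable borel" "(\<integral>\<^sup>+ x. g x epowr q \<partial>hausdorff N) \<le> ennreal b"
      "\<And>\<sigma>. \<sigma> \<in> separating_measures N E F \<Longrightarrow> 1 \<le> (\<integral>\<^sup>+ x. g x \<partial>\<sigma>)"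
  shows "unit_ball_vol N / (2 * unit_ball_vol (N - 1)) \<le> a powr (1 / p) * b powr (1 / q)"
proof -
  \<comment> \<open>The added 1 keeps \<open>V\<close> positive, as Hoelder's inequality above
    requires, even if the total mass is 0.\<close>
  define V where "V = measure (hausdorff N) (UNIV :: 'a set) + 1"
  have V: "0 < V" "emeasure (hausdorff N) (UNIV :: 'a set) \<le> ennreal V"
    using fin by (auto simp: V_def measure_def add_nonneg_pos less_top intro: order_trans[OF _ ennreal_leI])
  define K where "K = 2 * unit_ball_vol (N - 1) / unit_ball_vol N"
  have vpos: "0 < unit_ball_vol N" "0 < unit_ball_vol (N - 1)" using N by auto
  then have K: "0 < K" by (simp add: K_def)
  \<comment> \<open>The summand with \<open>V\<close> comes from Hoelder's inequality for the
    constant 1 and \<open>g\<close>, which handles the part \<open>\<epsilon> * g\<close> of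
    \<open>(w + \<epsilon>) * g\<close>.\<close>
  define \<Phi> where "\<Phi> = (\<lambda>\<epsilon>. K * (((a + \<epsilon>) powr (1 / p) + \<epsilon> * V powr (1 / p)) * b powr (1 / q)))"
  have key: "1 - \<epsilon> \<le> \<Phi> \<epsilon>" if \<epsilon>: "0 < \<epsilon>" "\<epsilon> < 1" for \<epsilon>
  proof -
    have M: "0 \<le> 1 - \<epsilon>" "1 - \<epsilon> < 1" using \<epsilon> by auto
    obtain w u :: "'a \<Rightarrow> real" and e where w: "continuous_on UNIV w" "\<And>x. 0 \<le> w x"
      "(\<integral>\<^sup>+ x. ennreal (w x) epowr p \<partial>hausdorff N) \<le> (\<integral>\<^sup>+ x. \<rho> x epowr p \<partial>hausdorff N) + ennreal \<epsilon>"
      and u: "0 < e" "\<And>x y. dist x y < e \<Longrightarrow> \<bar>u x - u y\<bar> \<le> max (w x) (w y) * dist x y"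
      "\<And>x. x \<in> E \<Longrightarrow> u x = 0" "\<And>x. x \<in> F \<Longrightarrow> 1 - \<epsilon> \<le> u x"
    proof (rule admissible_potential[OF X fin EF pq(1) M \<epsilon>(1) \<rho>(1)], goal_cases)
      case 1
      show ?case by (rule \<rho>(3)[OF 1(2,3)])
    next
      case (2 w e u)
      show ?case by (rule 2(1)[OF 2(2-)])
    qed
    have wm [measurable]: "w \<in> borel_measurable borel" using w(1) by (rule borel_measurable_continuous_onI)
    note [measurable] = g(1)
    have "ennreal (1 - \<epsilon>) \<le> ennreal K * (\<integral>\<^sup>+ x. ennreal (w x + \<epsilon>) * g x \<partial>hausdorff N)"
      unfolding K_def
      by (rule separating_integral_bound[OF X N fin w(1,2) u(1) \<epsilon>(1) _ u(2-4) g(1,3)]) (use \<epsilon> in auto)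
    also have "(\<integral>\<^sup>+ x. ennreal (w x + \<epsilon>) * g x \<partial>hausdorff N) =
      (\<integral>\<^sup>+ x. ennreal (w x) * g x + ennreal \<epsilon> * (1 * g x) \<partial>hausdorff N)"
      using w(2) \<epsilon> by (intro nn_integral_cong) (simp add: distrib_right)
    also have "\<dots> = (\<integral>\<^sup>+ x. ennreal (w x) * g x \<partial>hausdorff N) + ennreal \<epsilon> * (\<integral>\<^sup>+ x. 1 * g x \<partial>hausdorff N)"
      by (simp add: nn_integral_add nn_integral_cmult)
    also have "\<dots> \<le> ennreal ((a + \<epsilon>) powr (1 / p) * b powr (1 / q)) + ennreal \<epsilon> * ennreal (V powr (1 / p) * b powr (1 / q))"
    proof (intro add_mono mult_left_mono Holder_nn_integral pq)
      show "(\<integral>\<^sup>+ x. ennreal (w x) epowr p \<partial>hausdorff N) \<le> ennreal (a + \<epsilon>)"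
        using w(3) \<rho>(2) ab \<epsilon> by (simp add: order_trans[OF _ add_right_mono])
      have "(1::ennreal) epowr p = 1" by (simp add: ennreal_powr_def)
      then show "(\<integral>\<^sup>+ x. 1 epowr p \<partial>(hausdorff N :: 'a measure)) \<le> ennreal V" using V by simp
    qed (use ab \<epsilon> V g in auto)
    also have "\<dots> = ennreal (((a + \<epsilon>) powr (1 / p) + \<epsilon> * V powr (1 / p)) * b powr (1 / q))"
      using \<epsilon> by (simp add: ennreal_mult[symmetric] distrib_right mult.assoc flip: ennreal_plus)
    finally have "ennreal (1 - \<epsilon>) \<le> ennreal K * ennreal (((a + \<epsilon>) powr (1 / p) + \<epsilon> * V powr (1 / p)) * b powr (1 / q))"
      by (simp add: mult_left_mono)
    also have "\<dots> = ennreal (\<Phi> \<epsilon>)" using K \<epsilon> by (simp add: \<Phi>_def ennreal_mult)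
    finally show ?thesis using K \<epsilon> by (subst (asm) ennreal_le_iff) (auto simp: \<Phi>_def)
  qed
  have "((\<lambda>\<epsilon>. 1 - \<epsilon> :: real) \<longlongrightarrow> 1 - 0) (at_right 0)"
    by (rule tendsto_diff[OF tendsto_const tendsto_ident_at])
  moreover have "(\<Phi> \<longlongrightarrow> K * (((a + 0) powr (1 / p) + 0 * V powr (1 / p)) * b powr (1 / q))) (at_right 0)"
    unfolding \<Phi>_def using ab by (intro tendsto_intros) auto
  moreover have "\<forall>\<^sub>F \<epsilon> in at_right 0. 1 - \<epsilon> \<le> \<Phi> \<epsilon>"
    using eventually_at_right_real[of 0 1] by (auto elim!: eventually_mono simp: key)
  ultimately have "1 - 0 \<le> K * (((a + 0) powr (1 / p) + 0 * V powr (1 / p)) * b powr (1 / q))"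
    using tendsto_le[OF trivial_limit_at_right_real] by blast
  then show ?thesis using vpos by (simp add: K_def field_simps)
qed

text \<open>With \<open>d\<close> a positive lower bound for the distance between the sets,
  connecting curves have length at least \<open>d\<close>, so the constant \<open>1 / d\<close> is
  admissible. Finiteness matters because \<open>top * 0 = 0\<close> in \<open>ennreal\<close>: an
  infinite curve modulus together with a vanishing surface modulus would violate the product
  inequality.\<close>

lemma Mod_curves_finite:
  fixes E F :: "'a::metric_space set"
  assumes fin: "emeasure (hausdorff N) (UNIV :: 'a set) < top" and "compact E" "compact F" "E \<inter> F = {}"
  shows "Mod_curves N p (connecting_curves E F) < top"
proof -
  obtain d where d: "d > 0" "\<And>x y. x \<in> E \<Longrightarrow> y \<in> F \<Longrightarrow> d \<le> dist x y"
  proof (cases "E = {} \<or> F = {}")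
    case False
    then obtain x0 where x0: "x0 \<in> E" "\<forall>x\<in>E. infdist x0 F \<le> infdist x F"
      using continuous_attains_inf[OF assms(2) _ continuous_on_infdist[OF continuous_on_id], of F] by blast
    have "infdist x0 F \<noteq> 0"
      using in_closed_iff_infdist_zero[OF compact_imp_closed[OF assms(3)], of x0] x0(1) False assms(4) by auto
    moreover have "infdist x0 F \<le> dist x y" if "x \<in> E" "y \<in> F" for x y
      using x0(2) that infdist_le[OF that(2), of x] by force
    ultimately show ?thesis using that[of "infdist x0 F"] infdist_nonneg[of x0 F] by auto
  qed (use that[of 1] in auto)
  have "1 \<le> line_integral c (\<lambda>_. ennreal (1 / d))" if c: "c \<in> connecting_curves E F" "rectifiable c" for c
  proof -
    obtain a b \<gamma> where abg: "c = (a, b, \<gamma>)" "a \<le> b" "\<gamma> a \<in> E" "\<gamma> b \<in> F"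
      using c(1) by (auto simp: connecting_curves_def is_curve_def)
    define l where "l = enn2real (curve_length c)"
    have cl: "curve_length c = ennreal l" using c(2) by (simp add: l_def rectifiable_def)
    have "ennreal d \<le> ennreal (dist (\<gamma> a) (\<gamma> b))" using d(2)[OF abg(3,4)] by (rule ennreal_leI)
    also have "\<dots> \<le> ennreal l" using dist_le_curve_length[OF abg(2), of \<gamma>] by (simp add: cl flip: abg(1))
    finally have "d \<le> l" using d(1) by (simp add: l_def)
    have "1 \<le> ennreal (1 / d * l)" using \<open>d \<le> l\<close> d(1) by (simp add: ennreal_ge_1)
    also have "\<dots> = line_integral c (\<lambda>_. ennreal (1 / d))"
      unfolding line_integral_def l_def[symmetric] using d(1) \<open>d \<le> l\<close>
      by (simp add: nn_integral_cmult_indicator ennreal_mult[symmetric])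
    finally show ?thesis .
  qed
  then have "Mod_curves N p (connecting_curves E F) \<le> (\<integral>\<^sup>+ x. ennreal (1 / d) epowr p \<partial>(hausdorff N :: 'a measure))"
    unfolding Mod_curves_def by (intro INF_lower) auto
  also have "\<dots> < top" using fin by (simp add: ennreal_powr_def ennreal_mult_less_top)
  finally show ?thesis .
qed

theorem theorem1p1:
  fixes N p q :: real and E F :: "'a::metric_space set"
  assumes "N \<ge> 1"
    and "compact (UNIV :: 'a set)"
    and "emeasure (hausdorff N) (UNIV :: 'a set) < \<infinity>"
    and "1 < p" and "1 < q" and "1 / p + 1 / q = 1"
    and "continuum E" and "continuum F" and "E \<inter> F = {}"
  shows "(Mod_curves N p (connecting_curves E F) > 0 \<longrightarrow>
            (Mod_curves N p (connecting_curves E F)) epowr (1 / p) *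
            (Mod_measures N q (separating_measures N E F)) epowr (1 / q)
              \<ge> ennreal (unit_ball_vol N / (2 * unit_ball_vol (N - 1)))) \<and>
         (Mod_curves N p (connecting_curves E F) = 0 \<longrightarrow>
            Mod_measures N q (separating_measures N E F) = \<infinity>)"
proof -
  let ?A = "Mod_curves N p (connecting_curves E F)"
  let ?B = "Mod_measures N q (separating_measures N E F)"
  let ?v = "unit_ball_vol N / (2 * unit_ball_vol (N - 1))"
  have fin: "emeasure (hausdorff N) (UNIV :: 'a set) < top" using assms(3) by simp
  have EF: "compact E" "compact F" using assms(7,8) by (auto simp: continuum_def)
  obtain \<alpha> where \<alpha>: "0 \<le> \<alpha>" "?A = ennreal \<alpha>"
    using Mod_curves_finite[OF fin EF assms(9), of p] by (cases ?A) auto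
  \<comment> \<open>Serves both claims: if the curve modulus is 0, a finite surface modulus would
    give \<open>?v \<le> 0\<close>, so only \<open>\<infinity>\<close> is left.\<close>
  have bound: "?v \<le> \<alpha> powr (1 / p) * \<beta> powr (1 / q)" if \<beta>: "0 \<le> \<beta>" "?B = ennreal \<beta>" for \<beta>
  proof -
    \<comment> \<open>The infima need not be attained, and \<open>\<alpha>\<close> or
      \<open>\<beta>\<close> may be 0 while the bound for admissible pairs asks for positive
      numbers; adding \<open>\<epsilon>\<close> settles both.\<close>
    have "?v \<le> (\<alpha> + \<epsilon>) powr (1 / p) * (\<beta> + \<epsilon>) powr (1 / q)" if "0 < \<epsilon>" for \<epsilon>
    proof -
      have "?A < ennreal (\<alpha> + \<epsilon>)" "?B < ennreal (\<beta> + \<epsilon>)"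
        using \<alpha> \<beta> that by (simp_all add: ennreal_less_iff del: ennreal_plus)
      then obtain \<rho> g where
        "\<rho> \<in> borel_measurable borel" "\<forall>c\<in>connecting_curves E F. rectifiable c \<longrightarrow> line_integral c \<rho> \<ge> 1"
        "(\<integral>\<^sup>+ x. \<rho> x epowr p \<partial>hausdorff N) < ennreal (\<alpha> + \<epsilon>)"
        "g \<in> borel_measurable borel" "\<forall>\<sigma>\<in>separating_measures N E F. (\<integral>\<^sup>+ x. g x \<partial>\<sigma>) \<ge> 1"
        "(\<integral>\<^sup>+ x. g x epowr q \<partial>hausdorff N) < ennreal (\<beta> + \<epsilon>)"
        unfolding Mod_curves_def Mod_measures_def INF_less_iff by blast
      then show ?thesis
        using \<alpha> \<beta> that
        by (intro admissible_product_bound[where \<rho> = \<rho> and g = g and E = E and F = F])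
           (auto intro: assms fin EF compact_imp_closed less_imp_le)
    qed
    then have "\<forall>\<^sub>F \<epsilon> in at_right 0. ?v \<le> (\<alpha> + \<epsilon>) powr (1 / p) * (\<beta> + \<epsilon>) powr (1 / q)"
      using eventually_at_right_real[of 0 1] by (auto elim!: eventually_mono)
    \<comment> \<open>At base 0 the convergence relies on the positive exponent and on the base
      approaching from the right.\<close>
    moreover have lim: "((\<lambda>\<epsilon>. (r + \<epsilon>) powr (1 / s)) \<longlongrightarrow> (r + 0) powr (1 / s)) (at_right 0)"
      if "0 \<le> r" "1 < s" for r s :: real
      using that eventually_at_right_real[of 0 1]
      by (intro tendsto_powr' tendsto_intros) (auto elim!: eventually_mono)
    then have "((\<lambda>\<epsilon>. (\<alpha> + \<epsilon>) powr (1 / p) * (\<beta> + \<epsilon>) powr (1 / q)) \<longlongrightarrow>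
        (\<alpha> + 0) powr (1 / p) * (\<beta> + 0) powr (1 / q)) (at_right 0)"
      using \<alpha> \<beta> assms by (intro tendsto_mult lim) auto
    ultimately have "?v \<le> (\<alpha> + 0) powr (1 / p) * (\<beta> + 0) powr (1 / q)"
      by (intro tendsto_lowerbound) auto
    then show ?thesis by simp
  qed
  have v: "0 < ?v" using assms(1) by simp
  show ?thesis
  proof (cases ?B)
    case (real \<beta>)
    with bound[of \<beta>] have le: "?v \<le> \<alpha> powr (1 / p) * \<beta> powr (1 / q)" by simp
    then have "\<alpha> \<noteq> 0" using v by auto
    then show ?thesis
      using le \<alpha> real by (auto simp: ennreal_powr_def ennreal_mult[symmetric] intro!: ennreal_leI)
  next
    case top
    then show ?thesis
      using \<alpha> by (auto simp: ennreal_powr_def ennreal_mult_top ennreal_eq_0_iff)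
  qed
qed

end
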